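(* Let $\mathcal{E}$ be an elementary topos with a natural numbers object $(N,0,\mathrm{S})$ and let $\varphi$ be an axiom of Heyting arithmetic $\mathbf{HA}$. Then, under the standard interpretation of $\varphi$ on $N$, $\mathcal{E}\models\forall\mathbb{P}\subseteq\mathrm{Lop}\ \forall j\in\mathrm{Lop}.\ j\Vdash_{\mathbb{P}}\varphi$.
   Context: $\mathcal{E}$ is an elementary topos with subobject classifier $\Omega$; formulas are terms of type $\Omega$ of its internal intuitionistic higher-order type theory and $\mathcal{E}\models\varphi$ means the interpretation of $\varphi$ is the top subobject. The language of arithmetic has $0$, successor $\mathrm{S}$ and function symbols for all primitive recursive functions; $\mathbf{HA}$ consists of $\forall x\neg(\mathrm{S}x=0)$, the defining equations of the primitive recursive functions and the induction scheme, over intuitionistic logic. The standard interpretation turns an arithmetic formula into an internal formula whose variables range over $N$ (function symbols interpreted by the corresponding morphisms $N^m\to N$, equality by equality on $N$); this is an $\mathcal{L}_N$-formula. For $j:P\Omega$ write $jp$ for $p\in j$; $\mathrm{is\text{-}lop}[j]:=\forall p.(p\to jp)\wedge\forall p.(j(jp)\to jp)\wedge\forall p,q.((p\to q)\to(jp\to jq))$; $\mathrm{Lop}:=\{j:P\Omega\mid\mathrm{is\text{-}lop}[j]\}$; $j\le k:=\forall p{:}\Omega.(jp\to kp)$; for $\mathbb{P}:P(P\Omega)$, $\mathbb{P}\subseteq\mathrm{Lop}$ means every element of $\mathbb{P}$ lies in $\mathrm{Lop}$, and $\forall k\ge_{\mathbb{P}}j.\chi:=\forall k{:}P\Omega.(k\in\mathbb{P}\to(j\le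 k\to\chi))$. For an object $X$, $\mathcal{L}_X$-formulas are built from atomic $R[\vec x]$ ($R:X^m\to\Omega$ a morphism, including $\bot$) by $\wedge,\vee,\to,\exists x{:}X,\forall x{:}X$. The translation $j\Vdash_{\mathbb{P}}\varphi$: $j\Vdash_{\mathbb{P}}R:=jR$; $\wedge$ componentwise; $j\Vdash_{\mathbb{P}}(\varphi\vee\psi):=j((j\Vdash_{\mathbb{P}}\varphi)\vee(j\Vdash_{\mathbb{P}}\psi))$; $j\Vdash_{\mathbb{P}}(\varphi\to\psi):=\forall k\ge_{\mathbb{P}}j.((k\Vdash_{\mathbb{P}}\varphi)\to(k\Vdash_{\mathbb{P}}\psi))$; $j\Vdash_{\mathbb{P}}\exists y.\varphi:=j(\exists y.\,j\Vdash_{\mathbb{P}}\varphi)$; $j\Vdash_{\mathbb{P}}\forall y.\varphi:=\forall k\ge_{\mathbb{P}}j\,\forall y.\,k\Vdash_{\mathbb{P}}\varphi$. *)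

theory Defs
  imports Main
begin

section \<open>Elementary toposes with chosen structure\<close>

record ('o, 'a) topos =
  Obj :: "'o set"
  Arr :: "'a set"
  Dom :: "'a \<Rightarrow> 'o"
  Cod :: "'a \<Rightarrow> 'o"
  Idt :: "'o \<Rightarrow> 'a"
  Cmp :: "'a \<Rightarrow> 'a \<Rightarrow> 'a" (infixr "\<cdot>\<index>" 75)
  One :: "'o"
  Prod :: "'o \<Rightarrow> 'o \<Rightarrow> 'o"
  Fst :: "'o \<Rightarrow> 'o \<Rightarrow> 'a"
  Snd :: "'o \<Rightarrow> 'o \<Rightarrow> 'a"
  Exp :: "'o \<Rightarrow> 'o \<Rightarrow> 'o"
  Ev :: "'o \<Rightarrow> 'o \<Rightarrow> 'a"
  Omega :: "'o"
  Tru :: "'a"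

text \<open>\<open>Exp E A B\<close> is the exponential \<open>B\<^sup>A\<close>, and \<open>Ev E A B\<close> is the evaluation
  \<open>B\<^sup>A \<times> A \<rightarrow> B\<close>.\<close>

definition Hom :: "('o, 'a) topos \<Rightarrow> 'o \<Rightarrow> 'o \<Rightarrow> 'a set" where
  "Hom E A B = {f \<in> Arr E. Dom E f = A \<and> Cod E f = B}"

definition monic :: "('o, 'a) topos \<Rightarrow> 'a \<Rightarrow> bool" where
  "monic E m \<longleftrightarrow> m \<in> Arr E \<and>
     (\<forall>D\<in>Obj E. \<forall>f\<in>Hom E D (Dom E m). \<forall>g\<in>Hom E D (Dom E m).
        m \<cdot>\<^bsub>E\<^esub> f = m \<cdot>\<^bsub>E\<^esub> g \<longrightarrow> f = g)"

definition bang :: "('o, 'a) topos \<Rightarrow> 'o \<Rightarrow> 'a" where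
  "bang E A = (THE f. f \<in> Hom E A (One E))"

definition pair :: "('o, 'a) topos \<Rightarrow> 'a \<Rightarrow> 'a \<Rightarrow> 'a" where
  "pair E f g = (THE h. h \<in> Hom E (Dom E f) (Prod E (Cod E f) (Cod E g)) \<and>
     Fst E (Cod E f) (Cod E g) \<cdot>\<^bsub>E\<^esub> h = f \<and> Snd E (Cod E f) (Cod E g) \<cdot>\<^bsub>E\<^esub> h = g)"

definition uncurried :: "('o, 'a) topos \<Rightarrow> 'o \<Rightarrow> 'o \<Rightarrow> 'o \<Rightarrow> 'a \<Rightarrow> 'a" where
  "uncurried E C A B h = Ev E A B \<cdot>\<^bsub>E\<^esub> pair E (h \<cdot>\<^bsub>E\<^esub> Fst E C A) (Snd E C A)"

definition curried :: "('o, 'a) topos \<Rightarrow> 'o \<Rightarrow> 'o \<Rightarrow> 'o \<Rightarrow> 'a \<Rightarrow> 'a" where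
  "curried E C A B f = (THE h. h \<in> Hom E C (Exp E A B) \<and> uncurried E C A B h = f)"

definition true_at :: "('o, 'a) topos \<Rightarrow> 'o \<Rightarrow> 'a" where
  "true_at E A = Tru E \<cdot>\<^bsub>E\<^esub> bang E A"

text \<open>\<open>classifies E m \<chi>\<close>: the square with sides \<open>m\<close>, \<open>!\<close>, \<open>\<chi>\<close> and \<open>true\<close> is a pullback.\<close>

definition classifies :: "('o, 'a) topos \<Rightarrow> 'a \<Rightarrow> 'a \<Rightarrow> bool" where
  "classifies E m \<chi> \<longleftrightarrow> m \<in> Arr E \<and> \<chi> \<in> Hom E (Cod E m) (Omega E) \<and>
     \<chi> \<cdot>\<^bsub>E\<^esub> m = true_at E (Dom E m) \<and>
     (\<forall>D\<in>Obj E. \<forall>f\<in>Hom E D (Cod E m). \<chi> \<cdot>\<^bsub>E\<^esub> f = true_at E D \<longrightarrow>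
        (\<exists>!g. g \<in> Hom E D (Dom E m) \<and> m \<cdot>\<^bsub>E\<^esub> g = f))"

locale elementary_topos =
  fixes E :: "('o, 'a) topos"
  assumes dom_obj: "f \<in> Arr E \<Longrightarrow> Dom E f \<in> Obj E"
    and cod_obj: "f \<in> Arr E \<Longrightarrow> Cod E f \<in> Obj E"
    and id_hom: "A \<in> Obj E \<Longrightarrow> Idt E A \<in> Hom E A A"
    and comp_hom: "f \<in> Hom E A B \<Longrightarrow> g \<in> Hom E B C \<Longrightarrow> g \<cdot>\<^bsub>E\<^esub> f \<in> Hom E A C"
    and id_left: "f \<in> Hom E A B \<Longrightarrow> Idt E B \<cdot>\<^bsub>E\<^esub> f = f"
    and id_right: "f \<in> Hom E A B \<Longrightarrow> f \<cdot>\<^bsub>E\<^esub> Idt E A = f"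
    and comp_assoc: "f \<in> Hom E A B \<Longrightarrow> g \<in> Hom E B C \<Longrightarrow> h \<in> Hom E C D \<Longrightarrow>
        (h \<cdot>\<^bsub>E\<^esub> g) \<cdot>\<^bsub>E\<^esub> f = h \<cdot>\<^bsub>E\<^esub> (g \<cdot>\<^bsub>E\<^esub> f)"
    and one_obj: "One E \<in> Obj E"
    and terminal: "A \<in> Obj E \<Longrightarrow> \<exists>!f. f \<in> Hom E A (One E)"
    and prod_obj: "A \<in> Obj E \<Longrightarrow> B \<in> Obj E \<Longrightarrow> Prod E A B \<in> Obj E"
    and fst_hom: "A \<in> Obj E \<Longrightarrow> B \<in> Obj E \<Longrightarrow> Fst E A B \<in> Hom E (Prod E A B) A"
    and snd_hom: "A \<in> Obj E \<Longrightarrow> B \<in> Obj E \<Longrightarrow> Snd E A B \<in> Hom E (Prod E A B) B"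
    and product: "f \<in> Hom E C A \<Longrightarrow> g \<in> Hom E C B \<Longrightarrow>
        \<exists>!h. h \<in> Hom E C (Prod E A B) \<and> Fst E A B \<cdot>\<^bsub>E\<^esub> h = f \<and> Snd E A B \<cdot>\<^bsub>E\<^esub> h = g"
    and equalizer: "f \<in> Hom E A B \<Longrightarrow> g \<in> Hom E A B \<Longrightarrow>
        \<exists>e\<in>Arr E. Cod E e = A \<and> f \<cdot>\<^bsub>E\<^esub> e = g \<cdot>\<^bsub>E\<^esub> e \<and>
          (\<forall>D\<in>Obj E. \<forall>h\<in>Hom E D A. f \<cdot>\<^bsub>E\<^esub> h = g \<cdot>\<^bsub>E\<^esub> h \<longrightarrow>
             (\<exists>!k. k \<in> Hom E D (Dom E e) \<and> e \<cdot>\<^bsub>E\<^esub> k = h))"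
    and exp_obj: "A \<in> Obj E \<Longrightarrow> B \<in> Obj E \<Longrightarrow> Exp E A B \<in> Obj E"
    and ev_hom: "A \<in> Obj E \<Longrightarrow> B \<in> Obj E \<Longrightarrow> Ev E A B \<in> Hom E (Prod E (Exp E A B) A) B"
    and exponential: "A \<in> Obj E \<Longrightarrow> B \<in> Obj E \<Longrightarrow> C \<in> Obj E \<Longrightarrow> f \<in> Hom E (Prod E C A) B \<Longrightarrow>
        \<exists>!h. h \<in> Hom E C (Exp E A B) \<and> uncurried E C A B h = f"
    and omega_obj: "Omega E \<in> Obj E"
    and true_hom: "Tru E \<in> Hom E (One E) (Omega E)"
    and classifier: "monic E m \<Longrightarrow> \<exists>!\<chi>. classifies E m \<chi>"

definition pw :: "('o, 'a) topos \<Rightarrow> 'o \<Rightarrow> 'o" where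
  "pw E X = Exp E X (Omega E)"

definition nno :: "('o, 'a) topos \<Rightarrow> 'o \<Rightarrow> 'a \<Rightarrow> 'a \<Rightarrow> bool" where
  "nno E N z s \<longleftrightarrow> N \<in> Obj E \<and> z \<in> Hom E (One E) N \<and> s \<in> Hom E N N \<and>
     (\<forall>A\<in>Obj E. \<forall>a\<in>Hom E (One E) A. \<forall>f\<in>Hom E A A.
        \<exists>!h. h \<in> Hom E N A \<and> h \<cdot>\<^bsub>E\<^esub> z = a \<and> h \<cdot>\<^bsub>E\<^esub> s = f \<cdot>\<^bsub>E\<^esub> h)"


section \<open>Heyting operations on subobjects\<close>

text \<open>Subobjects of \<open>G\<close> are represented by their characteristic morphisms \<open>G \<rightarrow> \<Omega>\<close>. A morphism
  \<open>f\<close> into \<open>G\<close> factors through the subobject classified by \<open>\<phi>\<close> iff \<open>\<phi> \<circ> f\<close> is \<open>true\<close>; hence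
  \<open>sub_le\<close> is inclusion of subobjects. The logical operations are given by their universal
  properties in this order; the quantifiers are the adjoints of pulling back along the
  projection \<open>G \<times> X \<rightarrow> G\<close>.\<close>

definition sub_le :: "('o, 'a) topos \<Rightarrow> 'o \<Rightarrow> 'a \<Rightarrow> 'a \<Rightarrow> bool" where
  "sub_le E G \<phi> \<psi> \<longleftrightarrow> (\<forall>D\<in>Obj E. \<forall>f\<in>Hom E D G.
     \<phi> \<cdot>\<^bsub>E\<^esub> f = true_at E D \<longrightarrow> \<psi> \<cdot>\<^bsub>E\<^esub> f = true_at E D)"

definition sub_bot :: "('o, 'a) topos \<Rightarrow> 'o \<Rightarrow> 'a" where
  "sub_bot E G = (THE c. c \<in> Hom E G (Omega E) \<and>
     (\<forall>d\<in>Hom E G (Omega E). sub_le E G c d))"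

definition sub_meet :: "('o, 'a) topos \<Rightarrow> 'o \<Rightarrow> 'a \<Rightarrow> 'a \<Rightarrow> 'a" where
  "sub_meet E G \<phi> \<psi> = (THE c. c \<in> Hom E G (Omega E) \<and>
     (\<forall>d\<in>Hom E G (Omega E). sub_le E G d c \<longleftrightarrow> sub_le E G d \<phi> \<and> sub_le E G d \<psi>))"

definition sub_join :: "('o, 'a) topos \<Rightarrow> 'o \<Rightarrow> 'a \<Rightarrow> 'a \<Rightarrow> 'a" where
  "sub_join E G \<phi> \<psi> = (THE c. c \<in> Hom E G (Omega E) \<and>
     (\<forall>d\<in>Hom E G (Omega E). sub_le E G c d \<longleftrightarrow> sub_le E G \<phi> d \<and> sub_le E G \<psi> d))"

definition sub_imp :: "('o, 'a) topos \<Rightarrow> 'o \<Rightarrow> 'a \<Rightarrow> 'a \<Rightarrow> 'a" where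
  "sub_imp E G \<phi> \<psi> = (THE c. c \<in> Hom E G (Omega E) \<and>
     (\<forall>d\<in>Hom E G (Omega E). sub_le E G d c \<longleftrightarrow> sub_le E G (sub_meet E G d \<phi>) \<psi>))"

definition sub_all :: "('o, 'a) topos \<Rightarrow> 'o \<Rightarrow> 'o \<Rightarrow> 'a \<Rightarrow> 'a" where
  "sub_all E G X \<phi> = (THE c. c \<in> Hom E G (Omega E) \<and>
     (\<forall>d\<in>Hom E G (Omega E). sub_le E G d c \<longleftrightarrow> sub_le E (Prod E G X) (d \<cdot>\<^bsub>E\<^esub> Fst E G X) \<phi>))"

definition sub_ex :: "('o, 'a) topos \<Rightarrow> 'o \<Rightarrow> 'o \<Rightarrow> 'a \<Rightarrow> 'a" where
  "sub_ex E G X \<phi> = (THE c. c \<in> Hom E G (Omega E) \<and>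
     (\<forall>d\<in>Hom E G (Omega E). sub_le E G c d \<longleftrightarrow> sub_le E (Prod E G X) \<phi> (d \<cdot>\<^bsub>E\<^esub> Fst E G X)))"

definition eq_at :: "('o, 'a) topos \<Rightarrow> 'o \<Rightarrow> 'a" where
  "eq_at E X = (THE \<chi>. classifies E (pair E (Idt E X) (Idt E X)) \<chi>)"


section \<open>The internal higher-order type theory\<close>

text \<open>Types are the objects of the topos and every morphism is a function symbol. Variables are de
  Bruijn indices; the head of a context is the type of variable 0.\<close>

datatype ('o, 'a) tm =
    TVar nat
  | TStar
  | TPair "('o, 'a) tm" "('o, 'a) tm"
  | TApp 'a "('o, 'a) tm"
  | TEq "('o, 'a) tm" "('o, 'a) tm"
  | TMem "('o, 'a) tm" "('o, 'a) tm"
  | TCompr 'o "('o, 'a) tm"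
  | TTop
  | TBot
  | TAnd "('o, 'a) tm" "('o, 'a) tm"
  | TOr "('o, 'a) tm" "('o, 'a) tm"
  | TImp "('o, 'a) tm" "('o, 'a) tm"
  | TAll 'o "('o, 'a) tm"
  | TEx 'o "('o, 'a) tm"

inductive typed :: "('o, 'a) topos \<Rightarrow> 'o list \<Rightarrow> ('o, 'a) tm \<Rightarrow> 'o \<Rightarrow> bool" for E where
  "i < length \<Gamma> \<Longrightarrow> typed E \<Gamma> (TVar i) (\<Gamma> ! i)"
| "typed E \<Gamma> TStar (One E)"
| "typed E \<Gamma> t A \<Longrightarrow> typed E \<Gamma> u B \<Longrightarrow> typed E \<Gamma> (TPair t u) (Prod E A B)"
| "f \<in> Hom E A B \<Longrightarrow> typed E \<Gamma> t A \<Longrightarrow> typed E \<Gamma> (TApp f t) B"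
| "typed E \<Gamma> t A \<Longrightarrow> typed E \<Gamma> u A \<Longrightarrow> typed E \<Gamma> (TEq t u) (Omega E)"
| "typed E \<Gamma> t A \<Longrightarrow> typed E \<Gamma> u (pw E A) \<Longrightarrow> typed E \<Gamma> (TMem t u) (Omega E)"
| "X \<in> Obj E \<Longrightarrow> typed E (X # \<Gamma>) \<phi> (Omega E) \<Longrightarrow> typed E \<Gamma> (TCompr X \<phi>) (pw E X)"
| "typed E \<Gamma> TTop (Omega E)"
| "typed E \<Gamma> TBot (Omega E)"
| "typed E \<Gamma> \<phi> (Omega E) \<Longrightarrow> typed E \<Gamma> \<psi> (Omega E) \<Longrightarrow> typed E \<Gamma> (TAnd \<phi> \<psi>) (Omega E)"
| "typed E \<Gamma> \<phi> (Omega E) \<Longrightarrow> typed E \<Gamma> \<psi> (Omega E) \<Longrightarrow> typed E \<Gamma> (TOr \<phi> \<psi>) (Omega E)"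
| "typed E \<Gamma> \<phi> (Omega E) \<Longrightarrow> typed E \<Gamma> \<psi> (Omega E) \<Longrightarrow> typed E \<Gamma> (TImp \<phi> \<psi>) (Omega E)"
| "X \<in> Obj E \<Longrightarrow> typed E (X # \<Gamma>) \<phi> (Omega E) \<Longrightarrow> typed E \<Gamma> (TAll X \<phi>) (Omega E)"
| "X \<in> Obj E \<Longrightarrow> typed E (X # \<Gamma>) \<phi> (Omega E) \<Longrightarrow> typed E \<Gamma> (TEx X \<phi>) (Omega E)"

fun ctx :: "('o, 'a) topos \<Rightarrow> 'o list \<Rightarrow> 'o" where
  "ctx E [] = One E"
| "ctx E (X # \<Gamma>) = Prod E (ctx E \<Gamma>) X"

fun proj :: "('o, 'a) topos \<Rightarrow> 'o list \<Rightarrow> nat \<Rightarrow> 'a" where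
  "proj E [] i = undefined"
| "proj E (X # \<Gamma>) 0 = Snd E (ctx E \<Gamma>) X"
| "proj E (X # \<Gamma>) (Suc i) = proj E \<Gamma> i \<cdot>\<^bsub>E\<^esub> Fst E (ctx E \<Gamma>) X"

text \<open>For \<open>t\<close> of type \<open>A\<close> in context \<open>\<Gamma>\<close>, \<open>sem E \<Gamma> t\<close> is its interpretation
  \<open>ctx E \<Gamma> \<rightarrow> A\<close>; in the clauses for \<open>TEq\<close> and \<open>TMem\<close> the type is recovered as a codomain.\<close>

fun sem :: "('o, 'a) topos \<Rightarrow> 'o list \<Rightarrow> ('o, 'a) tm \<Rightarrow> 'a" where
  "sem E \<Gamma> (TVar i) = proj E \<Gamma> i"
| "sem E \<Gamma> TStar = bang E (ctx E \<Gamma>)"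
| "sem E \<Gamma> (TPair t u) = pair E (sem E \<Gamma> t) (sem E \<Gamma> u)"
| "sem E \<Gamma> (TApp f t) = f \<cdot>\<^bsub>E\<^esub> sem E \<Gamma> t"
| "sem E \<Gamma> (TEq t u) = eq_at E (Cod E (sem E \<Gamma> t)) \<cdot>\<^bsub>E\<^esub> pair E (sem E \<Gamma> t) (sem E \<Gamma> u)"
| "sem E \<Gamma> (TMem t u) =
     Ev E (Cod E (sem E \<Gamma> t)) (Omega E) \<cdot>\<^bsub>E\<^esub> pair E (sem E \<Gamma> u) (sem E \<Gamma> t)"
| "sem E \<Gamma> (TCompr X \<phi>) = curried E (ctx E \<Gamma>) X (Omega E) (sem E (X # \<Gamma>) \<phi>)"
| "sem E \<Gamma> TTop = true_at E (ctx E \<Gamma>)"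
| "sem E \<Gamma> TBot = sub_bot E (ctx E \<Gamma>)"
| "sem E \<Gamma> (TAnd \<phi> \<psi>) = sub_meet E (ctx E \<Gamma>) (sem E \<Gamma> \<phi>) (sem E \<Gamma> \<psi>)"
| "sem E \<Gamma> (TOr \<phi> \<psi>) = sub_join E (ctx E \<Gamma>) (sem E \<Gamma> \<phi>) (sem E \<Gamma> \<psi>)"
| "sem E \<Gamma> (TImp \<phi> \<psi>) = sub_imp E (ctx E \<Gamma>) (sem E \<Gamma> \<phi>) (sem E \<Gamma> \<psi>)"
| "sem E \<Gamma> (TAll X \<phi>) = sub_all E (ctx E \<Gamma>) X (sem E (X # \<Gamma>) \<phi>)"
| "sem E \<Gamma> (TEx X \<phi>) = sub_ex E (ctx E \<Gamma>) X (sem E (X # \<Gamma>) \<phi>)"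

definition holds :: "('o, 'a) topos \<Rightarrow> 'o list \<Rightarrow> ('o, 'a) tm \<Rightarrow> bool" where
  "holds E \<Gamma> \<phi> \<longleftrightarrow> typed E \<Gamma> \<phi> (Omega E) \<and> sem E \<Gamma> \<phi> = true_at E (ctx E \<Gamma>)"

text \<open>The tuple of \<open>t\<^sub>0, \<dots>, t\<^sub>m\<^sub>-\<^sub>1\<close>, of type \<open>ctx E [A\<^sub>0, \<dots>, A\<^sub>m\<^sub>-\<^sub>1]\<close>; in
  particular \<open>ctx E (replicate m X)\<close> is the power \<open>X\<^sup>m\<close>.\<close>

fun tuple :: "('o, 'a) tm list \<Rightarrow> ('o, 'a) tm" where
  "tuple [] = TStar"
| "tuple (t # ts) = TPair (tuple ts) t"


section \<open>Local operators and the forcing translation\<close>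

text \<open>Variables of type \<open>P\<Omega>\<close> and \<open>P(P\<Omega>)\<close> are passed as de Bruijn indices.\<close>

abbreviation at_op :: "nat \<Rightarrow> ('o, 'a) tm \<Rightarrow> ('o, 'a) tm" where
  "at_op j p \<equiv> TMem p (TVar j)"

definition is_lop :: "('o, 'a) topos \<Rightarrow> nat \<Rightarrow> ('o, 'a) tm" where
  "is_lop E j =
     TAnd (TAll (Omega E) (TImp (TVar 0) (at_op (j + 1) (TVar 0))))
    (TAnd (TAll (Omega E) (TImp (at_op (j + 1) (at_op (j + 1) (TVar 0))) (at_op (j + 1) (TVar 0))))
          (TAll (Omega E) (TAll (Omega E) (TImp (TImp (TVar 1) (TVar 0))
             (TImp (at_op (j + 2) (TVar 1)) (at_op (j + 2) (TVar 0)))))))"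

definition Lop :: "('o, 'a) topos \<Rightarrow> ('o, 'a) tm" where
  "Lop E = TCompr (pw E (Omega E)) (is_lop E 0)"

definition op_le :: "('o, 'a) topos \<Rightarrow> nat \<Rightarrow> nat \<Rightarrow> ('o, 'a) tm" where
  "op_le E j k = TAll (Omega E) (TImp (at_op (j + 1) (TVar 0)) (at_op (k + 1) (TVar 0)))"

definition sub_Lop :: "('o, 'a) topos \<Rightarrow> nat \<Rightarrow> ('o, 'a) tm" where
  "sub_Lop E P = TAll (pw E (Omega E)) (TImp (TMem (TVar 0) (TVar (P + 1))) (TMem (TVar 0) (Lop E)))"

text \<open>\<open>all_ge E P j \<chi>\<close> binds \<open>k\<close> as variable 0 of \<open>\<chi>\<close>.\<close>

definition all_ge :: "('o, 'a) topos \<Rightarrow> nat \<Rightarrow> nat \<Rightarrow> ('o, 'a) tm \<Rightarrow> ('o, 'a) tm" where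
  "all_ge E P j \<chi> = TAll (pw E (Omega E))
     (TImp (TMem (TVar 0) (TVar (P + 1))) (TImp (op_le E (j + 1) 0) \<chi>))"

text \<open>Formulas over an object \<open>X\<close>: \<open>LAtom R [i\<^sub>1, \<dots>, i\<^sub>m]\<close> is \<open>R\<close> applied to variables, for a
  morphism \<open>R\<close> from \<open>X\<^sup>m\<close> to \<open>\<Omega>\<close>. Indices count only variables of type \<open>X\<close>.\<close>

datatype 'a lfm =
    LAtom 'a "nat list"
  | LAnd "'a lfm" "'a lfm"
  | LOr "'a lfm" "'a lfm"
  | LImp "'a lfm" "'a lfm"
  | LEx "'a lfm"
  | LAll "'a lfm"

text \<open>\<open>v\<close> maps the variables of the \<open>X\<close>-formula to variables of the ambient context, which also
  contains the operators; \<open>up v\<close> is its extension under a binder of type \<open>X\<close>.\<close>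

definition up :: "(nat \<Rightarrow> nat) \<Rightarrow> nat \<Rightarrow> nat" where
  "up v i = (case i of 0 \<Rightarrow> 0 | Suc i' \<Rightarrow> Suc (v i'))"

fun force :: "('o, 'a) topos \<Rightarrow> 'o \<Rightarrow> nat \<Rightarrow> nat \<Rightarrow> (nat \<Rightarrow> nat) \<Rightarrow> 'a lfm \<Rightarrow> ('o, 'a) tm" where
  "force E X P j v (LAtom R is) = at_op j (TApp R (tuple (map (\<lambda>i. TVar (v i)) is)))"
| "force E X P j v (LAnd \<phi> \<psi>) = TAnd (force E X P j v \<phi>) (force E X P j v \<psi>)"
| "force E X P j v (LOr \<phi> \<psi>) = at_op j (TOr (force E X P j v \<phi>) (force E X P j v \<psi>))"
| "force E X P j v (LImp \<phi> \<psi>) = all_ge E P j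
     (TImp (force E X (P + 1) 0 (\<lambda>i. v i + 1) \<phi>) (force E X (P + 1) 0 (\<lambda>i. v i + 1) \<psi>))"
| "force E X P j v (LEx \<phi>) = at_op j (TEx X (force E X (P + 1) (j + 1) (up v) \<phi>))"
| "force E X P j v (LAll \<phi>) = all_ge E P j
     (TAll X (force E X (P + 2) 1 (up (\<lambda>i. v i + 1)) \<phi>))"


section \<open>Heyting arithmetic\<close>

text \<open>One function symbol for each primitive recursive definition. \<open>PComp m f gs\<close> is the \<open>m\<close>-ary
  composite of \<open>f\<close> with the list \<open>gs\<close>; \<open>PRec f g\<close> recurses on its first argument. The constant
  \<open>0\<close> and the successor are \<open>PZero\<close> and \<open>PSucc\<close>.\<close>

datatype prim =
    PZero
  | PSucc
  | PProj nat nat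
  | PComp nat prim "prim list"
  | PRec prim prim

fun arity :: "prim \<Rightarrow> nat" where
  "arity PZero = 0"
| "arity PSucc = 1"
| "arity (PProj m i) = m"
| "arity (PComp m f gs) = m"
| "arity (PRec f g) = arity f + 1"

fun prim_wf :: "prim \<Rightarrow> bool" where
  "prim_wf PZero \<longleftrightarrow> True"
| "prim_wf PSucc \<longleftrightarrow> True"
| "prim_wf (PProj m i) \<longleftrightarrow> i < m"
| "prim_wf (PComp m f gs) \<longleftrightarrow>
     prim_wf f \<and> arity f = length gs \<and> (\<forall>g\<in>set gs. prim_wf g \<and> arity g = m)"
| "prim_wf (PRec f g) \<longleftrightarrow> prim_wf f \<and> prim_wf g \<and> arity g = arity f + 2"

datatype atm = AVar nat | AFun prim "atm list"

abbreviation AZero :: atm where "AZero \<equiv> AFun PZero []"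
abbreviation ASuc :: "atm \<Rightarrow> atm" where "ASuc t \<equiv> AFun PSucc [t]"

datatype afm =
    AEq atm atm
  | ABot
  | AAnd afm afm
  | AOr afm afm
  | AImp afm afm
  | AEx afm
  | AAll afm

abbreviation ANeg :: "afm \<Rightarrow> afm" where "ANeg \<phi> \<equiv> AImp \<phi> ABot"

text \<open>Well-formedness with free variables among \<open>0, \<dots>, n - 1\<close>.\<close>

fun atm_wf :: "nat \<Rightarrow> atm \<Rightarrow> bool" where
  "atm_wf n (AVar i) \<longleftrightarrow> i < n"
| "atm_wf n (AFun f ts) \<longleftrightarrow> prim_wf f \<and> length ts = arity f \<and> (\<forall>t\<in>set ts. atm_wf n t)"

fun afm_wf :: "nat \<Rightarrow> afm \<Rightarrow> bool" where
  "afm_wf n (AEq t u) \<longleftrightarrow> atm_wf n t \<and> atm_wf n u"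
| "afm_wf n ABot \<longleftrightarrow> True"
| "afm_wf n (AAnd \<phi> \<psi>) \<longleftrightarrow> afm_wf n \<phi> \<and> afm_wf n \<psi>"
| "afm_wf n (AOr \<phi> \<psi>) \<longleftrightarrow> afm_wf n \<phi> \<and> afm_wf n \<psi>"
| "afm_wf n (AImp \<phi> \<psi>) \<longleftrightarrow> afm_wf n \<phi> \<and> afm_wf n \<psi>"
| "afm_wf n (AEx \<phi>) \<longleftrightarrow> afm_wf (Suc n) \<phi>"
| "afm_wf n (AAll \<phi>) \<longleftrightarrow> afm_wf (Suc n) \<phi>"

fun atm_subst :: "(nat \<Rightarrow> atm) \<Rightarrow> atm \<Rightarrow> atm" where
  "atm_subst \<sigma> (AVar i) = \<sigma> i"
| "atm_subst \<sigma> (AFun f ts) = AFun f (map (atm_subst \<sigma>) ts)"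

definition under :: "(nat \<Rightarrow> atm) \<Rightarrow> nat \<Rightarrow> atm" where
  "under \<sigma> i = (case i of 0 \<Rightarrow> AVar 0 | Suc i' \<Rightarrow> atm_subst (\<lambda>k. AVar (Suc k)) (\<sigma> i'))"

fun afm_subst :: "(nat \<Rightarrow> atm) \<Rightarrow> afm \<Rightarrow> afm" where
  "afm_subst \<sigma> (AEq t u) = AEq (atm_subst \<sigma> t) (atm_subst \<sigma> u)"
| "afm_subst \<sigma> ABot = ABot"
| "afm_subst \<sigma> (AAnd \<phi> \<psi>) = AAnd (afm_subst \<sigma> \<phi>) (afm_subst \<sigma> \<psi>)"
| "afm_subst \<sigma> (AOr \<phi> \<psi>) = AOr (afm_subst \<sigma> \<phi>) (afm_subst \<sigma> \<psi>)"
| "afm_subst \<sigma> (AImp \<phi> \<psi>) = AImp (afm_subst \<sigma> \<phi>) (afm_subst \<sigma> \<psi>)"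
| "afm_subst \<sigma> (AEx \<phi>) = AEx (afm_subst (under \<sigma>) \<phi>)"
| "afm_subst \<sigma> (AAll \<phi>) = AAll (afm_subst (under \<sigma>) \<phi>)"

definition subst_zero :: "afm \<Rightarrow> afm" where
  "subst_zero \<phi> = afm_subst (\<lambda>i. case i of 0 \<Rightarrow> AZero | Suc i' \<Rightarrow> AVar i') \<phi>"

text \<open>\<open>\<phi>[S x / x]\<close> for \<open>x\<close> variable 0, still in a context containing \<open>x\<close>.\<close>

definition subst_suc :: "afm \<Rightarrow> afm" where
  "subst_suc \<phi> = afm_subst (\<lambda>i. case i of 0 \<Rightarrow> ASuc (AVar 0) | Suc i' \<Rightarrow> AVar (Suc i')) \<phi>"

definition vars :: "nat \<Rightarrow> nat \<Rightarrow> atm list" where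
  "vars k m = map AVar [k..<k + m]"

text \<open>\<open>HA_axiom n \<phi>\<close>: \<open>\<phi>\<close> is an axiom with free variables among \<open>0, \<dots>, n - 1\<close>. By rule \<open>gen\<close>
  this comprises both the axioms with free variables and their universal closures (\<open>n = 0\<close>).\<close>

inductive HA_axiom :: "nat \<Rightarrow> afm \<Rightarrow> bool" where
  succ_nonzero: "HA_axiom n (AAll (ANeg (AEq (ASuc (AVar 0)) AZero)))"
| proj_eq: "prim_wf (PProj m i) \<Longrightarrow> m \<le> n \<Longrightarrow>
    HA_axiom n (AEq (AFun (PProj m i) (vars 0 m)) (AVar i))"
| comp_eq: "prim_wf (PComp m f gs) \<Longrightarrow> m \<le> n \<Longrightarrow>
    HA_axiom n (AEq (AFun (PComp m f gs) (vars 0 m)) (AFun f (map (\<lambda>g. AFun g (vars 0 m)) gs)))"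
| rec_zero: "prim_wf (PRec f g) \<Longrightarrow> arity f \<le> n \<Longrightarrow>
    HA_axiom n (AEq (AFun (PRec f g) (AZero # vars 0 (arity f))) (AFun f (vars 0 (arity f))))"
| rec_suc: "prim_wf (PRec f g) \<Longrightarrow> arity f + 1 \<le> n \<Longrightarrow>
    HA_axiom n (AEq (AFun (PRec f g) (ASuc (AVar 0) # vars 1 (arity f)))
      (AFun g (AVar 0 # AFun (PRec f g) (AVar 0 # vars 1 (arity f)) # vars 1 (arity f))))"
| induction: "afm_wf (Suc n) \<phi> \<Longrightarrow>
    HA_axiom n (AImp (AAnd (subst_zero \<phi>) (AAll (AImp \<phi> (subst_suc \<phi>)))) (AAll \<phi>))"
| gen: "HA_axiom (Suc n) \<phi> \<Longrightarrow> HA_axiom n (AAll \<phi>)"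


section \<open>The standard interpretation of arithmetic\<close>

definition mor_tuple :: "('o, 'a) topos \<Rightarrow> 'o \<Rightarrow> 'a list \<Rightarrow> 'a" where
  "mor_tuple E D fs = foldr (\<lambda>f h. pair E h f) fs (bang E D)"

text \<open>The morphism \<open>N\<^sup>m \<rightarrow> N\<close> of an \<open>m\<close>-ary function symbol. Since the first argument is the
  last factor of \<open>N\<^sup>m\<^sup>+\<^sup>1 = N\<^sup>m \<times> N\<close>, the clause for \<open>PRec\<close> says \<open>h(0, x) = f(x)\<close> and
  \<open>h(S y, x) = g(y, h(y, x), x)\<close>.\<close>

fun prim_mor :: "('o, 'a) topos \<Rightarrow> 'o \<Rightarrow> 'a \<Rightarrow> 'a \<Rightarrow> prim \<Rightarrow> 'a" where
  "prim_mor E N z s PZero = z"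
| "prim_mor E N z s PSucc = s \<cdot>\<^bsub>E\<^esub> proj E [N] 0"
| "prim_mor E N z s (PProj m i) = proj E (replicate m N) i"
| "prim_mor E N z s (PComp m f gs) =
     prim_mor E N z s f \<cdot>\<^bsub>E\<^esub> mor_tuple E (ctx E (replicate m N)) (map (prim_mor E N z s) gs)"
| "prim_mor E N z s (PRec f g) =
     (let D = ctx E (replicate (arity f) N); p = Fst E D N; q = Snd E D N in
      THE h. h \<in> Hom E (Prod E D N) N \<and>
        h \<cdot>\<^bsub>E\<^esub> pair E (Idt E D) (z \<cdot>\<^bsub>E\<^esub> bang E D) = prim_mor E N z s f \<and>
        h \<cdot>\<^bsub>E\<^esub> pair E p (s \<cdot>\<^bsub>E\<^esub> q) = prim_mor E N z s g \<cdot>\<^bsub>E\<^esub> pair E (pair E p h) q)"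

fun std_tm :: "('o, 'a) topos \<Rightarrow> 'o \<Rightarrow> 'a \<Rightarrow> 'a \<Rightarrow> atm \<Rightarrow> ('o, 'a) tm" where
  "std_tm E N z s (AVar i) = TVar i"
| "std_tm E N z s (AFun f ts) = TApp (prim_mor E N z s f) (tuple (map (std_tm E N z s) ts))"

text \<open>An equation with variables among the \<open>n\<close> variables in scope becomes an atomic formula given
  by a morphism \<open>N\<^sup>n \<rightarrow> \<Omega>\<close>.\<close>

fun std :: "('o, 'a) topos \<Rightarrow> 'o \<Rightarrow> 'a \<Rightarrow> 'a \<Rightarrow> nat \<Rightarrow> afm \<Rightarrow> 'a lfm" where
  "std E N z s n (AEq t u) =
     LAtom (sem E (replicate n N) (TEq (std_tm E N z s t) (std_tm E N z s u))) [0..<n]"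
| "std E N z s n ABot = LAtom (sem E [] TBot) []"
| "std E N z s n (AAnd \<phi> \<psi>) = LAnd (std E N z s n \<phi>) (std E N z s n \<psi>)"
| "std E N z s n (AOr \<phi> \<psi>) = LOr (std E N z s n \<phi>) (std E N z s n \<psi>)"
| "std E N z s n (AImp \<phi> \<psi>) = LImp (std E N z s n \<phi>) (std E N z s n \<psi>)"
| "std E N z s n (AEx \<phi>) = LEx (std E N z s (Suc n) \<phi>)"
| "std E N z s n (AAll \<phi>) = LAll (std E N z s (Suc n) \<phi>)"

end

theory Submission
  imports Defs
begin

text \<open>Formulas are evaluated at generalized elements: \<open>\<phi>\<close> holds at \<open>f : D \<rightarrow> G\<close> iff \<open>\<phi> \<circ> f\<close> is
  \<open>true\<close>. Morphisms into \<open>\<Omega>\<close> are determined by where they hold, which gives Kripke--Joyal clauses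
  for all connectives. In these terms \<open>j \<tturnstile>\<^sub>P \<phi>\<close> is monotone in \<open>j\<close> along \<open>P \<subseteq> Lop\<close>. Hence, for
  the induction axiom, at every \<open>k \<ge> j\<close> in \<open>P\<close> the predicate \<open>k \<tturnstile>\<^sub>P \<phi>(x)\<close> of \<open>x\<close> contains \<open>0\<close>
  and is closed under successor, and induction inside the topos applies. The equational axioms are
  true equations between morphisms and pass through \<open>p \<rightarrow> jp\<close>; \<open>S x = 0\<close> implies \<open>\<bottom>\<close> internally
  and \<open>k\<close> preserves this implication.\<close>

context elementary_topos
begin

abbreviation comp :: "'a \<Rightarrow> 'a \<Rightarrow> 'a" (infixr "\<bullet>" 75) where
  "g \<bullet> f \<equiv> Cmp E g f"

abbreviation \<Omega> :: 'o where "\<Omega> \<equiv> Omega E"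

lemma Hom_iff [simp]: "f \<in> Hom E A B \<longleftrightarrow> f \<in> Arr E \<and> Dom E f = A \<and> Cod E f = B"
  by (auto simp: Hom_def)

declare dom_obj [simp] cod_obj [simp] one_obj [simp] prod_obj [simp] exp_obj [simp] omega_obj [simp]

lemma comp_simps [simp]:
  assumes "f \<in> Arr E" "g \<in> Arr E" "Cod E f = Dom E g"
  shows "g \<bullet> f \<in> Arr E" "Dom E (g \<bullet> f) = Dom E f" "Cod E (g \<bullet> f) = Cod E g"
  using comp_hom[of f "Dom E f" "Dom E g" g "Cod E g"] assms by auto

lemma comp_comp [simp]:
  assumes "f \<in> Arr E" "g \<in> Arr E" "h \<in> Arr E" "Cod E f = Dom E g" "Cod E g = Dom E h"
  shows "(h \<bullet> g) \<bullet> f = h \<bullet> (g \<bullet> f)"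
  using comp_assoc[of f "Dom E f" "Dom E g" g "Dom E h" h "Cod E h"] assms by auto

lemma Idt_simps [simp]:
  assumes "A \<in> Obj E"
  shows "Idt E A \<in> Arr E" "Dom E (Idt E A) = A" "Cod E (Idt E A) = A"
  using id_hom[OF assms] by auto

lemma Idt_comp [simp]: "f \<in> Arr E \<Longrightarrow> Cod E f = B \<Longrightarrow> Idt E B \<bullet> f = f"
  using id_left[of f "Dom E f" B] by simp

lemma comp_Idt [simp]: "f \<in> Arr E \<Longrightarrow> Dom E f = A \<Longrightarrow> f \<bullet> Idt E A = f"
  using id_right[of f A "Cod E f"] by simp

lemma bang_simps [simp]:
  assumes "A \<in> Obj E"
  shows "bang E A \<in> Arr E" "Dom E (bang E A) = A" "Cod E (bang E A) = One E"
  using theI'[OF terminal[OF assms]] unfolding bang_def by auto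

lemma bang_unique: "f \<in> Arr E \<Longrightarrow> Cod E f = One E \<Longrightarrow> f = bang E (Dom E f)"
  using terminal[of "Dom E f"] bang_simps[of "Dom E f"] by auto

lemma bang_comp [simp]: "f \<in> Arr E \<Longrightarrow> Cod E f = A \<Longrightarrow> bang E A \<bullet> f = bang E (Dom E f)"
  using bang_unique[of "bang E A \<bullet> f"] by auto

lemma Tru_simps [simp]: "Tru E \<in> Arr E" "Dom E (Tru E) = One E" "Cod E (Tru E) = \<Omega>"
  using true_hom by auto

lemma true_at_simps [simp]:
  assumes "A \<in> Obj E"
  shows "true_at E A \<in> Arr E" "Dom E (true_at E A) = A" "Cod E (true_at E A) = \<Omega>"
  using assms by (auto simp: true_at_def)

lemma true_at_comp [simp]:
  "f \<in> Arr E \<Longrightarrow> Cod E f = A \<Longrightarrow> true_at E A \<bullet> f = true_at E (Dom E f)"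
  by (auto simp: true_at_def)

lemma Fst_simps [simp]:
  assumes "A \<in> Obj E" "B \<in> Obj E"
  shows "Fst E A B \<in> Arr E" "Dom E (Fst E A B) = Prod E A B" "Cod E (Fst E A B) = A"
  using fst_hom[OF assms] by auto

lemma Snd_simps [simp]:
  assumes "A \<in> Obj E" "B \<in> Obj E"
  shows "Snd E A B \<in> Arr E" "Dom E (Snd E A B) = Prod E A B" "Cod E (Snd E A B) = B"
  using snd_hom[OF assms] by auto

lemma pair_simps [simp]:
  assumes "f \<in> Arr E" "g \<in> Arr E" "Dom E f = Dom E g"
  shows "pair E f g \<in> Arr E" "Dom E (pair E f g) = Dom E g"
    "Cod E (pair E f g) = Prod E (Cod E f) (Cod E g)"
    "Cod E f = A \<Longrightarrow> Cod E g = B \<Longrightarrow> Fst E A B \<bullet> pair E f g = f"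
    "Cod E f = A \<Longrightarrow> Cod E g = B \<Longrightarrow> Snd E A B \<bullet> pair E f g = g"
  using theI'[OF product[of f "Dom E f" "Cod E f" g "Cod E g"]] assms
  unfolding pair_def by auto

lemma pair_eta:
  assumes "h \<in> Arr E" "Cod E h = Prod E A B" "A \<in> Obj E" "B \<in> Obj E"
  shows "pair E (Fst E A B \<bullet> h) (Snd E A B \<bullet> h) = h"
  using the1_equality[OF product[of "Fst E A B \<bullet> h" "Dom E h" A "Snd E A B \<bullet> h" B], of h] assms
  by (simp add: pair_def)

lemma pair_unique:
  assumes "h \<in> Arr E" "Cod E h = Prod E A B" "A \<in> Obj E" "B \<in> Obj E"
    "Fst E A B \<bullet> h = f" "Snd E A B \<bullet> h = g"
  shows "h = pair E f g"
  using pair_eta[OF assms(1-4)] assms(5,6) by metis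

lemma pair_comp [simp]:
  assumes "f \<in> Arr E" "g \<in> Arr E" "Dom E f = Dom E g" "h \<in> Arr E" "Cod E h = Dom E g"
  shows "pair E f g \<bullet> h = pair E (f \<bullet> h) (g \<bullet> h)"
proof (rule pair_unique)
  show "Fst E (Cod E f) (Cod E g) \<bullet> (pair E f g \<bullet> h) = f \<bullet> h"
    "Snd E (Cod E f) (Cod E g) \<bullet> (pair E f g \<bullet> h) = g \<bullet> h"
    using assms by (simp_all flip: comp_comp)
qed (use assms in auto)

lemma pair_Fst_Snd [simp]:
  "A \<in> Obj E \<Longrightarrow> B \<in> Obj E \<Longrightarrow> pair E (Fst E A B) (Snd E A B) = Idt E (Prod E A B)"
  by (rule pair_unique[of _ A B, symmetric]) auto

lemma pair_inject:
  assumes "pair E f g = pair E f' g'"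
    and "f \<in> Arr E" "g \<in> Arr E" "Dom E f = Dom E g"
    and "f' \<in> Arr E" "g' \<in> Arr E" "Dom E f' = Dom E g'"
    and "Cod E f = Cod E f'" "Cod E g = Cod E g'"
  shows "f = f' \<and> g = g'"
  using assms pair_simps(4,5)[of f g] pair_simps(4,5)[of f' g'] by metis

lemma all_Arr_Prod_iff:
  assumes "A \<in> Obj E" "B \<in> Obj E"
  shows "(\<forall>h. h \<in> Arr E \<and> Dom E h = D \<and> Cod E h = Prod E A B \<longrightarrow> \<Phi> h) \<longleftrightarrow>
    (\<forall>f. f \<in> Arr E \<and> Dom E f = D \<and> Cod E f = A \<longrightarrow>
      (\<forall>g. g \<in> Arr E \<and> Dom E g = D \<and> Cod E g = B \<longrightarrow> \<Phi> (pair E f g)))" (is "?lhs \<longleftrightarrow> ?rhs")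
proof
  assume rhs: ?rhs
  show ?lhs
  proof (intro allI impI)
    fix h assume h: "h \<in> Arr E \<and> Dom E h = D \<and> Cod E h = Prod E A B"
    then have "\<Phi> (pair E (Fst E A B \<bullet> h) (Snd E A B \<bullet> h))"
      using assms by (intro rhs[rule_format]) simp_all
    then show "\<Phi> h" using h assms by (simp add: pair_eta)
  qed
qed simp

lemma Ev_simps [simp]:
  assumes "A \<in> Obj E" "B \<in> Obj E"
  shows "Ev E A B \<in> Arr E" "Dom E (Ev E A B) = Prod E (Exp E A B) A" "Cod E (Ev E A B) = B"
  using ev_hom[OF assms] by auto

context
  fixes A B C :: 'o and f :: 'a
  assumes objs: "A \<in> Obj E" "B \<in> Obj E" "C \<in> Obj E"
    and f: "f \<in> Arr E" "Dom E f = Prod E C A" "Cod E f = B"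
begin

lemma curried_simps [simp]:
  "curried E C A B f \<in> Arr E" "Dom E (curried E C A B f) = C"
  "Cod E (curried E C A B f) = Exp E A B"
  using theI'[OF exponential[of A B C f]] objs f unfolding curried_def by auto

lemma uncurried_curried: "uncurried E C A B (curried E C A B f) = f"
  using theI'[OF exponential[of A B C f]] objs f unfolding curried_def by auto

lemma curried_unique: "h \<in> Hom E C (Exp E A B) \<Longrightarrow> uncurried E C A B h = f \<Longrightarrow> h = curried E C A B f"
  unfolding curried_def using objs f by (intro the1_equality[OF exponential, symmetric]) simp_all

lemma Ev_curried [simp]:
  assumes "k \<in> Arr E" "x \<in> Arr E" "Dom E k = Dom E x" "Cod E k = C" "Cod E x = A"
  shows "Ev E A B \<bullet> pair E (curried E C A B f \<bullet> k) x = f \<bullet> pair E k x"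
proof -
  have "f \<bullet> pair E k x = uncurried E C A B (curried E C A B f) \<bullet> pair E k x"
    by (simp add: uncurried_curried)
  then show ?thesis using assms objs f by (simp add: uncurried_def)
qed

end

lemma curried_comp:
  assumes "A \<in> Obj E" "B \<in> Obj E" "f \<in> Hom E (Prod E C A) B" "k \<in> Hom E D C"
  shows "curried E C A B f \<bullet> k = curried E D A B (f \<bullet> pair E (k \<bullet> Fst E D A) (Snd E D A))"
proof -
  have "C \<in> Obj E" "D \<in> Obj E" using assms(4) by auto
  then show ?thesis using assms by (intro curried_unique) (simp_all add: uncurried_def)
qed

lemma curried_inject:
  assumes "A \<in> Obj E" "B \<in> Obj E" "C \<in> Obj E" "f \<in> Hom E (Prod E C A) B" "g \<in> Hom E (Prod E C A) B"
  shows "curried E C A B f = curried E C A B g \<longleftrightarrow> f = g"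
  using assms by (metis Hom_iff uncurried_curried)

definition memb :: "'a \<Rightarrow> 'a \<Rightarrow> 'a" where
  "memb x a = Ev E (Cod E x) \<Omega> \<bullet> pair E a x"

lemma pw_obj [simp]: "X \<in> Obj E \<Longrightarrow> pw E X \<in> Obj E"
  by (simp add: pw_def)

lemma memb_simps [simp]:
  assumes "x \<in> Arr E" "a \<in> Arr E" "Dom E a = Dom E x" "Cod E a = pw E (Cod E x)"
  shows "memb x a \<in> Arr E" "Dom E (memb x a) = Dom E x" "Cod E (memb x a) = \<Omega>"
    "f \<in> Arr E \<Longrightarrow> Cod E f = Dom E x \<Longrightarrow> memb x a \<bullet> f = memb (x \<bullet> f) (a \<bullet> f)"
  using assms by (auto simp: memb_def pw_def)


subsection \<open>Truth of generalized elements of the classifier\<close>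

definition is_true :: "'a \<Rightarrow> bool" where
  "is_true p \<longleftrightarrow> p = true_at E (Dom E p)"

lemma is_true_true_at [simp]: "A \<in> Obj E \<Longrightarrow> is_true (true_at E A)"
  by (simp add: is_true_def)

lemma is_true_comp:
  "is_true p \<Longrightarrow> p \<in> Arr E \<Longrightarrow> f \<in> Arr E \<Longrightarrow> Cod E f = Dom E p \<Longrightarrow> is_true (p \<bullet> f)"
  unfolding is_true_def by (metis comp_simps(2) true_at_comp)

lemma is_true_iff_comp:
  assumes "p \<in> Hom E G \<Omega>"
  shows "is_true p \<longleftrightarrow> (\<forall>D f. f \<in> Hom E D G \<longrightarrow> is_true (p \<bullet> f))"
proof
  assume "\<forall>D f. f \<in> Hom E D G \<longrightarrow> is_true (p \<bullet> f)"
  from this[rule_format, of "Idt E G" G] show "is_true p" using assms by auto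
qed (use assms in \<open>auto intro: is_true_comp\<close>)

lemma equalizer_true_at:
  assumes "p \<in> Hom E G \<Omega>"
  obtains e where "e \<in> Arr E" "Cod E e = G" "is_true (p \<bullet> e)" "monic E e"
    "\<And>D h. h \<in> Hom E D G \<Longrightarrow> is_true (p \<bullet> h) \<Longrightarrow> \<exists>!k. k \<in> Hom E D (Dom E e) \<and> e \<bullet> k = h"
proof -
  have "G \<in> Obj E" using assms by auto
  then obtain e where e: "e \<in> Arr E" "Cod E e = G" "p \<bullet> e = true_at E G \<bullet> e"
    and factor: "\<forall>D\<in>Obj E. \<forall>h\<in>Hom E D G. p \<bullet> h = true_at E G \<bullet> h \<longrightarrow>
      (\<exists>!k. k \<in> Hom E D (Dom E e) \<and> e \<bullet> k = h)"
    using equalizer[of p G \<Omega> "true_at E G"] assms by force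
  have true_e: "is_true (p \<bullet> e)" using e assms by (simp add: is_true_def)
  have factor_true: "\<exists>!k. k \<in> Hom E D (Dom E e) \<and> e \<bullet> k = h"
    if "h \<in> Hom E D G" "is_true (p \<bullet> h)" for D h
    using that assms \<open>G \<in> Obj E\<close> by (intro factor[rule_format]) (auto simp: is_true_def)
  have "monic E e"
    unfolding monic_def
  proof (intro conjI ballI impI)
    fix D f g assume "f \<in> Hom E D (Dom E e)" "g \<in> Hom E D (Dom E e)" "e \<bullet> f = e \<bullet> g"
    moreover from this have "is_true (p \<bullet> (e \<bullet> f))"
      using is_true_comp[OF true_e, of f] e(1,2) assms by simp
    ultimately show "f = g" using factor_true[of "e \<bullet> f" D] e by auto
  qed (use e in simp)
  show thesis by (rule that[OF e(1,2) true_e \<open>monic E e\<close> factor_true])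
qed

text \<open>Both maps classify the equalizer of \<open>p\<close> and \<open>true\<close>.\<close>

lemma is_true_ext:
  assumes "p \<in> Hom E G \<Omega>" "q \<in> Hom E G \<Omega>"
    and "\<And>D f. f \<in> Hom E D G \<Longrightarrow> is_true (p \<bullet> f) \<longleftrightarrow> is_true (q \<bullet> f)"
  shows "p = q"
proof -
  obtain e where e: "e \<in> Arr E" "Cod E e = G" "is_true (p \<bullet> e)" "monic E e"
    and factor: "\<And>D h. h \<in> Hom E D G \<Longrightarrow> is_true (p \<bullet> h) \<Longrightarrow> \<exists>!k. k \<in> Hom E D (Dom E e) \<and> e \<bullet> k = h"
    using assms(1) by (rule equalizer_true_at) blast
  have "classifies E e r"
    if r: "r \<in> Hom E G \<Omega>" "\<And>D f. f \<in> Hom E D G \<Longrightarrow> is_true (r \<bullet> f) \<longleftrightarrow> is_true (p \<bullet> f)" for r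
    unfolding classifies_def
  proof (intro conjI ballI impI)
    fix D f assume f: "D \<in> Obj E" "f \<in> Hom E D (Cod E e)" "r \<bullet> f = true_at E D"
    then have "is_true (p \<bullet> f)" using r(2)[of f D] e by simp
    then show "\<exists>!g. g \<in> Hom E D (Dom E e) \<and> e \<bullet> g = f" using factor[of f D] f e by simp
  qed (use e r(1) r(2)[of e "Dom E e"] in \<open>auto simp: is_true_def\<close>)
  then show ?thesis using classifier[OF e(4)] assms by blast
qed

lemma sub_le_iff:
  assumes "p \<in> Hom E G \<Omega>" "q \<in> Hom E G \<Omega>"
  shows "sub_le E G p q \<longleftrightarrow> (\<forall>D f. f \<in> Hom E D G \<longrightarrow> is_true (p \<bullet> f) \<longrightarrow> is_true (q \<bullet> f))"
  using assms unfolding sub_le_def is_true_def by auto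

lemma sub_leD:
  assumes "sub_le E G p q" "p \<in> Hom E G \<Omega>" "q \<in> Hom E G \<Omega>" "is_true p"
  shows "is_true q"
proof -
  have "Idt E G \<in> Hom E G G" using assms(2) by auto
  then have "is_true (q \<bullet> Idt E G)" using assms sub_le_iff[of p G q] by force
  then show ?thesis using assms(3) by simp
qed

lemma sub_le_antisym:
  assumes "sub_le E G p q" "sub_le E G q p" "p \<in> Hom E G \<Omega>" "q \<in> Hom E G \<Omega>"
  shows "p = q"
  using assms by (intro is_true_ext[of p G]) (auto simp: sub_le_iff)

lemma eq_at_classifies:
  assumes "X \<in> Obj E"
  shows "classifies E (pair E (Idt E X) (Idt E X)) (eq_at E X)"
proof -
  have "monic E (pair E (Idt E X) (Idt E X))"
    unfolding monic_def using assms by (auto dest!: pair_inject)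
  from theI'[OF classifier[OF this]] show ?thesis by (simp add: eq_at_def)
qed

lemma eq_at_simps [simp]:
  assumes "X \<in> Obj E"
  shows "eq_at E X \<in> Arr E" "Dom E (eq_at E X) = Prod E X X" "Cod E (eq_at E X) = \<Omega>"
  using eq_at_classifies[OF assms] assms by (auto simp: classifies_def)

lemma is_true_eq_at [simp]:
  assumes "f \<in> Arr E" "g \<in> Arr E" "Dom E f = Dom E g" "Cod E f = X" "Cod E g = X"
  shows "is_true (eq_at E X \<bullet> pair E f g) \<longleftrightarrow> f = g"
proof -
  have X: "X \<in> Obj E" and D: "Dom E g \<in> Obj E" using assms by auto
  let ?\<Delta> = "pair E (Idt E X) (Idt E X)"
  have true_diagonal: "eq_at E X \<bullet> ?\<Delta> = true_at E (Dom E ?\<Delta>)"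
    and factor: "\<forall>D\<in>Obj E. \<forall>h\<in>Hom E D (Cod E ?\<Delta>). eq_at E X \<bullet> h = true_at E D \<longrightarrow>
      (\<exists>!k. k \<in> Hom E D (Dom E ?\<Delta>) \<and> ?\<Delta> \<bullet> k = h)"
    using eq_at_classifies[OF X] unfolding classifies_def by blast+
  show ?thesis
  proof
    assume "is_true (eq_at E X \<bullet> pair E f g)"
    then have "eq_at E X \<bullet> pair E f g = true_at E (Dom E g)"
      using assms X by (simp add: is_true_def)
    then obtain k where "k \<in> Hom E (Dom E g) X" "?\<Delta> \<bullet> k = pair E f g"
      using factor[rule_format, of "Dom E g" "pair E f g"] assms X by (auto simp del: pair_comp)
    then show "f = g" using assms X by (auto dest: pair_inject)
  next
    assume "f = g"
    then have "eq_at E X \<bullet> pair E f g = (eq_at E X \<bullet> ?\<Delta>) \<bullet> f" using assms X by simp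
    then show "is_true (eq_at E X \<bullet> pair E f g)" unfolding true_diagonal using assms X D by simp
  qed
qed


subsection \<open>Representable predicates on generalized elements\<close>

definition represents :: "'o \<Rightarrow> ('o \<Rightarrow> 'a \<Rightarrow> bool) \<Rightarrow> 'a \<Rightarrow> bool" where
  "represents G \<Phi> c \<longleftrightarrow> c \<in> Hom E G \<Omega> \<and> (\<forall>D f. f \<in> Hom E D G \<longrightarrow> is_true (c \<bullet> f) \<longleftrightarrow> \<Phi> D f)"

lemma representsD:
  assumes "represents G \<Phi> c"
  shows "c \<in> Arr E" "Dom E c = G" "Cod E c = \<Omega>"
    and "\<And>D f. f \<in> Hom E D G \<Longrightarrow> is_true (c \<bullet> f) \<longleftrightarrow> \<Phi> D f"
  using assms by (simp_all add: represents_def)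

lemma represents_unique:
  assumes "represents G \<Phi> c" "represents G \<Psi> d" "\<And>D f. f \<in> Hom E D G \<Longrightarrow> \<Phi> D f \<longleftrightarrow> \<Psi> D f"
  shows "c = d"
  using assms by (intro is_true_ext[of c G]) (auto simp: represents_def)

lemma represents_comp:
  assumes "represents G \<Phi> c" "g \<in> Hom E G' G"
  shows "represents G' (\<lambda>D f. \<Phi> D (g \<bullet> f)) (c \<bullet> g)"
  using assms by (auto simp: represents_def)

lemma represents_greatest:
  assumes "represents G \<Phi> c"
    and "\<And>d. d \<in> Hom E G \<Omega> \<Longrightarrow> \<Psi> d \<longleftrightarrow> (\<forall>D f. f \<in> Hom E D G \<longrightarrow> is_true (d \<bullet> f) \<longrightarrow> \<Phi> D f)"
  shows "(THE c. c \<in> Hom E G \<Omega> \<and> (\<forall>d\<in>Hom E G \<Omega>. sub_le E G d c \<longleftrightarrow> \<Psi> d)) = c"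
proof (rule the_equality)
  show c: "c \<in> Hom E G \<Omega> \<and> (\<forall>d\<in>Hom E G \<Omega>. sub_le E G d c \<longleftrightarrow> \<Psi> d)"
    using assms by (auto simp: represents_def sub_le_iff)
  fix b assume b: "b \<in> Hom E G \<Omega> \<and> (\<forall>d\<in>Hom E G \<Omega>. sub_le E G d b \<longleftrightarrow> \<Psi> d)"
  have "sub_le E G b b" "sub_le E G c c" by (simp_all add: sub_le_def)
  then show "b = c" using b c by (intro sub_le_antisym) auto
qed

lemma represents_least:
  assumes "represents G \<Phi> c"
    and "\<And>d. d \<in> Hom E G \<Omega> \<Longrightarrow> \<Psi> d \<longleftrightarrow> (\<forall>D f. f \<in> Hom E D G \<longrightarrow> \<Phi> D f \<longrightarrow> is_true (d \<bullet> f))"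
  shows "(THE c. c \<in> Hom E G \<Omega> \<and> (\<forall>d\<in>Hom E G \<Omega>. sub_le E G c d \<longleftrightarrow> \<Psi> d)) = c"
proof (rule the_equality)
  show c: "c \<in> Hom E G \<Omega> \<and> (\<forall>d\<in>Hom E G \<Omega>. sub_le E G c d \<longleftrightarrow> \<Psi> d)"
    using assms by (auto simp: represents_def sub_le_iff)
  fix b assume b: "b \<in> Hom E G \<Omega> \<and> (\<forall>d\<in>Hom E G \<Omega>. sub_le E G b d \<longleftrightarrow> \<Psi> d)"
  have "sub_le E G b b" "sub_le E G c c" by (simp_all add: sub_le_def)
  then show "b = c" using b c by (intro sub_le_antisym) auto
qed


subsection \<open>Kripke--Joyal semantics of the logical operations\<close>

lemma represents_sub_meet:
  assumes "p \<in> Hom E G \<Omega>" "q \<in> Hom E G \<Omega>"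
  shows "represents G (\<lambda>D f. is_true (p \<bullet> f) \<and> is_true (q \<bullet> f)) (sub_meet E G p q)"
proof -
  have G: "G \<in> Obj E" using assms(1) by auto
  let ?c = "eq_at E (Prod E \<Omega> \<Omega>) \<bullet> pair E (pair E p q) (pair E (true_at E G) (true_at E G))"
  have "is_true (?c \<bullet> f) \<longleftrightarrow> is_true (p \<bullet> f) \<and> is_true (q \<bullet> f)" if f: "f \<in> Hom E D G" for D f
  proof -
    have D: "D \<in> Obj E" using f by auto
    have "is_true (?c \<bullet> f) \<longleftrightarrow> pair E (p \<bullet> f) (q \<bullet> f) = pair E (true_at E D) (true_at E D)"
      using assms f G D by simp
    also have "\<dots> \<longleftrightarrow> p \<bullet> f = true_at E D \<and> q \<bullet> f = true_at E D"
      using assms f G D by (auto dest: pair_inject)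
    finally show ?thesis using assms f by (simp add: is_true_def)
  qed
  then have represents_c: "represents G (\<lambda>D f. is_true (p \<bullet> f) \<and> is_true (q \<bullet> f)) ?c"
    using assms G by (simp add: represents_def)
  moreover have "sub_meet E G p q = ?c"
    unfolding sub_meet_def using assms
    by (intro represents_greatest[OF represents_c]) (auto simp: sub_le_iff)
  ultimately show ?thesis by simp
qed

lemma sub_meet_simps [simp]:
  assumes "p \<in> Arr E" "q \<in> Arr E" "Dom E p = G" "Dom E q = G" "Cod E p = \<Omega>" "Cod E q = \<Omega>"
  shows "sub_meet E G p q \<in> Arr E" "Dom E (sub_meet E G p q) = G" "Cod E (sub_meet E G p q) = \<Omega>"
    "f \<in> Arr E \<Longrightarrow> Cod E f = G \<Longrightarrow>
      sub_meet E G p q \<bullet> f = sub_meet E (Dom E f) (p \<bullet> f) (q \<bullet> f)"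
    "is_true (sub_meet E G p q) \<longleftrightarrow> is_true p \<and> is_true q"
proof -
  have pq: "represents G (\<lambda>D f. is_true (p \<bullet> f) \<and> is_true (q \<bullet> f)) (sub_meet E G p q)"
    using assms by (intro represents_sub_meet) simp_all
  show "sub_meet E G p q \<in> Arr E" "Dom E (sub_meet E G p q) = G" "Cod E (sub_meet E G p q) = \<Omega>"
    using representsD[OF pq] by auto
  show "is_true (sub_meet E G p q) \<longleftrightarrow> is_true p \<and> is_true q"
    using representsD[OF pq] representsD(4)[OF pq, of "Idt E G" G] assms by auto
  show "sub_meet E G p q \<bullet> f = sub_meet E (Dom E f) (p \<bullet> f) (q \<bullet> f)"
    if "f \<in> Arr E" "Cod E f = G"
    using assms that
    by (intro represents_unique[OF represents_comp[OF pq] represents_sub_meet]) auto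
qed

lemma sub_le_sub_meet_iff:
  assumes "d \<in> Hom E G \<Omega>" "p \<in> Hom E G \<Omega>" "q \<in> Hom E G \<Omega>"
  shows "sub_le E G (sub_meet E G d p) q \<longleftrightarrow>
    (\<forall>D f. f \<in> Hom E D G \<longrightarrow> is_true (d \<bullet> f) \<longrightarrow> sub_le E D (p \<bullet> f) (q \<bullet> f))" (is "?lhs \<longleftrightarrow> ?rhs")
proof
  assume lhs: ?lhs
  have "is_true (q \<bullet> f \<bullet> g)"
    if f: "f \<in> Hom E D G" "is_true (d \<bullet> f)" and g: "g \<in> Hom E D' D" "is_true (p \<bullet> f \<bullet> g)"
      for D f D' g
    using lhs is_true_comp[OF f(2), of g] f g assms by (auto simp: sub_le_iff)
  then show ?rhs using assms by (simp add: sub_le_iff)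
next
  assume rhs: ?rhs
  have "is_true (q \<bullet> f)" if f: "f \<in> Hom E D G" "is_true (d \<bullet> f)" "is_true (p \<bullet> f)" for D f
    using rhs[rule_format, OF f(1,2)] by (rule sub_leD) (use f assms in simp_all)
  then show ?lhs using assms by (simp add: sub_le_iff)
qed

lemma represents_sub_imp:
  assumes "p \<in> Hom E G \<Omega>" "q \<in> Hom E G \<Omega>"
  shows "represents G (\<lambda>D f. sub_le E D (p \<bullet> f) (q \<bullet> f)) (sub_imp E G p q)"
proof -
  have G: "G \<in> Obj E" using assms(1) by auto
  let ?c = "eq_at E \<Omega> \<bullet> pair E (sub_meet E G p q) p"
  have "is_true (?c \<bullet> f) \<longleftrightarrow> sub_le E D (p \<bullet> f) (q \<bullet> f)" if f: "f \<in> Hom E D G" for D f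
  proof -
    have "is_true (?c \<bullet> f) \<longleftrightarrow> sub_meet E D (p \<bullet> f) (q \<bullet> f) = p \<bullet> f"
      using assms f G by simp
    also have "\<dots> \<longleftrightarrow> (\<forall>D' g. g \<in> Hom E D' D \<longrightarrow>
        (is_true (sub_meet E D (p \<bullet> f) (q \<bullet> f) \<bullet> g) \<longleftrightarrow> is_true ((p \<bullet> f) \<bullet> g)))"
      using assms f by (auto intro!: is_true_ext[of _ D] simp del: sub_meet_simps(4,5))
    also have "\<dots> \<longleftrightarrow> sub_le E D (p \<bullet> f) (q \<bullet> f)"
      using assms f by (auto simp: sub_le_iff)
    finally show ?thesis .
  qed
  then have represents_c: "represents G (\<lambda>D f. sub_le E D (p \<bullet> f) (q \<bullet> f)) ?c"
    using assms G by (simp add: represents_def)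
  have "sub_imp E G p q = ?c"
    unfolding sub_imp_def using assms
    by (intro represents_greatest[OF represents_c] sub_le_sub_meet_iff)
  then show ?thesis using represents_c by simp
qed

lemma sub_imp_simps [simp]:
  assumes "p \<in> Arr E" "q \<in> Arr E" "Dom E p = G" "Dom E q = G" "Cod E p = \<Omega>" "Cod E q = \<Omega>"
  shows "sub_imp E G p q \<in> Arr E" "Dom E (sub_imp E G p q) = G" "Cod E (sub_imp E G p q) = \<Omega>"
    "f \<in> Arr E \<Longrightarrow> Cod E f = G \<Longrightarrow>
      sub_imp E G p q \<bullet> f = sub_imp E (Dom E f) (p \<bullet> f) (q \<bullet> f)"
    "is_true (sub_imp E G p q) \<longleftrightarrow> sub_le E G p q"
proof -
  have pq: "represents G (\<lambda>D f. sub_le E D (p \<bullet> f) (q \<bullet> f)) (sub_imp E G p q)"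
    using assms by (intro represents_sub_imp) simp_all
  show "sub_imp E G p q \<in> Arr E" "Dom E (sub_imp E G p q) = G" "Cod E (sub_imp E G p q) = \<Omega>"
    using representsD[OF pq] by auto
  show "is_true (sub_imp E G p q) \<longleftrightarrow> sub_le E G p q"
    using representsD[OF pq] representsD(4)[OF pq, of "Idt E G" G] assms by auto
  show "sub_imp E G p q \<bullet> f = sub_imp E (Dom E f) (p \<bullet> f) (q \<bullet> f)"
    if "f \<in> Arr E" "Cod E f = G"
    using assms that
    by (intro represents_unique[OF represents_comp[OF pq] represents_sub_imp]) auto
qed

lemma sub_imp_sub_imp:
  assumes "p \<in> Hom E G \<Omega>" "q \<in> Hom E G \<Omega>" "r \<in> Hom E G \<Omega>"
  shows "sub_imp E G p (sub_imp E G q r) = sub_imp E G (sub_meet E G p q) r"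
proof (rule is_true_ext)
  fix D f assume f: "f \<in> Hom E D G"
  have "is_true (sub_imp E G p (sub_imp E G q r) \<bullet> f) \<longleftrightarrow>
      sub_le E D (p \<bullet> f) (sub_imp E D (q \<bullet> f) (r \<bullet> f))"
    using f assms by simp
  also have "\<dots> \<longleftrightarrow> sub_le E D (sub_meet E D (p \<bullet> f) (q \<bullet> f)) (r \<bullet> f)"
    using f assms sub_le_sub_meet_iff[of "p \<bullet> f" D "q \<bullet> f" "r \<bullet> f"]
    by (simp add: sub_le_iff[of "p \<bullet> f"])
  also have "\<dots> \<longleftrightarrow> is_true (sub_imp E G (sub_meet E G p q) r \<bullet> f)"
    using f assms by simp
  finally show "is_true (sub_imp E G p (sub_imp E G q r) \<bullet> f) \<longleftrightarrow>
    is_true (sub_imp E G (sub_meet E G p q) r \<bullet> f)" .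
qed (use assms in simp_all)

lemma sub_le_comp_Fst_iff:
  assumes d: "d \<in> Hom E G \<Omega>" and "X \<in> Obj E" "p \<in> Hom E (Prod E G X) \<Omega>"
  shows "sub_le E (Prod E G X) (d \<bullet> Fst E G X) p \<longleftrightarrow>
    (\<forall>D f. f \<in> Hom E D G \<longrightarrow> is_true (d \<bullet> f) \<longrightarrow> is_true (p \<bullet> pair E (f \<bullet> Fst E D X) (Snd E D X)))"
    (is "?lhs \<longleftrightarrow> ?rhs")
proof -
  have G: "G \<in> Obj E" using d by auto
  show ?thesis
  proof
    assume lhs: ?lhs
    show ?rhs
    proof (intro allI impI)
      fix D f assume f: "f \<in> Hom E D G" "is_true (d \<bullet> f)"
      then have D: "D \<in> Obj E" by auto
      have "is_true (d \<bullet> f \<bullet> Fst E D X)"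
        using is_true_comp[OF f(2), of "Fst E D X"] f D assms by simp
      then show "is_true (p \<bullet> pair E (f \<bullet> Fst E D X) (Snd E D X))"
        using lhs f D G assms sub_le_iff[of "d \<bullet> Fst E G X" "Prod E G X" p] by simp
    qed
  next
    assume rhs: ?rhs
    have "is_true (p \<bullet> pair E f x)"
      if f: "f \<in> Hom E D G" "x \<in> Hom E D X" "is_true (d \<bullet> f)" for D f x
    proof -
      have D: "D \<in> Obj E" using f by auto
      have "is_true ((p \<bullet> pair E (f \<bullet> Fst E D X) (Snd E D X)) \<bullet> pair E (Idt E D) x)"
        by (rule is_true_comp[OF rhs[rule_format, OF f(1,3)]]) (use f D assms in simp_all)
      then show ?thesis using f D assms by simp
    qed
    then show ?lhs using G assms by (simp add: sub_le_iff all_Arr_Prod_iff)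
  qed
qed

lemma represents_sub_all:
  assumes "X \<in> Obj E" "G \<in> Obj E" "p \<in> Hom E (Prod E G X) \<Omega>"
  shows "represents G (\<lambda>D f. is_true (p \<bullet> pair E (f \<bullet> Fst E D X) (Snd E D X))) (sub_all E G X p)"
    (is "represents G ?\<Phi> _")
proof -
  let ?true = "true_at E (Prod E G X)"
  let ?c = "eq_at E (Exp E X \<Omega>) \<bullet> pair E (curried E G X \<Omega> p) (curried E G X \<Omega> ?true)"
  have "is_true (?c \<bullet> f) \<longleftrightarrow> ?\<Phi> D f" if f: "f \<in> Hom E D G" for D f
  proof -
    let ?g = "pair E (f \<bullet> Fst E D X) (Snd E D X)"
    have D: "D \<in> Obj E" using f by auto
    have g: "?g \<in> Hom E (Prod E D X) (Prod E G X)" using f D assms by simp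
    have "is_true (?c \<bullet> f) \<longleftrightarrow> curried E D X \<Omega> (p \<bullet> ?g) = curried E D X \<Omega> (?true \<bullet> ?g)"
      using assms f D g by (simp add: curried_comp)
    also have "\<dots> \<longleftrightarrow> p \<bullet> ?g = ?true \<bullet> ?g"
      by (rule curried_inject) (use assms D g in simp_all)
    finally show ?thesis using assms D g by (simp add: is_true_def)
  qed
  then have represents_c: "represents G ?\<Phi> ?c" using assms by (simp add: represents_def)
  have "sub_all E G X p = ?c"
    unfolding sub_all_def using assms
    by (intro represents_greatest[OF represents_c] sub_le_comp_Fst_iff)
  then show ?thesis using represents_c by simp
qed

lemma sub_all_simps [simp]:
  assumes "X \<in> Obj E" "G \<in> Obj E" "p \<in> Arr E" "Dom E p = Prod E G X" "Cod E p = \<Omega>"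
  shows "sub_all E G X p \<in> Arr E" "Dom E (sub_all E G X p) = G" "Cod E (sub_all E G X p) = \<Omega>"
    "f \<in> Arr E \<Longrightarrow> Cod E f = G \<Longrightarrow> sub_all E G X p \<bullet> f =
      sub_all E (Dom E f) X (p \<bullet> pair E (f \<bullet> Fst E (Dom E f) X) (Snd E (Dom E f) X))"
    "is_true (sub_all E G X p) \<longleftrightarrow> is_true p"
proof -
  have p: "represents G (\<lambda>D f. is_true (p \<bullet> pair E (f \<bullet> Fst E D X) (Snd E D X))) (sub_all E G X p)"
    using assms by (intro represents_sub_all) simp_all
  show "sub_all E G X p \<in> Arr E" "Dom E (sub_all E G X p) = G" "Cod E (sub_all E G X p) = \<Omega>"
    using representsD[OF p] by auto
  show "is_true (sub_all E G X p) \<longleftrightarrow> is_true p"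
    using representsD[OF p] representsD(4)[OF p, of "Idt E G" G] assms by auto
  show "sub_all E G X p \<bullet> f =
      sub_all E (Dom E f) X (p \<bullet> pair E (f \<bullet> Fst E (Dom E f) X) (Snd E (Dom E f) X))"
    if "f \<in> Arr E" "Cod E f = G"
    using assms that
    by (intro represents_unique[OF represents_comp[OF p] represents_sub_all]) auto
qed

lemma sub_imp_sub_all:
  assumes "p \<in> Hom E G \<Omega>" "X \<in> Obj E" "q \<in> Hom E (Prod E G X) \<Omega>"
  shows "sub_imp E G p (sub_all E G X q) = sub_all E G X (sub_imp E (Prod E G X) (p \<bullet> Fst E G X) q)"
proof (rule is_true_ext)
  have G: "G \<in> Obj E" using assms(1) by auto
  fix D f assume f: "f \<in> Hom E D G"
  then have D: "D \<in> Obj E" by auto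
  let ?q = "q \<bullet> pair E (f \<bullet> Fst E D X) (Snd E D X)"
  have "is_true (sub_imp E G p (sub_all E G X q) \<bullet> f) \<longleftrightarrow> sub_le E D (p \<bullet> f) (sub_all E D X ?q)"
    using f assms G D by simp
  also have "\<dots> \<longleftrightarrow> sub_le E (Prod E D X) ((p \<bullet> f) \<bullet> Fst E D X) ?q"
    using f assms G D sub_le_comp_Fst_iff[of "p \<bullet> f" D X ?q] by (simp add: sub_le_iff[of "p \<bullet> f"])
  also have "\<dots> \<longleftrightarrow> is_true (sub_all E G X (sub_imp E (Prod E G X) (p \<bullet> Fst E G X) q) \<bullet> f)"
    using f assms G D by simp
  finally show "is_true (sub_imp E G p (sub_all E G X q) \<bullet> f) \<longleftrightarrow>
    is_true (sub_all E G X (sub_imp E (Prod E G X) (p \<bullet> Fst E G X) q) \<bullet> f)" .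
qed (use assms dom_obj[of p] in auto)

text \<open>\<open>\<bottom>\<close>, \<open>\<or>\<close> and \<open>\<exists>\<close> are least upper bounds of sieves \<open>S\<close>; they are obtained by the
  second-order encoding \<open>\<forall>r:\<Omega>. (S \<rightarrow> r) \<rightarrow> r\<close>. This makes their stability under substitution
  evident, without image factorizations.\<close>

definition sieve :: "'o \<Rightarrow> ('o \<Rightarrow> 'a \<Rightarrow> bool) \<Rightarrow> bool" where
  "sieve G S \<longleftrightarrow> (\<forall>D D' f g. f \<in> Hom E D G \<longrightarrow> g \<in> Hom E D' D \<longrightarrow> S D f \<longrightarrow> S D' (f \<bullet> g))"

definition covered :: "('o \<Rightarrow> 'a \<Rightarrow> bool) \<Rightarrow> 'o \<Rightarrow> 'a \<Rightarrow> bool" where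
  "covered S D f \<longleftrightarrow> (\<forall>D' g r. g \<in> Hom E D' D \<longrightarrow> r \<in> Hom E D' \<Omega> \<longrightarrow>
    (\<forall>D'' h. h \<in> Hom E D'' D' \<longrightarrow> S D'' (f \<bullet> g \<bullet> h) \<longrightarrow> is_true (r \<bullet> h)) \<longrightarrow> is_true r)"

lemma covered_comp:
  assumes "f \<in> Hom E D G" "g \<in> Hom E D' D"
    and "\<And>D'' h. h \<in> Hom E D'' D \<Longrightarrow> S' D'' h \<longleftrightarrow> S D'' (f \<bullet> h)"
  shows "covered S D' (f \<bullet> g) \<longleftrightarrow> covered S' D' g"
proof -
  have "S D2 ((f \<bullet> g) \<bullet> h \<bullet> k) \<longleftrightarrow> S' D2 (g \<bullet> h \<bullet> k)"
    if "h \<in> Hom E D1 D'" "k \<in> Hom E D2 D1" for D1 D2 h k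
    using assms(3)[of "g \<bullet> h \<bullet> k" D2] assms(1,2) that by simp
  then show ?thesis unfolding covered_def by (intro all_cong1 imp_cong refl) blast
qed

lemma covered_mono:
  assumes "covered S D f" "f \<in> Hom E D G" "\<And>D' g. g \<in> Hom E D' G \<Longrightarrow> S D' g \<Longrightarrow> S' D' g"
  shows "covered S' D f"
proof -
  have "f \<bullet> g \<bullet> h \<in> Hom E D2 G" if "g \<in> Hom E D1 D" "h \<in> Hom E D2 D1" for D1 D2 g h
    using assms(2) that by simp
  then show ?thesis using assms(1,3) unfolding covered_def by meson
qed

lemma represents_covered:
  assumes "G \<in> Obj E" "represents (Prod E G \<Omega>)
    (\<lambda>D u. \<forall>D' h. h \<in> Hom E D' D \<longrightarrow> S D' (Fst E G \<Omega> \<bullet> u \<bullet> h) \<longrightarrow> is_true (Snd E G \<Omega> \<bullet> u \<bullet> h)) w"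
  shows "represents G (covered S) (sub_all E G \<Omega> (sub_imp E (Prod E G \<Omega>) w (Snd E G \<Omega>)))"
    (is "represents G _ ?c")
proof -
  note w = representsD[OF assms(2)]
  have "is_true (?c \<bullet> f) \<longleftrightarrow> covered S D f" if f: "f \<in> Hom E D G" for D f
  proof -
    let ?f = "pair E (f \<bullet> Fst E D \<Omega>) (Snd E D \<Omega>)"
    have D: "D \<in> Obj E" using f by auto
    have "is_true (?c \<bullet> f) \<longleftrightarrow> sub_le E (Prod E D \<Omega>) (w \<bullet> ?f) (Snd E D \<Omega>)"
      using f D assms(1) w(1-3) by simp
    also have "\<dots> \<longleftrightarrow> (\<forall>D' g r. g \<in> Hom E D' D \<longrightarrow> r \<in> Hom E D' \<Omega> \<longrightarrow>
        is_true (w \<bullet> pair E (f \<bullet> g) r) \<longrightarrow> is_true r)"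
      using f D assms(1) w(1-3) by (simp add: sub_le_iff all_Arr_Prod_iff)
    also have "\<dots> \<longleftrightarrow> covered S D f"
      unfolding covered_def
      by (intro all_cong1 imp_cong refl, subst w(4)) (use f assms(1) in auto)
    finally show ?thesis .
  qed
  then show ?thesis using assms(1) w(1-3) by (simp add: represents_def)
qed

lemma covered_upper_bound:
  assumes S: "sieve G S" and d: "d \<in> Hom E G \<Omega>"
  shows "(\<forall>D f. f \<in> Hom E D G \<longrightarrow> covered S D f \<longrightarrow> is_true (d \<bullet> f)) \<longleftrightarrow>
    (\<forall>D f. f \<in> Hom E D G \<longrightarrow> S D f \<longrightarrow> is_true (d \<bullet> f))" (is "?lhs \<longleftrightarrow> ?rhs")
proof
  assume lhs: ?lhs
  have "covered S D f" if f: "f \<in> Hom E D G" "S D f" for D f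
    unfolding covered_def
  proof (intro allI impI)
    fix D' g r assume g: "g \<in> Hom E D' D" "r \<in> Hom E D' \<Omega>"
      and bound: "\<forall>D'' h. h \<in> Hom E D'' D' \<longrightarrow> S D'' (f \<bullet> g \<bullet> h) \<longrightarrow> is_true (r \<bullet> h)"
    have D': "D' \<in> Obj E" using g(1) by auto
    have "S D' (f \<bullet> g)" using S f g unfolding sieve_def by blast
    then have "is_true (r \<bullet> Idt E D')" using f g D' by (intro bound[rule_format]) simp_all
    then show "is_true r" using g by simp
  qed
  then show ?rhs using lhs by blast
next
  assume rhs: ?rhs
  show ?lhs
  proof (intro allI impI)
    fix D f assume f: "f \<in> Hom E D G" and cov: "covered S D f"
    have D: "D \<in> Obj E" using f by auto
    have "is_true ((d \<bullet> f) \<bullet> h)" if "h \<in> Hom E D' D" "S D' (f \<bullet> h)" for D' h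
      using rhs that f d by auto
    then show "is_true (d \<bullet> f)"
      using cov[unfolded covered_def, rule_format, of "Idt E D" D "d \<bullet> f"] f d D by simp
  qed
qed

lemma represents_sub_bot:
  assumes G: "G \<in> Obj E"
  shows "represents G (covered (\<lambda>D f. False)) (sub_bot E G)"
proof -
  let ?c = "sub_all E G \<Omega> (sub_imp E (Prod E G \<Omega>) (true_at E (Prod E G \<Omega>)) (Snd E G \<Omega>))"
  have represents_c: "represents G (covered (\<lambda>D f. False)) ?c"
    using G by (intro represents_covered) (auto simp: represents_def)
  have "(\<forall>D f. f \<in> Hom E D G \<longrightarrow> covered (\<lambda>D f. False) D f \<longrightarrow> is_true (d \<bullet> f)) \<longleftrightarrow> True"
    if "d \<in> Hom E G \<Omega>" for d
    using covered_upper_bound[OF _ that] by (simp add: sieve_def)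
  then have "(THE c. c \<in> Hom E G \<Omega> \<and> (\<forall>d\<in>Hom E G \<Omega>. sub_le E G c d \<longleftrightarrow> True)) = ?c"
    by (intro represents_least[OF represents_c]) blast
  then show ?thesis using represents_c by (simp add: sub_bot_def)
qed

lemma sub_bot_simps [simp]:
  assumes "G \<in> Obj E"
  shows "sub_bot E G \<in> Arr E" "Dom E (sub_bot E G) = G" "Cod E (sub_bot E G) = \<Omega>"
    "f \<in> Arr E \<Longrightarrow> Cod E f = G \<Longrightarrow> sub_bot E G \<bullet> f = sub_bot E (Dom E f)"
proof -
  note bot = represents_sub_bot[OF assms]
  show "sub_bot E G \<in> Arr E" "Dom E (sub_bot E G) = G" "Cod E (sub_bot E G) = \<Omega>"
    using representsD[OF bot] by auto
  show "sub_bot E G \<bullet> f = sub_bot E (Dom E f)" if f: "f \<in> Arr E" "Cod E f = G"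
  proof (rule represents_unique[OF represents_comp[OF bot] represents_sub_bot])
    fix D g assume "g \<in> Hom E D (Dom E f)"
    then show "covered (\<lambda>D f. False) D (f \<bullet> g) \<longleftrightarrow> covered (\<lambda>D f. False) D g"
      using f by (intro covered_comp) simp_all
  qed (use f in simp_all)
qed

lemma represents_sub_join:
  assumes "p \<in> Hom E G \<Omega>" "q \<in> Hom E G \<Omega>"
  shows "represents G (covered (\<lambda>D f. is_true (p \<bullet> f) \<or> is_true (q \<bullet> f))) (sub_join E G p q)"
    (is "represents G (covered ?S) _")
proof -
  have G: "G \<in> Obj E" using assms by auto
  let ?F = "Fst E G \<Omega>" and ?P = "Snd E G \<Omega>" and ?G = "Prod E G \<Omega>"
  let ?w = "sub_meet E ?G (sub_imp E ?G (p \<bullet> ?F) ?P) (sub_imp E ?G (q \<bullet> ?F) ?P)"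
  have "is_true (?w \<bullet> u) \<longleftrightarrow> (\<forall>D' h. h \<in> Hom E D' D \<longrightarrow> ?S D' (?F \<bullet> u \<bullet> h) \<longrightarrow> is_true (?P \<bullet> u \<bullet> h))"
    if u: "u \<in> Hom E D ?G" for D u
    using u assms G by (auto simp: sub_le_iff)
  then have represents_c: "represents G (covered ?S) (sub_all E G \<Omega> (sub_imp E ?G ?w ?P))"
    using assms G by (intro represents_covered) (simp_all add: represents_def)
  have "sieve G ?S"
    using assms is_true_comp[of "p \<bullet> _"] is_true_comp[of "q \<bullet> _"] by (fastforce simp: sieve_def)
  then have "sub_join E G p q = sub_all E G \<Omega> (sub_imp E ?G ?w ?P)"
    unfolding sub_join_def using assms
    by (intro represents_least[OF represents_c])
      (auto simp: covered_upper_bound[simplified] sub_le_iff)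
  then show ?thesis using represents_c by simp
qed

lemma sub_join_simps [simp]:
  assumes "p \<in> Arr E" "q \<in> Arr E" "Dom E p = G" "Dom E q = G" "Cod E p = \<Omega>" "Cod E q = \<Omega>"
  shows "sub_join E G p q \<in> Arr E" "Dom E (sub_join E G p q) = G" "Cod E (sub_join E G p q) = \<Omega>"
    "f \<in> Arr E \<Longrightarrow> Cod E f = G \<Longrightarrow>
      sub_join E G p q \<bullet> f = sub_join E (Dom E f) (p \<bullet> f) (q \<bullet> f)"
proof -
  have pq: "represents G (covered (\<lambda>D f. is_true (p \<bullet> f) \<or> is_true (q \<bullet> f))) (sub_join E G p q)"
    using assms by (intro represents_sub_join) simp_all
  show "sub_join E G p q \<in> Arr E" "Dom E (sub_join E G p q) = G" "Cod E (sub_join E G p q) = \<Omega>"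
    using representsD[OF pq] by auto
  show "sub_join E G p q \<bullet> f = sub_join E (Dom E f) (p \<bullet> f) (q \<bullet> f)"
    if f: "f \<in> Arr E" "Cod E f = G"
  proof (rule represents_unique[OF represents_comp[OF pq] represents_sub_join])
    fix D g assume "g \<in> Hom E D (Dom E f)"
    then show "covered (\<lambda>D h. is_true (p \<bullet> h) \<or> is_true (q \<bullet> h)) D (f \<bullet> g) \<longleftrightarrow>
        covered (\<lambda>D h. is_true ((p \<bullet> f) \<bullet> h) \<or> is_true ((q \<bullet> f) \<bullet> h)) D g"
      using assms f by (intro covered_comp[of f _ G]) auto
  qed (use assms f in simp_all)
qed

lemma represents_sub_ex:
  assumes "X \<in> Obj E" "G \<in> Obj E" and p: "p \<in> Hom E (Prod E G X) \<Omega>"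
  shows "represents G (covered (\<lambda>D f. \<exists>x. x \<in> Hom E D X \<and> is_true (p \<bullet> pair E f x)))
      (sub_ex E G X p)"
    (is "represents G (covered ?S) _")
proof -
  let ?F = "Fst E G \<Omega>" and ?P = "Snd E G \<Omega>" and ?G = "Prod E G \<Omega>"
  let ?w = "sub_all E ?G X (sub_imp E (Prod E ?G X)
    (p \<bullet> pair E (?F \<bullet> Fst E ?G X) (Snd E ?G X)) (?P \<bullet> Fst E ?G X))"
  have "is_true (?w \<bullet> u) \<longleftrightarrow> (\<forall>D' h. h \<in> Hom E D' D \<longrightarrow> ?S D' (?F \<bullet> u \<bullet> h) \<longrightarrow> is_true (?P \<bullet> u \<bullet> h))"
    if u: "u \<in> Hom E D ?G" for D u
  proof -
    have D: "D \<in> Obj E" using u by auto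
    have "is_true (?w \<bullet> u) \<longleftrightarrow> sub_le E (Prod E D X)
        (p \<bullet> pair E (?F \<bullet> u \<bullet> Fst E D X) (Snd E D X)) (?P \<bullet> u \<bullet> Fst E D X)"
      using u D assms by simp
    then show ?thesis
      using u D assms by (auto simp: sub_le_iff all_Arr_Prod_iff)
  qed
  then have represents_c: "represents G (covered ?S) (sub_all E G \<Omega> (sub_imp E ?G ?w ?P))"
    using assms by (intro represents_covered) (simp_all add: represents_def)
  have "?S D' (f \<bullet> g)" if f: "f \<in> Hom E D G" "g \<in> Hom E D' D" and "?S D f" for D D' f g
  proof -
    obtain x where x: "x \<in> Hom E D X" "is_true (p \<bullet> pair E f x)" using \<open>?S D f\<close> by auto
    have "is_true ((p \<bullet> pair E f x) \<bullet> g)" using x f p by (intro is_true_comp[OF x(2)]) auto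
    then show ?thesis using x f p by (intro exI[of _ "x \<bullet> g"]) simp
  qed
  then have "sieve G ?S" unfolding sieve_def by blast
  then have "sub_ex E G X p = sub_all E G \<Omega> (sub_imp E ?G ?w ?P)"
    unfolding sub_ex_def using assms
    by (intro represents_least[OF represents_c])
      (auto simp: covered_upper_bound[simplified] sub_le_iff all_Arr_Prod_iff)
  then show ?thesis using represents_c by simp
qed

lemma sub_ex_simps [simp]:
  assumes "X \<in> Obj E" "G \<in> Obj E" "p \<in> Arr E" "Dom E p = Prod E G X" "Cod E p = \<Omega>"
  shows "sub_ex E G X p \<in> Arr E" "Dom E (sub_ex E G X p) = G" "Cod E (sub_ex E G X p) = \<Omega>"
    "f \<in> Arr E \<Longrightarrow> Cod E f = G \<Longrightarrow> sub_ex E G X p \<bullet> f =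
      sub_ex E (Dom E f) X (p \<bullet> pair E (f \<bullet> Fst E (Dom E f) X) (Snd E (Dom E f) X))"
proof -
  have p: "represents G (covered (\<lambda>D f. \<exists>x. x \<in> Hom E D X \<and> is_true (p \<bullet> pair E f x)))
      (sub_ex E G X p)"
    using assms by (intro represents_sub_ex) simp_all
  show "sub_ex E G X p \<in> Arr E" "Dom E (sub_ex E G X p) = G" "Cod E (sub_ex E G X p) = \<Omega>"
    using representsD[OF p] by auto
  show "sub_ex E G X p \<bullet> f =
      sub_ex E (Dom E f) X (p \<bullet> pair E (f \<bullet> Fst E (Dom E f) X) (Snd E (Dom E f) X))"
    (is "_ = sub_ex E ?D X ?q") if f: "f \<in> Arr E" "Cod E f = G"
  proof (rule represents_unique[OF represents_comp[OF p] represents_sub_ex])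
    fix D g assume "g \<in> Hom E D ?D"
    then show "covered (\<lambda>D h. \<exists>x. x \<in> Hom E D X \<and> is_true (p \<bullet> pair E h x)) D (f \<bullet> g) \<longleftrightarrow>
        covered (\<lambda>D h. \<exists>x. x \<in> Hom E D X \<and> is_true (?q \<bullet> pair E h x)) D g"
      using assms f by (intro covered_comp[of f _ G] ex_cong1 conj_cong refl) auto
  qed (use assms f in simp_all)
qed

lemma sub_join_mono:
  assumes "p \<in> Hom E G \<Omega>" "q \<in> Hom E G \<Omega>" "p' \<in> Hom E G \<Omega>" "q' \<in> Hom E G \<Omega>"
    and "sub_le E G p p'" "sub_le E G q q'"
  shows "sub_le E G (sub_join E G p q) (sub_join E G p' q')"
proof -
  note pq = representsD[OF represents_sub_join[OF assms(1,2)]]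
    and pq' = representsD[OF represents_sub_join[OF assms(3,4)]]
  have "is_true (sub_join E G p' q' \<bullet> f)"
    if f: "f \<in> Hom E D G" "is_true (sub_join E G p q \<bullet> f)" for D f
    unfolding pq'(4)[OF f(1)]
    by (rule covered_mono[OF f(2)[unfolded pq(4)[OF f(1)]] f(1)])
      (use assms(5,6) sub_le_iff[OF assms(1,3)] sub_le_iff[OF assms(2,4)] in blast)
  then show ?thesis using pq(1-3) pq'(1-3) by (simp add: sub_le_iff)
qed

lemma sub_ex_mono:
  assumes "X \<in> Obj E" "G \<in> Obj E" "p \<in> Hom E (Prod E G X) \<Omega>" "q \<in> Hom E (Prod E G X) \<Omega>"
    and "sub_le E (Prod E G X) p q"
  shows "sub_le E G (sub_ex E G X p) (sub_ex E G X q)"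
proof -
  note p = representsD[OF represents_sub_ex[OF assms(1-3)]]
    and q = representsD[OF represents_sub_ex[OF assms(1,2,4)]]
  have pointwise: "is_true (q \<bullet> pair E f x)"
    if "f \<in> Hom E D G" "x \<in> Hom E D X" "is_true (p \<bullet> pair E f x)" for D f x
    using assms(5) that unfolding sub_le_iff[OF assms(3,4)] by simp
  have "is_true (sub_ex E G X q \<bullet> f)" if f: "f \<in> Hom E D G" "is_true (sub_ex E G X p \<bullet> f)" for D f
    unfolding q(4)[OF f(1)]
    by (rule covered_mono[OF f(2)[unfolded p(4)[OF f(1)]] f(1)]) (use pointwise in blast)
  then show ?thesis using p(1-3) q(1-3) by (simp add: sub_le_iff)
qed


subsection \<open>Terms at generalized elements\<close>

inductive_simps typed_simps [simp]:
  "typed E \<Gamma> (TVar i) A" "typed E \<Gamma> TStar A" "typed E \<Gamma> (TPair t u) A" "typed E \<Gamma> (TApp f t) A"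
  "typed E \<Gamma> (TEq t u) A" "typed E \<Gamma> (TMem t u) A" "typed E \<Gamma> (TCompr X \<phi>) A"
  "typed E \<Gamma> TTop A" "typed E \<Gamma> TBot A" "typed E \<Gamma> (TAnd \<phi> \<psi>) A" "typed E \<Gamma> (TOr \<phi> \<psi>) A"
  "typed E \<Gamma> (TImp \<phi> \<psi>) A" "typed E \<Gamma> (TAll X \<phi>) A" "typed E \<Gamma> (TEx X \<phi>) A"

lemma ctx_obj [simp]: "set \<Gamma> \<subseteq> Obj E \<Longrightarrow> ctx E \<Gamma> \<in> Obj E"
  by (induction \<Gamma>) auto

lemma proj_simps [simp]:
  assumes "set \<Gamma> \<subseteq> Obj E" "i < length \<Gamma>"
  shows "proj E \<Gamma> i \<in> Arr E" "Dom E (proj E \<Gamma> i) = ctx E \<Gamma>" "Cod E (proj E \<Gamma> i) = \<Gamma> ! i"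
proof -
  have "proj E \<Gamma> i \<in> Hom E (ctx E \<Gamma>) (\<Gamma> ! i)"
    using assms
  proof (induction \<Gamma> arbitrary: i)
    case (Cons X \<Gamma>)
    then show ?case by (cases i) auto
  qed simp
  then show "proj E \<Gamma> i \<in> Arr E" "Dom E (proj E \<Gamma> i) = ctx E \<Gamma>" "Cod E (proj E \<Gamma> i) = \<Gamma> ! i"
    by simp_all
qed

lemma sem_hom: "typed E \<Gamma> t A \<Longrightarrow> set \<Gamma> \<subseteq> Obj E \<Longrightarrow> sem E \<Gamma> t \<in> Hom E (ctx E \<Gamma>) A"
proof (induction rule: typed.induct)
  case (6 \<Gamma> t A u)
  then have "memb (sem E \<Gamma> t) (sem E \<Gamma> u) \<in> Hom E (ctx E \<Gamma>) \<Omega>" by simp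
  then show ?case by (simp only: memb_def sem.simps)
next
  case (7 X \<Gamma> \<phi>)
  then show ?case by (simp add: pw_def)
qed auto

lemma sem_simps [simp]:
  assumes "typed E \<Gamma> \<phi> \<Omega>" "set \<Gamma> \<subseteq> Obj E"
  shows "sem E \<Gamma> \<phi> \<in> Arr E" "Dom E (sem E \<Gamma> \<phi>) = ctx E \<Gamma>" "Cod E (sem E \<Gamma> \<phi>) = \<Omega>"
  using sem_hom[OF assms] by simp_all

lemma typed_tuple:
  "(\<And>t. t \<in> set ts \<Longrightarrow> typed E \<Gamma> t A) \<Longrightarrow> typed E \<Gamma> (tuple ts) (ctx E (replicate (length ts) A))"
  by (induction ts) auto

text \<open>An environment lists the components of a generalized element of a context.\<close>

definition env :: "'o \<Rightarrow> 'a list \<Rightarrow> bool" where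
  "env D \<rho> \<longleftrightarrow> D \<in> Obj E \<and> (\<forall>x\<in>set \<rho>. x \<in> Arr E \<and> Dom E x = D)"

abbreviation types :: "'a list \<Rightarrow> 'o list" where
  "types \<equiv> map (Cod E)"

definition restrict :: "'a list \<Rightarrow> 'a \<Rightarrow> 'a list" (infixl "\<restriction>" 90) where
  "\<rho> \<restriction> f = map (\<lambda>x. x \<bullet> f) \<rho>"

lemma env_Nil [simp]: "env D [] \<longleftrightarrow> D \<in> Obj E"
  by (simp add: env_def)

lemma env_Cons [simp]: "env D (x # \<rho>) \<longleftrightarrow> x \<in> Arr E \<and> Dom E x = D \<and> env D \<rho>"
  by (auto simp: env_def)

lemma env_obj: "env D \<rho> \<Longrightarrow> D \<in> Obj E"
  by (simp add: env_def)

lemma env_nth: "env D \<rho> \<Longrightarrow> i < length \<rho> \<Longrightarrow> \<rho> ! i \<in> Arr E \<and> Dom E (\<rho> ! i) = D"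
  by (simp add: env_def)

lemma types_obj: "env D \<rho> \<Longrightarrow> set (types \<rho>) \<subseteq> Obj E"
  by (auto simp: env_def)

lemma restrict_Nil [simp]: "[] \<restriction> f = []"
  by (simp add: restrict_def)

lemma restrict_Cons [simp]: "(x # \<rho>) \<restriction> f = (x \<bullet> f) # \<rho> \<restriction> f"
  by (simp add: restrict_def)

lemma length_restrict [simp]: "length (\<rho> \<restriction> f) = length \<rho>"
  by (simp add: restrict_def)

lemma nth_restrict [simp]: "i < length \<rho> \<Longrightarrow> (\<rho> \<restriction> f) ! i = \<rho> ! i \<bullet> f"
  by (simp add: restrict_def)

lemma env_restrict [simp]: "env (Cod E f) \<rho> \<Longrightarrow> f \<in> Arr E \<Longrightarrow> Dom E f = D \<Longrightarrow> env D (\<rho> \<restriction> f)"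
  by (auto simp: env_def restrict_def)

lemma types_restrict [simp]: "env (Cod E f) \<rho> \<Longrightarrow> f \<in> Arr E \<Longrightarrow> types (\<rho> \<restriction> f) = types \<rho>"
  by (auto simp: env_def restrict_def)

lemma restrict_restrict [simp]:
  "env (Cod E f) \<rho> \<Longrightarrow> f \<in> Arr E \<Longrightarrow> g \<in> Arr E \<Longrightarrow> Cod E g = Dom E f \<Longrightarrow> \<rho> \<restriction> f \<restriction> g = \<rho> \<restriction> (f \<bullet> g)"
  by (auto simp: env_def restrict_def)

lemma restrict_Idt [simp]: "env D \<rho> \<Longrightarrow> \<rho> \<restriction> Idt E D = \<rho>"
  by (induction \<rho>) simp_all

lemma mor_tuple_Nil [simp]: "mor_tuple E D [] = bang E D"
  by (simp add: mor_tuple_def)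

lemma mor_tuple_Cons [simp]: "mor_tuple E D (f # fs) = pair E (mor_tuple E D fs) f"
  by (simp add: mor_tuple_def)

lemma mor_tuple_hom: "env D \<rho> \<Longrightarrow> mor_tuple E D \<rho> \<in> Hom E D (ctx E (types \<rho>))"
  by (induction \<rho>) simp_all

lemma mor_tuple_simps [simp]:
  assumes "env D \<rho>"
  shows "mor_tuple E D \<rho> \<in> Arr E" "Dom E (mor_tuple E D \<rho>) = D"
    "Cod E (mor_tuple E D \<rho>) = ctx E (types \<rho>)"
  using mor_tuple_hom[OF assms] by simp_all

lemma mor_tuple_comp [simp]:
  "env D \<rho> \<Longrightarrow> f \<in> Arr E \<Longrightarrow> Cod E f = D \<Longrightarrow> mor_tuple E D \<rho> \<bullet> f = mor_tuple E (Dom E f) (\<rho> \<restriction> f)"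
  by (induction \<rho>) simp_all

lemma proj_mor_tuple: "env D \<rho> \<Longrightarrow> i < length \<rho> \<Longrightarrow> proj E (types \<rho>) i \<bullet> mor_tuple E D \<rho> = \<rho> ! i"
proof (induction \<rho> arbitrary: i)
  case (Cons x \<rho>)
  then show ?case using types_obj[of D \<rho>] by (cases i) auto
qed simp

lemma mor_tuple_proj:
  "set \<Gamma> \<subseteq> Obj E \<Longrightarrow> mor_tuple E (ctx E \<Gamma>) (map (proj E \<Gamma>) [0..<length \<Gamma>]) = Idt E (ctx E \<Gamma>)"
proof (induction \<Gamma>)
  case Nil
  then show ?case using bang_unique[of "Idt E (One E)"] by simp
next
  case (Cons X \<Gamma>)
  let ?F = "Fst E (ctx E \<Gamma>) X"
  let ?\<rho> = "map (proj E \<Gamma>) [0..<length \<Gamma>]"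
  have "map (proj E (X # \<Gamma>)) [0..<length (X # \<Gamma>)] = Snd E (ctx E \<Gamma>) X # ?\<rho> \<restriction> ?F"
    by (simp add: map_upt_Suc restrict_def del: upt_Suc)
  moreover have "env (ctx E \<Gamma>) ?\<rho>"
    using Cons.prems by (auto simp: env_def)
  then have "mor_tuple E (ctx E (X # \<Gamma>)) (?\<rho> \<restriction> ?F) = mor_tuple E (ctx E \<Gamma>) ?\<rho> \<bullet> ?F"
    using Cons.prems by simp
  ultimately show ?case using Cons by (simp del: upt_Suc)
qed

definition val :: "'o \<Rightarrow> 'a list \<Rightarrow> ('o, 'a) tm \<Rightarrow> 'a" where
  "val D \<rho> t = sem E (types \<rho>) t \<bullet> mor_tuple E D \<rho>"

abbreviation holds_at :: "'o \<Rightarrow> 'a list \<Rightarrow> ('o, 'a) tm \<Rightarrow> bool" where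
  "holds_at D \<rho> \<phi> \<equiv> is_true (val D \<rho> \<phi>)"

lemma holdsI:
  assumes "set \<Gamma> \<subseteq> Obj E" "typed E \<Gamma> \<phi> \<Omega>"
    and "\<And>D \<rho>. env D \<rho> \<Longrightarrow> types \<rho> = \<Gamma> \<Longrightarrow> holds_at D \<rho> \<phi>"
  shows "holds E \<Gamma> \<phi>"
proof -
  let ?\<rho> = "map (proj E \<Gamma>) [0..<length \<Gamma>]"
  have types: "types ?\<rho> = \<Gamma>"
    using assms(1) by (intro nth_equalityI) simp_all
  have "holds_at (ctx E \<Gamma>) ?\<rho> \<phi>"
    by (rule assms(3)) (use assms(1) types in \<open>auto simp: env_def\<close>)
  then have "is_true (sem E \<Gamma> \<phi>)"
    using assms(1,2) unfolding val_def types mor_tuple_proj[OF assms(1)] by simp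
  then show ?thesis using assms(1,2) by (simp add: holds_def is_true_def)
qed

context
  fixes D :: 'o and \<rho> :: "'a list"
  assumes env: "env D \<rho>"
begin

lemma val_hom: "typed E (types \<rho>) t A \<Longrightarrow> val D \<rho> t \<in> Hom E D A"
  using env sem_hom[OF _ types_obj[OF env], of t A] by (simp add: val_def)

lemma val_simps [simp]:
  assumes "typed E (types \<rho>) \<phi> \<Omega>"
  shows "val D \<rho> \<phi> \<in> Arr E" "Dom E (val D \<rho> \<phi>) = D" "Cod E (val D \<rho> \<phi>) = \<Omega>"
  using val_hom[OF assms] by simp_all

lemma val_comp:
  assumes "typed E (types \<rho>) t A" "f \<in> Hom E D' D"
  shows "val D \<rho> t \<bullet> f = val D' (\<rho> \<restriction> f) t"
  using env assms sem_hom[OF assms(1) types_obj[OF env]] by (simp add: val_def)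

lemma val_TVar [simp]: "i < length \<rho> \<Longrightarrow> val D \<rho> (TVar i) = \<rho> ! i"
  using env by (simp add: val_def proj_mor_tuple)

lemma val_TApp:
  assumes "f \<in> Hom E A B" "typed E (types \<rho>) t A"
  shows "val D \<rho> (TApp f t) = f \<bullet> val D \<rho> t"
  using env assms sem_hom[OF assms(2) types_obj[OF env]] by (simp add: val_def)

lemma val_TPair:
  assumes "typed E (types \<rho>) t A" "typed E (types \<rho>) u B"
  shows "val D \<rho> (TPair t u) = pair E (val D \<rho> t) (val D \<rho> u)"
  using env sem_hom[OF assms(1) types_obj[OF env]] sem_hom[OF assms(2) types_obj[OF env]]
  by (simp add: val_def)

lemma val_tuple:
  "(\<And>t. t \<in> set ts \<Longrightarrow> typed E (types \<rho>) t A) \<Longrightarrow> val D \<rho> (tuple ts) = mor_tuple E D (map (val D \<rho>) ts)"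
proof (induction ts)
  case Nil
  then show ?case using env types_obj[OF env] by (simp add: val_def)
next
  case (Cons t ts)
  then show ?case using val_TPair[OF typed_tuple, of ts A t A] by simp
qed

lemma val_TEq:
  assumes "typed E (types \<rho>) t A" "typed E (types \<rho>) u A"
  shows "val D \<rho> (TEq t u) = eq_at E A \<bullet> pair E (val D \<rho> t) (val D \<rho> u)"
proof -
  note hom = sem_hom[OF assms(1) types_obj[OF env]] sem_hom[OF assms(2) types_obj[OF env]]
  then have "A \<in> Obj E" by auto
  then show ?thesis using env hom by (simp add: val_def)
qed

lemma val_TMem:
  assumes "typed E (types \<rho>) t A" "typed E (types \<rho>) u (pw E A)"
  shows "val D \<rho> (TMem t u) = memb (val D \<rho> t) (val D \<rho> u)"
proof -
  note hom = sem_hom[OF assms(1) types_obj[OF env]] sem_hom[OF assms(2) types_obj[OF env]]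
  have "val D \<rho> (TMem t u) = memb (sem E (types \<rho>) t) (sem E (types \<rho>) u) \<bullet> mor_tuple E D \<rho>"
    by (simp add: val_def memb_def)
  also have "\<dots> = memb (val D \<rho> t) (val D \<rho> u)"
    using env hom by (simp add: val_def)
  finally show ?thesis .
qed

lemma val_TMem_TCompr:
  assumes "typed E (types \<rho>) t X" "X \<in> Obj E" "typed E (X # types \<rho>) \<phi> \<Omega>"
  shows "val D \<rho> (TMem t (TCompr X \<phi>)) = val D (val D \<rho> t # \<rho>) \<phi>"
proof -
  have \<phi>: "sem E (X # types \<rho>) \<phi> \<in> Hom E (ctx E (X # types \<rho>)) \<Omega>"
    using assms types_obj[OF env] by (intro sem_hom) auto
  have "val D \<rho> (TMem t (TCompr X \<phi>)) =
      memb (val D \<rho> t) (curried E (ctx E (types \<rho>)) X \<Omega> (sem E (X # types \<rho>) \<phi>) \<bullet> mor_tuple E D \<rho>)"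
    using assms by (simp add: val_TMem) (simp add: val_def)
  also have "\<dots> = sem E (X # types \<rho>) \<phi> \<bullet> pair E (mor_tuple E D \<rho>) (val D \<rho> t)"
    using env \<phi> assms types_obj[OF env] val_hom[OF assms(1)] by (simp add: memb_def)
  finally show ?thesis using val_hom[OF assms(1)] by (simp add: val_def)
qed

context
  fixes \<phi> \<psi> :: "('o, 'a) tm"
  assumes typed: "typed E (types \<rho>) \<phi> \<Omega>" "typed E (types \<rho>) \<psi> \<Omega>"
begin

lemma val_TAnd [simp]: "val D \<rho> (TAnd \<phi> \<psi>) = sub_meet E D (val D \<rho> \<phi>) (val D \<rho> \<psi>)"
  using env typed types_obj[OF env] by (simp add: val_def)

lemma val_TOr [simp]: "val D \<rho> (TOr \<phi> \<psi>) = sub_join E D (val D \<rho> \<phi>) (val D \<rho> \<psi>)"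
  using env typed types_obj[OF env] by (simp add: val_def)

lemma val_TImp [simp]: "val D \<rho> (TImp \<phi> \<psi>) = sub_imp E D (val D \<rho> \<phi>) (val D \<rho> \<psi>)"
  using env typed types_obj[OF env] by (simp add: val_def)

end

context
  fixes X :: 'o and \<phi> :: "('o, 'a) tm"
  assumes X: "X \<in> Obj E" and typed: "typed E (X # types \<rho>) \<phi> \<Omega>"
begin

lemma val_TAll:
  "val D \<rho> (TAll X \<phi>) = sub_all E D X (val (Prod E D X) (Snd E D X # \<rho> \<restriction> Fst E D X) \<phi>)"
  using env env_obj[OF env] X typed types_obj[OF env] by (simp add: val_def)

lemma val_TEx:
  "val D \<rho> (TEx X \<phi>) = sub_ex E D X (val (Prod E D X) (Snd E D X # \<rho> \<restriction> Fst E D X) \<phi>)"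
  using env env_obj[OF env] X typed types_obj[OF env] by (simp add: val_def)

lemma val_extend_comp:
  assumes "f \<in> Hom E D' D" "x \<in> Hom E D' X"
  shows "val (Prod E D X) (Snd E D X # \<rho> \<restriction> Fst E D X) \<phi> \<bullet> pair E f x = val D' (x # \<rho> \<restriction> f) \<phi>"
  using env env_obj[OF env] X typed types_obj[OF env] assms by (simp add: val_def)

end

end

lemma holds_at_TAll:
  assumes "env D \<rho>" "X \<in> Obj E" "typed E (X # types \<rho>) \<phi> \<Omega>"
  shows "holds_at D \<rho> (TAll X \<phi>) \<longleftrightarrow>
    (\<forall>D' f x. f \<in> Hom E D' D \<longrightarrow> x \<in> Hom E D' X \<longrightarrow> holds_at D' (x # \<rho> \<restriction> f) \<phi>)"
proof -
  let ?p = "val (Prod E D X) (Snd E D X # \<rho> \<restriction> Fst E D X) \<phi>"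
  have D: "D \<in> Obj E" using assms(1) by (rule env_obj)
  then have p: "?p \<in> Hom E (Prod E D X) \<Omega>"
    using assms by simp
  have "holds_at D \<rho> (TAll X \<phi>) \<longleftrightarrow> is_true ?p"
    using p D assms by (simp add: val_TAll)
  also have "\<dots> \<longleftrightarrow> (\<forall>D' f x. f \<in> Hom E D' D \<longrightarrow> x \<in> Hom E D' X \<longrightarrow> is_true (?p \<bullet> pair E f x))"
    unfolding is_true_iff_comp[OF p] using D assms(2) by (simp add: all_Arr_Prod_iff)
  finally show ?thesis using assms by (simp add: val_extend_comp)
qed

lemma holds_at_TAll_TImp:
  assumes "env D \<rho>" "X \<in> Obj E" "typed E (X # types \<rho>) \<phi> \<Omega>" "typed E (X # types \<rho>) \<psi> \<Omega>"
  shows "holds_at D \<rho> (TAll X (TImp \<phi> \<psi>)) \<longleftrightarrow>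
    (\<forall>D' f x. f \<in> Hom E D' D \<longrightarrow> x \<in> Hom E D' X \<longrightarrow>
      holds_at D' (x # \<rho> \<restriction> f) \<phi> \<longrightarrow> holds_at D' (x # \<rho> \<restriction> f) \<psi>)"
proof -
  have "D \<in> Obj E" using assms(1) by (rule env_obj)
  then show ?thesis
    using assms by (simp add: val_TAll sub_le_iff all_Arr_Prod_iff val_extend_comp)
qed

lemma holds_at_TAllD:
  assumes "holds_at D \<rho> (TAll X \<phi>)" "env D \<rho>" "X \<in> Obj E" "typed E (X # types \<rho>) \<phi> \<Omega>"
    and "f \<in> Hom E D' D" "x \<in> Hom E D' X"
  shows "holds_at D' (x # \<rho> \<restriction> f) \<phi>"
  using assms(1,5,6) unfolding holds_at_TAll[OF assms(2-4)] by blast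

lemma holds_at_TImpD:
  assumes "holds_at D \<rho> (TImp \<phi> \<psi>)" "env D \<rho>" "typed E (types \<rho>) \<phi> \<Omega>" "typed E (types \<rho>) \<psi> \<Omega>"
    and "holds_at D \<rho> \<phi>"
  shows "holds_at D \<rho> \<psi>"
  using assms by (intro sub_leD[of D "val D \<rho> \<phi>" "val D \<rho> \<psi>"]) simp_all


subsection \<open>Local operators at generalized elements\<close>

abbreviation P\<Omega> :: 'o where "P\<Omega> \<equiv> pw E \<Omega>"
abbreviation PP\<Omega> :: 'o where "PP\<Omega> \<equiv> pw E P\<Omega>"

lemma val_TMem_TVar [simp]:
  assumes "env D \<rho>" "i < length \<rho>" "k < length \<rho>" "Cod E (\<rho> ! k) = pw E (Cod E (\<rho> ! i))"
  shows "val D \<rho> (TMem (TVar i) (TVar k)) = memb (\<rho> ! i) (\<rho> ! k)"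
  using assms val_TMem[OF assms(1), of "TVar i" "Cod E (\<rho> ! i)" "TVar k"] by simp

lemma val_at_op [simp]:
  assumes "env D \<rho>" "k < length \<rho>" "Cod E (\<rho> ! k) = P\<Omega>" "typed E (types \<rho>) \<phi> \<Omega>"
  shows "val D \<rho> (at_op k \<phi>) = memb (val D \<rho> \<phi>) (\<rho> ! k)"
  using assms val_TMem[OF assms(1), of \<phi> \<Omega> "TVar k"] by simp

definition op_leq :: "'o \<Rightarrow> 'a \<Rightarrow> 'a \<Rightarrow> bool" where
  "op_leq D j k \<longleftrightarrow> (\<forall>D' f p. f \<in> Hom E D' D \<longrightarrow> p \<in> Hom E D' \<Omega> \<longrightarrow>
    is_true (memb p (j \<bullet> f)) \<longrightarrow> is_true (memb p (k \<bullet> f)))"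

lemma op_leq_refl: "op_leq D j j"
  by (simp add: op_leq_def)

lemma op_leq_trans: "op_leq D j k \<Longrightarrow> op_leq D k l \<Longrightarrow> op_leq D j l"
  by (simp add: op_leq_def)

lemma op_leq_comp:
  assumes "op_leq D j k" "j \<in> Hom E D P\<Omega>" "k \<in> Hom E D P\<Omega>" "f \<in> Hom E D' D"
  shows "op_leq D' (j \<bullet> f) (k \<bullet> f)"
  unfolding op_leq_def
proof (intro allI impI)
  fix D'' g p assume "g \<in> Hom E D'' D'" "p \<in> Hom E D'' \<Omega>" "is_true (memb p ((j \<bullet> f) \<bullet> g))"
  then show "is_true (memb p ((k \<bullet> f) \<bullet> g))"
    using assms(1)[unfolded op_leq_def, rule_format, of "f \<bullet> g" D'' p] assms(2-4) by simp
qed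

lemma sub_le_memb_if_op_leq:
  assumes "op_leq D j k" "j \<in> Hom E D P\<Omega>" "k \<in> Hom E D P\<Omega>" "p \<in> Hom E D \<Omega>"
  shows "sub_le E D (memb p j) (memb p k)"
proof -
  have "is_true (memb p k \<bullet> f)" if "f \<in> Hom E D' D" "is_true (memb p j \<bullet> f)" for D' f
    using assms(1)[unfolded op_leq_def, rule_format, of f D' "p \<bullet> f"] assms(2-4) that by simp
  then show ?thesis using assms(2-4) by (simp add: sub_le_iff)
qed

lemma typed_op_le [simp]:
  "i < length \<Gamma> \<Longrightarrow> k < length \<Gamma> \<Longrightarrow> \<Gamma> ! i = P\<Omega> \<Longrightarrow> \<Gamma> ! k = P\<Omega> \<Longrightarrow> typed E \<Gamma> (op_le E i k) \<Omega>"
  by (simp add: op_le_def)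

lemma holds_at_op_le:
  assumes "env D \<rho>" "i < length \<rho>" "k < length \<rho>" "Cod E (\<rho> ! i) = P\<Omega>" "Cod E (\<rho> ! k) = P\<Omega>"
  shows "holds_at D \<rho> (op_le E i k) \<longleftrightarrow> op_leq D (\<rho> ! i) (\<rho> ! k)"
proof -
  have "holds_at D \<rho> (op_le E i k) \<longleftrightarrow> (\<forall>D' f p. f \<in> Hom E D' D \<longrightarrow> p \<in> Hom E D' \<Omega> \<longrightarrow>
      holds_at D' (p # \<rho> \<restriction> f) (at_op (i + 1) (TVar 0)) \<longrightarrow>
      holds_at D' (p # \<rho> \<restriction> f) (at_op (k + 1) (TVar 0)))"
    unfolding op_le_def using assms by (intro holds_at_TAll_TImp) simp_all
  also have "\<dots> \<longleftrightarrow> op_leq D (\<rho> ! i) (\<rho> ! k)"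
    unfolding op_leq_def
    by (intro all_cong1 imp_cong refl) (use assms env_nth[OF assms(1)] in simp_all)
  finally show ?thesis .
qed

definition op_leq_val :: "'o \<Rightarrow> 'a \<Rightarrow> 'a \<Rightarrow> 'a" where
  "op_leq_val D j k = val D [j, k] (op_le E 0 1)"

lemma val_op_le:
  assumes "env D \<rho>" "i < length \<rho>" "k < length \<rho>" "Cod E (\<rho> ! i) = P\<Omega>" "Cod E (\<rho> ! k) = P\<Omega>"
  shows "val D \<rho> (op_le E i k) = op_leq_val D (\<rho> ! i) (\<rho> ! k)"
proof -
  have "\<rho> ! i \<in> Hom E D P\<Omega>" "\<rho> ! k \<in> Hom E D P\<Omega>" using assms env_nth[OF assms(1)] by simp_all
  then show ?thesis using assms env_obj[OF assms(1)]
    by (simp add: op_leq_val_def op_le_def val_TAll)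
qed

lemma op_leq_val_simps [simp]:
  assumes "j \<in> Arr E" "k \<in> Arr E" "Dom E j = D" "Dom E k = D" "Cod E j = P\<Omega>" "Cod E k = P\<Omega>"
  shows "op_leq_val D j k \<in> Arr E" "Dom E (op_leq_val D j k) = D" "Cod E (op_leq_val D j k) = \<Omega>"
    "f \<in> Arr E \<Longrightarrow> Cod E f = D \<Longrightarrow> op_leq_val D j k \<bullet> f = op_leq_val (Dom E f) (j \<bullet> f) (k \<bullet> f)"
    "is_true (op_leq_val D j k) \<longleftrightarrow> op_leq D j k"
proof -
  have env: "env D [j, k]" using assms dom_obj[of j] by simp
  show "op_leq_val D j k \<in> Arr E" "Dom E (op_leq_val D j k) = D" "Cod E (op_leq_val D j k) = \<Omega>"
    using env assms by (simp_all add: op_leq_val_def)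
  show "op_leq_val D j k \<bullet> f = op_leq_val (Dom E f) (j \<bullet> f) (k \<bullet> f)" if "f \<in> Arr E" "Cod E f = D"
    using val_comp[OF env, of "op_le E 0 1" \<Omega> f "Dom E f"] assms that
    by (simp add: op_leq_val_def)
  show "is_true (op_leq_val D j k) \<longleftrightarrow> op_leq D j k"
    using holds_at_op_le[OF env, of 0 1] assms by (simp add: op_leq_val_def)
qed

text \<open>\<open>op_ge D P j k\<close> is \<open>k \<ge>\<^sub>P j\<close>.\<close>

definition op_ge :: "'o \<Rightarrow> 'a \<Rightarrow> 'a \<Rightarrow> 'a \<Rightarrow> bool" where
  "op_ge D P j k \<longleftrightarrow> k \<in> Hom E D P\<Omega> \<and> is_true (memb k P) \<and> op_leq D j k"

lemma op_ge_refl: "j \<in> Hom E D P\<Omega> \<Longrightarrow> is_true (memb j P) \<Longrightarrow> op_ge D P j j"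
  by (simp add: op_ge_def op_leq_refl)

lemma op_ge_trans: "op_ge D P k l \<Longrightarrow> op_ge D P j k \<Longrightarrow> op_ge D P j l"
  by (auto simp: op_ge_def intro: op_leq_trans)

lemma op_ge_comp:
  assumes "op_ge D P j k" "P \<in> Hom E D PP\<Omega>" "j \<in> Hom E D P\<Omega>" "f \<in> Hom E D' D"
  shows "op_ge D' (P \<bullet> f) (j \<bullet> f) (k \<bullet> f)"
  using assms op_leq_comp[of D j k f D'] is_true_comp[of "memb k P" f] by (simp add: op_ge_def)

definition all_ge_val :: "'o \<Rightarrow> 'a \<Rightarrow> 'a \<Rightarrow> 'a \<Rightarrow> 'a" where
  "all_ge_val D P j c = (let G = Prod E D P\<Omega>; f = Fst E D P\<Omega>; k = Snd E D P\<Omega> in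
     sub_all E D P\<Omega> (sub_imp E G (memb k (P \<bullet> f)) (sub_imp E G (op_leq_val G (j \<bullet> f) k) c)))"

lemma val_all_ge:
  assumes "env D \<rho>" "P < length \<rho>" "j < length \<rho>" "Cod E (\<rho> ! P) = PP\<Omega>" "Cod E (\<rho> ! j) = P\<Omega>"
    and "typed E (P\<Omega> # types \<rho>) \<chi> \<Omega>"
  shows "val D \<rho> (all_ge E P j \<chi>) =
    all_ge_val D (\<rho> ! P) (\<rho> ! j) (val (Prod E D P\<Omega>) (Snd E D P\<Omega> # \<rho> \<restriction> Fst E D P\<Omega>) \<chi>)"
proof -
  have "\<rho> ! P \<in> Hom E D PP\<Omega>" "\<rho> ! j \<in> Hom E D P\<Omega>" using assms env_nth[OF assms(1)] by simp_all
  then show ?thesis using assms env_obj[OF assms(1)]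
    by (simp add: all_ge_def all_ge_val_def Let_def val_TAll val_op_le)
qed

lemma all_ge_val_simps [simp]:
  assumes "P \<in> Arr E" "j \<in> Arr E" "c \<in> Arr E" "Dom E P = D" "Dom E j = D" "Dom E c = Prod E D P\<Omega>"
    and "Cod E P = PP\<Omega>" "Cod E j = P\<Omega>" "Cod E c = \<Omega>"
  shows "all_ge_val D P j c \<in> Arr E" "Dom E (all_ge_val D P j c) = D"
    "Cod E (all_ge_val D P j c) = \<Omega>"
    "f \<in> Arr E \<Longrightarrow> Cod E f = D \<Longrightarrow> all_ge_val D P j c \<bullet> f =
      all_ge_val (Dom E f) (P \<bullet> f) (j \<bullet> f)
        (c \<bullet> pair E (f \<bullet> Fst E (Dom E f) P\<Omega>) (Snd E (Dom E f) P\<Omega>))"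
  using assms dom_obj[of j] by (simp_all add: all_ge_val_def Let_def)

context
  fixes D :: 'o and P j :: 'a
  assumes P: "P \<in> Hom E D PP\<Omega>" and j: "j \<in> Hom E D P\<Omega>"
begin

lemma is_true_all_ge_val:
  assumes "c \<in> Hom E (Prod E D P\<Omega>) \<Omega>"
  shows "is_true (all_ge_val D P j c) \<longleftrightarrow>
    (\<forall>D' f k. f \<in> Hom E D' D \<longrightarrow> op_ge D' (P \<bullet> f) (j \<bullet> f) k \<longrightarrow> is_true (c \<bullet> pair E f k))"
proof -
  have "D \<in> Obj E" using j by auto
  then show ?thesis
    using P j assms
    by (auto simp: all_ge_val_def Let_def sub_imp_sub_imp sub_le_iff all_Arr_Prod_iff op_ge_def)
qed

lemma is_true_all_ge_val_sub_imp:
  assumes "a \<in> Hom E (Prod E D P\<Omega>) \<Omega>" "b \<in> Hom E (Prod E D P\<Omega>) \<Omega>"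
  shows "is_true (all_ge_val D P j (sub_imp E (Prod E D P\<Omega>) a b)) \<longleftrightarrow>
    (\<forall>D' f k. f \<in> Hom E D' D \<longrightarrow> op_ge D' (P \<bullet> f) (j \<bullet> f) k \<longrightarrow>
      is_true (a \<bullet> pair E f k) \<longrightarrow> is_true (b \<bullet> pair E f k))"
proof -
  have "D \<in> Obj E" using j by auto
  then show ?thesis
    using P j assms
    by (auto simp: all_ge_val_def Let_def sub_imp_sub_imp sub_le_iff all_Arr_Prod_iff op_ge_def)
qed

lemma is_true_all_ge_val_sub_all:
  assumes "X \<in> Obj E" "a \<in> Hom E (Prod E (Prod E D P\<Omega>) X) \<Omega>"
  shows "is_true (all_ge_val D P j (sub_all E (Prod E D P\<Omega>) X a)) \<longleftrightarrow>
    (\<forall>D' f k x. f \<in> Hom E D' D \<longrightarrow> op_ge D' (P \<bullet> f) (j \<bullet> f) k \<longrightarrow> x \<in> Hom E D' X \<longrightarrow>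
      is_true (a \<bullet> pair E (pair E f k) x))"
proof -
  have "D \<in> Obj E" using j by auto
  then show ?thesis
    using P j assms
    by (auto simp: all_ge_val_def Let_def sub_imp_sub_imp sub_imp_sub_all sub_le_iff
      all_Arr_Prod_iff op_ge_def)
qed

end

lemma all_ge_val_mono:
  assumes P: "P \<in> Hom E D PP\<Omega>" and j: "j \<in> Hom E D P\<Omega>" and c: "c \<in> Hom E (Prod E D P\<Omega>) \<Omega>"
    and ge: "op_ge D P j k"
  shows "sub_le E D (all_ge_val D P j c) (all_ge_val D P k c)"
proof -
  have D: "D \<in> Obj E" and k: "k \<in> Hom E D P\<Omega>" using j ge by (auto simp: op_ge_def)
  have "is_true (all_ge_val D P k c \<bullet> f)"
    if f: "f \<in> Hom E D' D" and true: "is_true (all_ge_val D P j c \<bullet> f)" for D' f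
  proof -
    have D': "D' \<in> Obj E" using f by auto
    let ?c = "c \<bullet> pair E (f \<bullet> Fst E D' P\<Omega>) (Snd E D' P\<Omega>)"
    have c': "?c \<in> Hom E (Prod E D' P\<Omega>) \<Omega>" using c f D D' by simp
    have "op_ge D'' ((P \<bullet> f) \<bullet> g) ((j \<bullet> f) \<bullet> g) l"
      if "g \<in> Hom E D'' D'" "op_ge D'' ((P \<bullet> f) \<bullet> g) ((k \<bullet> f) \<bullet> g) l" for D'' g l
      using op_ge_trans[OF that(2)] op_ge_comp[OF op_ge_comp[OF ge P j f] _ _ that(1)] P j f by simp
    moreover have "is_true (all_ge_val D' (P \<bullet> f) (j \<bullet> f) ?c)" using true P j c f by simp
    ultimately have "is_true (all_ge_val D' (P \<bullet> f) (k \<bullet> f) ?c)"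
      using is_true_all_ge_val[OF _ _ c', of "P \<bullet> f"] P j k f by simp
    then show ?thesis using P k c f by simp
  qed
  then show ?thesis using P j k c by (simp add: sub_le_iff)
qed

definition infl_mono :: "'o \<Rightarrow> 'a \<Rightarrow> bool" where
  "infl_mono D j \<longleftrightarrow> (\<forall>D' f. f \<in> Hom E D' D \<longrightarrow>
    (\<forall>p\<in>Hom E D' \<Omega>. is_true p \<longrightarrow> is_true (memb p (j \<bullet> f))) \<and>
    (\<forall>p\<in>Hom E D' \<Omega>. \<forall>q\<in>Hom E D' \<Omega>.
      sub_le E D' p q \<longrightarrow> is_true (memb p (j \<bullet> f)) \<longrightarrow> is_true (memb q (j \<bullet> f))))"

definition infl_monos :: "'o \<Rightarrow> 'a \<Rightarrow> bool" where
  "infl_monos D P \<longleftrightarrow> (\<forall>D' f k. f \<in> Hom E D' D \<longrightarrow> k \<in> Hom E D' P\<Omega> \<longrightarrow>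
    is_true (memb k (P \<bullet> f)) \<longrightarrow> infl_mono D' k)"

lemma infl_mono_true:
  assumes "infl_mono D j" "j \<in> Hom E D P\<Omega>" "p \<in> Hom E D \<Omega>" "is_true p"
  shows "is_true (memb p j)"
proof -
  have "Idt E D \<in> Hom E D D" using assms(2) by auto
  then have "is_true (memb p (j \<bullet> Idt E D))"
    using assms(1,3,4) unfolding infl_mono_def by blast
  then show ?thesis using assms(2) by simp
qed

lemma infl_mono_sub_le:
  assumes "infl_mono D j" "j \<in> Hom E D P\<Omega>" "p \<in> Hom E D \<Omega>" "q \<in> Hom E D \<Omega>" "sub_le E D p q"
  shows "sub_le E D (memb p j) (memb q j)"
proof -
  have "is_true (memb q j \<bullet> f)" if f: "f \<in> Hom E D' D" "is_true (memb p j \<bullet> f)" for D' f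
  proof -
    have "sub_le E D' (p \<bullet> f) (q \<bullet> f)" using assms(3-5) f by (simp add: sub_le_iff)
    then have "is_true (memb (q \<bullet> f) (j \<bullet> f))"
      using assms(1)[unfolded infl_mono_def, rule_format, OF f(1), THEN conjunct2, rule_format,
        of "p \<bullet> f" "q \<bullet> f"] f assms(2-4) by simp
    then show ?thesis using f assms(2-4) by simp
  qed
  then show ?thesis using assms(2-4) by (simp add: sub_le_iff)
qed

lemma infl_monos_comp:
  assumes "infl_monos D P" "P \<in> Hom E D PP\<Omega>" "f \<in> Hom E D' D"
  shows "infl_monos D' (P \<bullet> f)"
  unfolding infl_monos_def
proof (intro allI impI)
  fix D'' g k assume "g \<in> Hom E D'' D'" "k \<in> Hom E D'' P\<Omega>" "is_true (memb k ((P \<bullet> f) \<bullet> g))"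
  then show "infl_mono D'' k"
    using assms(1)[unfolded infl_monos_def, rule_format, of "f \<bullet> g" D'' k] assms(2,3) by simp
qed

lemma infl_mono_if_op_ge:
  assumes "infl_monos D P" "P \<in> Hom E D PP\<Omega>" "op_ge D P j k"
  shows "infl_mono D k"
proof -
  have "Idt E D \<in> Hom E D D" "P \<bullet> Idt E D = P" using assms(2) by auto
  then show ?thesis using assms(1,3) unfolding infl_monos_def op_ge_def by metis
qed

lemma memb_mono:
  assumes "infl_monos D P" "P \<in> Hom E D PP\<Omega>" "op_ge D P j k" "j \<in> Hom E D P\<Omega>"
    and "p \<in> Hom E D \<Omega>" "q \<in> Hom E D \<Omega>" "sub_le E D p q"
  shows "sub_le E D (memb p j) (memb q k)"
proof -
  have k: "k \<in> Hom E D P\<Omega>" "op_leq D j k" using assms(3) by (simp_all add: op_ge_def)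
  have "sub_le E D (memb p j) (memb p k)"
    using assms(4,5) k by (intro sub_le_memb_if_op_leq) simp_all
  moreover have "sub_le E D (memb p k) (memb q k)"
    using assms k by (intro infl_mono_sub_le infl_mono_if_op_ge[of D P j]) simp_all
  ultimately show ?thesis by (auto simp: sub_le_def)
qed

lemma typed_is_lop [simp]: "i < length \<Gamma> \<Longrightarrow> \<Gamma> ! i = P\<Omega> \<Longrightarrow> typed E \<Gamma> (is_lop E i) \<Omega>"
  by (simp add: is_lop_def)

lemma typed_Lop [simp]: "typed E \<Gamma> (Lop E) PP\<Omega>"
  by (simp add: Lop_def)

lemma typed_sub_Lop [simp]:
  "i < length \<Gamma> \<Longrightarrow> \<Gamma> ! i = PP\<Omega> \<Longrightarrow> typed E \<Gamma> (sub_Lop E i) \<Omega>"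
  by (simp add: sub_Lop_def)

lemma infl_mono_if_is_lop:
  assumes env: "env D \<rho>" and i: "i < length \<rho>" "Cod E (\<rho> ! i) = P\<Omega>"
    and lop: "holds_at D \<rho> (is_lop E i)"
  shows "infl_mono D (\<rho> ! i)"
  unfolding infl_mono_def
proof (intro allI impI conjI ballI)
  let ?j = "\<rho> ! i"
  let ?unit = "TImp (TVar 0) (at_op (i + 1) (TVar 0))"
    and ?mono = "TImp (TImp (TVar 1) (TVar 0))
      (TImp (at_op (i + 2) (TVar 1)) (at_op (i + 2) (TVar 0)))"
  have j: "?j \<in> Hom E D P\<Omega>" using env_nth[OF env i(1)] i(2) by simp
  have unit: "holds_at D \<rho> (TAll \<Omega> ?unit)" and mono: "holds_at D \<rho> (TAll \<Omega> (TAll \<Omega> ?mono))"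
    using lop env i by (simp_all add: is_lop_def)
  fix D' f assume f: "f \<in> Hom E D' D"
  have env': "env D' (\<rho> \<restriction> f)" "types (\<rho> \<restriction> f) = types \<rho>" using env f by simp_all
  fix p assume p: "p \<in> Hom E D' \<Omega>"
  show "is_true (memb p (?j \<bullet> f))" if "is_true p"
  proof -
    have "holds_at D' (p # \<rho> \<restriction> f) ?unit"
      using unit env i f p by (intro holds_at_TAllD[of D]) simp_all
    then have "sub_le E D' p (memb p (?j \<bullet> f))" using env' i f j p by simp
    then show ?thesis by (rule sub_leD) (use f j p that in simp_all)
  qed
  fix q assume q: "q \<in> Hom E D' \<Omega>" and le: "sub_le E D' p q" and jp: "is_true (memb p (?j \<bullet> f))"
  have mono_p: "holds_at D' (p # \<rho> \<restriction> f) (TAll \<Omega> ?mono)"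
    using mono env i f p by (intro holds_at_TAllD[of D]) simp_all
  have "holds_at D' (q # (p # \<rho> \<restriction> f) \<restriction> Idt E D') ?mono"
    by (rule holds_at_TAllD[OF mono_p]) (use env' i p q env_obj[OF env'(1)] in simp_all)
  then have mono_pq: "holds_at D' (q # p # \<rho> \<restriction> f) ?mono" using env' p by simp
  have "holds_at D' (q # p # \<rho> \<restriction> f) (TImp (at_op (i + 2) (TVar 1)) (at_op (i + 2) (TVar 0)))"
    by (rule holds_at_TImpD[OF mono_pq]) (use env' i p q le in simp_all)
  then have "sub_le E D' (memb p (?j \<bullet> f)) (memb q (?j \<bullet> f))" using env' i f j p q by simp
  then show "is_true (memb q (?j \<bullet> f))" by (rule sub_leD) (use f j p q jp in simp_all)
qed

lemma infl_mono_if_mem_Lop: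
  assumes "env D \<rho>" "i < length \<rho>" "Cod E (\<rho> ! i) = P\<Omega>" "holds_at D \<rho> (TMem (TVar i) (Lop E))"
  shows "infl_mono D (\<rho> ! i)"
proof -
  have "val D \<rho> (TMem (TVar i) (Lop E)) = val D (\<rho> ! i # \<rho>) (is_lop E 0)"
    using assms(1-3) by (simp add: Lop_def val_TMem_TCompr)
  then have "holds_at D (\<rho> ! i # \<rho>) (is_lop E 0)" using assms(4) by simp
  then show ?thesis
    using infl_mono_if_is_lop[of D "\<rho> ! i # \<rho>" 0] assms(1-3) env_nth[OF assms(1,2)] by simp
qed

lemma infl_monos_if_sub_Lop:
  assumes "env D \<rho>" "i < length \<rho>" "Cod E (\<rho> ! i) = PP\<Omega>" "holds_at D \<rho> (sub_Lop E i)"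
  shows "infl_monos D (\<rho> ! i)"
  unfolding infl_monos_def
proof (intro allI impI)
  fix D' f k assume f: "f \<in> Hom E D' D" "k \<in> Hom E D' P\<Omega>" "is_true (memb k (\<rho> ! i \<bullet> f))"
  let ?\<rho> = "k # \<rho> \<restriction> f"
  have env: "env D' ?\<rho>" using assms(1) f by simp
  have "holds_at D' ?\<rho> (TImp (TMem (TVar 0) (TVar (i + 1))) (TMem (TVar 0) (Lop E)))"
    using assms(4) unfolding sub_Lop_def by (rule holds_at_TAllD) (use assms f in simp_all)
  then have "holds_at D' ?\<rho> (TMem (TVar 0) (Lop E))"
    by (rule holds_at_TImpD) (use assms f env_nth[OF assms(1,2)] in simp_all)
  then show "infl_mono D' k" using infl_mono_if_mem_Lop[OF env, of 0] f by simp
qed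


subsection \<open>The forcing translation at generalized elements\<close>

fun lfm_wf :: "'o \<Rightarrow> nat \<Rightarrow> 'a lfm \<Rightarrow> bool" where
  "lfm_wf X n (LAtom R is) \<longleftrightarrow> R \<in> Hom E (ctx E (replicate (length is) X)) \<Omega> \<and> (\<forall>i\<in>set is. i < n)"
| "lfm_wf X n (LAnd \<phi> \<psi>) \<longleftrightarrow> lfm_wf X n \<phi> \<and> lfm_wf X n \<psi>"
| "lfm_wf X n (LOr \<phi> \<psi>) \<longleftrightarrow> lfm_wf X n \<phi> \<and> lfm_wf X n \<psi>"
| "lfm_wf X n (LImp \<phi> \<psi>) \<longleftrightarrow> lfm_wf X n \<phi> \<and> lfm_wf X n \<psi>"
| "lfm_wf X n (LEx \<phi>) \<longleftrightarrow> lfm_wf X (Suc n) \<phi>"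
| "lfm_wf X n (LAll \<phi>) \<longleftrightarrow> lfm_wf X (Suc n) \<phi>"

definition force_scope :: "'o \<Rightarrow> nat \<Rightarrow> 'o list \<Rightarrow> nat \<Rightarrow> nat \<Rightarrow> (nat \<Rightarrow> nat) \<Rightarrow> bool" where
  "force_scope X n \<Gamma> P j v \<longleftrightarrow> X \<in> Obj E \<and> P < length \<Gamma> \<and> \<Gamma> ! P = PP\<Omega> \<and> j < length \<Gamma> \<and> \<Gamma> ! j = P\<Omega> \<and>
    (\<forall>i<n. v i < length \<Gamma> \<and> \<Gamma> ! v i = X)"

lemma force_scope_up:
  "force_scope X n \<Gamma> P j v \<Longrightarrow> force_scope X (Suc n) (X # \<Gamma>) (P + 1) (j + 1) (up v)"
  by (auto simp: force_scope_def up_def split: nat.split)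

lemma force_scope_op: "force_scope X n \<Gamma> P j v \<Longrightarrow> force_scope X n (P\<Omega> # \<Gamma>) (P + 1) 0 (\<lambda>i. v i + 1)"
  by (simp add: force_scope_def)

lemma force_scope_op_up:
  assumes "force_scope X n \<Gamma> P j v"
  shows "force_scope X (Suc n) (X # P\<Omega> # \<Gamma>) (P + 2) 1 (up (\<lambda>i. v i + 1))"
  using force_scope_up[OF force_scope_op[OF assms]] by simp

lemma typed_force:
  "lfm_wf X n \<phi> \<Longrightarrow> force_scope X n \<Gamma> P j v \<Longrightarrow> typed E \<Gamma> (force E X P j v \<phi>) \<Omega>"
proof (induction \<phi> arbitrary: n \<Gamma> P j v)
  case (LAtom R "is")
  have "typed E \<Gamma> (tuple (map (\<lambda>i. TVar (v i)) is)) (ctx E (replicate (length is) X))"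
    using typed_tuple[of "map (\<lambda>i. TVar (v i)) is" \<Gamma> X] LAtom by (force simp: force_scope_def)
  then show ?case using LAtom by (auto simp: force_scope_def)
next
  case (LImp \<phi> \<psi>)
  then show ?case
    using LImp.IH[OF _ force_scope_op[OF LImp.prems(2)]] by (simp add: all_ge_def force_scope_def)
next
  case (LEx \<phi>)
  then show ?case
    using LEx.IH[OF _ force_scope_up[OF LEx.prems(2)]] by (simp add: force_scope_def)
next
  case (LAll \<phi>)
  then show ?case
    using LAll.IH[OF _ force_scope_op_up[OF LAll.prems(2)]]
    by (simp add: all_ge_def force_scope_def)
qed (auto simp: force_scope_def)

primrec force_val :: "'o \<Rightarrow> 'o \<Rightarrow> 'a \<Rightarrow> 'a \<Rightarrow> 'a list \<Rightarrow> 'a lfm \<Rightarrow> 'a" where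
  "force_val X D P j \<rho> (LAtom R is) = memb (R \<bullet> mor_tuple E D (map (nth \<rho>) is)) j"
| "force_val X D P j \<rho> (LAnd \<phi> \<psi>) = sub_meet E D (force_val X D P j \<rho> \<phi>) (force_val X D P j \<rho> \<psi>)"
| "force_val X D P j \<rho> (LOr \<phi> \<psi>) =
     memb (sub_join E D (force_val X D P j \<rho> \<phi>) (force_val X D P j \<rho> \<psi>)) j"
| "force_val X D P j \<rho> (LImp \<phi> \<psi>) = (let G = Prod E D P\<Omega>; f = Fst E D P\<Omega>; k = Snd E D P\<Omega> in
     all_ge_val D P j (sub_imp E G
       (force_val X G (P \<bullet> f) k (\<rho> \<restriction> f) \<phi>) (force_val X G (P \<bullet> f) k (\<rho> \<restriction> f) \<psi>)))"
| "force_val X D P j \<rho> (LEx \<phi>) = (let G = Prod E D X; f = Fst E D X; x = Snd E D X in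
     memb (sub_ex E D X (force_val X G (P \<bullet> f) (j \<bullet> f) (x # \<rho> \<restriction> f) \<phi>)) j)"
| "force_val X D P j \<rho> (LAll \<phi>) =
     (let G = Prod E D P\<Omega>; f = Fst E D P\<Omega>; k = Snd E D P\<Omega>;
          H = Prod E G X; g = Fst E G X; x = Snd E G X in
      all_ge_val D P j (sub_all E G X (force_val X H (P \<bullet> f \<bullet> g) (k \<bullet> g) (x # \<rho> \<restriction> (f \<bullet> g)) \<phi>)))"

abbreviation forced :: "'o \<Rightarrow> 'o \<Rightarrow> 'a \<Rightarrow> 'a \<Rightarrow> 'a list \<Rightarrow> 'a lfm \<Rightarrow> bool" where
  "forced X D P j \<rho> \<phi> \<equiv> is_true (force_val X D P j \<rho> \<phi>)"

lemma force_scopeD: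
  assumes "force_scope X n (types \<rho>) P j v"
  shows "X \<in> Obj E" "P < length \<rho>" "Cod E (\<rho> ! P) = PP\<Omega>" "j < length \<rho>" "Cod E (\<rho> ! j) = P\<Omega>"
    "\<forall>i<n. v i < length \<rho>" "\<forall>i<n. Cod E (\<rho> ! v i) = X"
  using assms by (auto simp: force_scope_def)

lemma val_force_LAtom:
  assumes "lfm_wf X n (LAtom R is)" "env D \<rho>" "force_scope X n (types \<rho>) P j v"
  shows "val D \<rho> (force E X P j v (LAtom R is)) =
    memb (R \<bullet> mor_tuple E D (map (\<lambda>i. \<rho> ! v i) is)) (\<rho> ! j)"
proof -
  let ?ts = "map (\<lambda>i. TVar (v i)) is"
  have vars: "typed E (types \<rho>) t X" if "t \<in> set ?ts" for t
    using that assms(1) force_scopeD(6,7)[OF assms(3)] by auto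
  then have tuple: "typed E (types \<rho>) (tuple ?ts) (ctx E (replicate (length is) X))"
    using typed_tuple[of ?ts "types \<rho>" X] by simp
  have R: "R \<in> Hom E (ctx E (replicate (length is) X)) \<Omega>" using assms(1) by simp
  have "map (val D \<rho>) ?ts = map (\<lambda>i. \<rho> ! v i) is"
    using assms(1,2) force_scopeD(6)[OF assms(3)] by auto
  then have "val D \<rho> (tuple ?ts) = mor_tuple E D (map (\<lambda>i. \<rho> ! v i) is)"
    using val_tuple[OF assms(2), of ?ts X] vars by metis
  then have "val D \<rho> (TApp R (tuple ?ts)) = R \<bullet> mor_tuple E D (map (\<lambda>i. \<rho> ! v i) is)"
    by (simp only: val_TApp[OF assms(2) R tuple])
  moreover have "typed E (types \<rho>) (TApp R (tuple ?ts)) \<Omega>"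
    using R tuple by auto
  ultimately show ?thesis using assms(2) force_scopeD(4,5)[OF assms(3)] by simp
qed

lemma val_force_LImp:
  assumes "lfm_wf X n (LImp \<phi> \<psi>)" "env D \<rho>" and scope: "force_scope X n (types \<rho>) P j v"
  defines "G \<equiv> Prod E D P\<Omega>" and "\<rho>' \<equiv> Snd E D P\<Omega> # \<rho> \<restriction> Fst E D P\<Omega>"
  shows "val D \<rho> (force E X P j v (LImp \<phi> \<psi>)) = all_ge_val D (\<rho> ! P) (\<rho> ! j) (sub_imp E G
    (val G \<rho>' (force E X (P + 1) 0 (\<lambda>i. v i + 1) \<phi>))
    (val G \<rho>' (force E X (P + 1) 0 (\<lambda>i. v i + 1) \<psi>)))"
proof -
  have "typed E (P\<Omega> # types \<rho>) (force E X (P + 1) 0 (\<lambda>i. v i + 1) \<chi>) \<Omega>" if "\<chi> \<in> {\<phi>, \<psi>}" for \<chi>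
    using that assms(1) by (intro typed_force[OF _ force_scope_op[OF scope]]) auto
  then show ?thesis
    unfolding force.simps G_def \<rho>'_def
    using assms(2) env_obj[OF assms(2)] force_scopeD[OF scope] by (subst val_all_ge) simp_all
qed

lemma val_force_LEx:
  assumes "lfm_wf X n (LEx \<phi>)" "env D \<rho>" and scope: "force_scope X n (types \<rho>) P j v"
  shows "val D \<rho> (force E X P j v (LEx \<phi>)) = memb (sub_ex E D X
    (val (Prod E D X) (Snd E D X # \<rho> \<restriction> Fst E D X) (force E X (P + 1) (j + 1) (up v) \<phi>))) (\<rho> ! j)"
proof -
  have "typed E (X # types \<rho>) (force E X (P + 1) (j + 1) (up v) \<phi>) \<Omega>"
    using assms(1) by (intro typed_force[OF _ force_scope_up[OF scope]]) simp
  then show ?thesis using assms(2) force_scopeD[OF scope] by (simp add: val_TEx)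
qed

lemma val_force_LAll:
  assumes "lfm_wf X n (LAll \<phi>)" "env D \<rho>" and scope: "force_scope X n (types \<rho>) P j v"
  defines "G \<equiv> Prod E D P\<Omega>" and "\<rho>' \<equiv> Snd E D P\<Omega> # \<rho> \<restriction> Fst E D P\<Omega>"
  shows "val D \<rho> (force E X P j v (LAll \<phi>)) = all_ge_val D (\<rho> ! P) (\<rho> ! j) (sub_all E G X
    (val (Prod E G X) (Snd E G X # \<rho>' \<restriction> Fst E G X) (force E X (P + 2) 1 (up (\<lambda>i. v i + 1)) \<phi>)))"
proof -
  have "typed E (X # P\<Omega> # types \<rho>) (force E X (P + 2) 1 (up (\<lambda>i. v i + 1)) \<phi>) \<Omega>"
    using assms(1) by (intro typed_force[OF _ force_scope_op_up[OF scope]]) simp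
  then show ?thesis
    unfolding force.simps G_def \<rho>'_def
    using assms(2) env_obj[OF assms(2)] force_scopeD[OF scope]
    by (subst val_all_ge) (simp_all add: val_TAll)
qed

definition vals :: "'a list \<Rightarrow> (nat \<Rightarrow> nat) \<Rightarrow> nat \<Rightarrow> 'a list" where
  "vals \<rho> v n = map (\<lambda>i. \<rho> ! v i) [0..<n]"

lemma vals_op:
  "\<forall>i<n. v i < length \<rho> \<Longrightarrow> vals (k # \<rho> \<restriction> f) (\<lambda>i. Suc (v i)) n = vals \<rho> v n \<restriction> f"
  by (simp add: vals_def restrict_def)

lemma vals_up:
  "\<forall>i<n. v i < length \<rho> \<Longrightarrow> vals (x # \<rho> \<restriction> f) (up v) (Suc n) = x # vals \<rho> v n \<restriction> f"
  unfolding vals_def map_upt_Suc by (simp add: up_def restrict_def)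

lemma vals_op_up:
  assumes "\<forall>i<n. v i < length \<rho>"
  shows "vals (x # k # \<rho> \<restriction> f) (up (\<lambda>i. Suc (v i))) (Suc n) = x # vals \<rho> v n \<restriction> f"
  unfolding vals_def map_upt_Suc using assms by (simp add: up_def restrict_def)

lemma val_force:
  assumes "lfm_wf X n \<phi>" "force_scope X n (types \<rho>) P j v" "env D \<rho>"
  shows "val D \<rho> (force E X P j v \<phi>) = force_val X D (\<rho> ! P) (\<rho> ! j) (vals \<rho> v n) \<phi>"
  using assms
proof (induction \<phi> arbitrary: n D \<rho> P j v)
  case (LAtom R "is")
  have "map (nth (vals \<rho> v n)) is = map (\<lambda>i. \<rho> ! v i) is"
    using LAtom.prems(1) by (auto simp: vals_def)
  then show ?case
    unfolding val_force_LAtom[OF LAtom.prems(1,3,2)] force_val.simps by (rule ssubst) (rule refl)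
next
  case (LAnd \<phi> \<psi>)
  show ?case
    using LAnd.prems typed_force[OF _ LAnd.prems(2)] LAnd.IH[OF _ LAnd.prems(2,3)] by simp
next
  case (LOr \<phi> \<psi>)
  show ?case
    using LOr.prems typed_force[OF _ LOr.prems(2)] LOr.IH[OF _ LOr.prems(2,3)]
      force_scopeD[OF LOr.prems(2)] by simp
next
  case (LImp \<phi> \<psi>)
  note vars = force_scopeD[OF LImp.prems(2)] and env = LImp.prems(3)
  let ?G = "Prod E D P\<Omega>" and ?k = "Snd E D P\<Omega>" and ?f = "Fst E D P\<Omega>"
  have "val ?G (?k # \<rho> \<restriction> ?f) (force E X (P + 1) 0 (\<lambda>i. v i + 1) \<chi>) =
      force_val X ?G (\<rho> ! P \<bullet> ?f) ?k (vals \<rho> v n \<restriction> ?f) \<chi>" if "\<chi> \<in> {\<phi>, \<psi>}" for \<chi>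
    using that LImp.prems(1) LImp.IH[of n "?k # \<rho> \<restriction> ?f" "P + 1" 0 "\<lambda>i. v i + 1"] env env_obj[OF env]
      force_scope_op[OF LImp.prems(2)] vars by (auto simp: vals_op)
  then show ?case
    unfolding val_force_LImp[OF LImp.prems(1,3,2)] by (simp add: Let_def)
next
  case (LEx \<phi>)
  note vars = force_scopeD[OF LEx.prems(2)] and env = LEx.prems(3)
  have "val (Prod E D X) (Snd E D X # \<rho> \<restriction> Fst E D X) (force E X (P + 1) (j + 1) (up v) \<phi>) =
      force_val X (Prod E D X) (\<rho> ! P \<bullet> Fst E D X) (\<rho> ! j \<bullet> Fst E D X)
        (Snd E D X # vals \<rho> v n \<restriction> Fst E D X) \<phi>"
    using LEx.prems(1) LEx.IH[of "Suc n" "Snd E D X # \<rho> \<restriction> Fst E D X" "P + 1" "j + 1" "up v"]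
      env env_obj[OF env] force_scope_up[OF LEx.prems(2)] vars by (simp add: vals_up)
  then show ?case
    unfolding val_force_LEx[OF LEx.prems(1,3,2)] by (simp add: Let_def)
next
  case (LAll \<phi>)
  note vars = force_scopeD[OF LAll.prems(2)] and env = LAll.prems(3)
  let ?G = "Prod E D P\<Omega>" and ?k = "Snd E D P\<Omega>" and ?f = "Fst E D P\<Omega>"
  let ?H = "Prod E ?G X" and ?x = "Snd E ?G X" and ?g = "Fst E ?G X"
  let ?\<rho> = "?x # (?k # \<rho> \<restriction> ?f) \<restriction> ?g" and ?v = "up (\<lambda>i. v i + 1)"
  have "val ?H ?\<rho> (force E X (P + 2) 1 ?v \<phi>) =
      force_val X ?H (\<rho> ! P \<bullet> ?f \<bullet> ?g) (?k \<bullet> ?g) (?x # vals \<rho> v n \<restriction> (?f \<bullet> ?g)) \<phi>"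
    using LAll.prems(1) LAll.IH[of "Suc n" ?\<rho> "P + 2" 1 ?v ?H] env env_obj[OF env] vars
      force_scope_op_up[OF LAll.prems(2)] env_nth[OF env vars(2)] by (simp add: vals_op_up)
  then show ?case
    unfolding val_force_LAll[OF LAll.prems(1,3,2)] by (simp add: Let_def)
qed

definition stage :: "'o \<Rightarrow> 'o \<Rightarrow> 'a \<Rightarrow> 'a \<Rightarrow> 'a list \<Rightarrow> bool" where
  "stage X D P j \<rho> \<longleftrightarrow> X \<in> Obj E \<and> P \<in> Hom E D PP\<Omega> \<and> j \<in> Hom E D P\<Omega> \<and>
     env D \<rho> \<and> types \<rho> = replicate (length \<rho>) X"

lemma stageD:
  assumes "stage X D P j \<rho>"
  shows "X \<in> Obj E" "D \<in> Obj E" "P \<in> Arr E" "Dom E P = D" "Cod E P = PP\<Omega>"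
    "j \<in> Arr E" "Dom E j = D" "Cod E j = P\<Omega>" "env D \<rho>" "types \<rho> = replicate (length \<rho>) X"
  using assms env_obj by (auto simp: stage_def)

lemmas stage_env = stageD(9,10)

lemma stage_nth:
  assumes "stage X D P j \<rho>" "i < length \<rho>"
  shows "\<rho> ! i \<in> Hom E D X"
  using stage_env[OF assms(1)] env_nth[of D \<rho> i] assms(2) nth_map[of i \<rho> "Cod E"] by simp

lemma stage_comp:
  assumes "stage X D P j \<rho>" "f \<in> Hom E D' D" "k \<in> Hom E D' P\<Omega>"
  shows "stage X D' (P \<bullet> f) k (\<rho> \<restriction> f)"
  using stageD[OF assms(1)] assms(2,3) by (simp add: stage_def)

lemma stage_Cons:
  assumes "stage X D P j \<rho>" "x \<in> Hom E D X"
  shows "stage X D P j (x # \<rho>)"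
  using assms by (simp add: stage_def)

lemma stage_op:
  assumes "stage X D P j \<rho>"
  shows "stage X (Prod E D P\<Omega>) (P \<bullet> Fst E D P\<Omega>) (Snd E D P\<Omega>) (\<rho> \<restriction> Fst E D P\<Omega>)"
  using stageD(2)[OF assms] by (intro stage_comp[OF assms]) simp_all

lemma stage_up:
  assumes "stage X D P j \<rho>"
  shows "stage X (Prod E D X) (P \<bullet> Fst E D X) (j \<bullet> Fst E D X) (Snd E D X # \<rho> \<restriction> Fst E D X)"
  using stageD[OF assms] by (intro stage_Cons stage_comp[OF assms]) simp_all

lemma stage_op_up:
  assumes "stage X D P j \<rho>"
  defines "G \<equiv> Prod E D P\<Omega>" and "f \<equiv> Fst E D P\<Omega>" and "k \<equiv> Snd E D P\<Omega>"
  shows "stage X (Prod E G X) (P \<bullet> f \<bullet> Fst E G X) (k \<bullet> Fst E G X) (Snd E G X # \<rho> \<restriction> (f \<bullet> Fst E G X))"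
  using stage_up[OF stage_op[OF assms(1)]] stageD[OF assms(1)] by (simp add: G_def f_def k_def)

lemma val_force_stage:
  assumes "stage X D P j \<rho>" "lfm_wf X (length \<rho>) \<phi>"
  shows "typed E (types (j # P # \<rho>)) (force E X 1 0 (\<lambda>i. i + 2) \<phi>) \<Omega>"
    and "val D (j # P # \<rho>) (force E X 1 0 (\<lambda>i. i + 2) \<phi>) = force_val X D P j \<rho> \<phi>"
proof -
  note homs = stageD[OF assms(1)]
  have scope: "force_scope X (length \<rho>) (types (j # P # \<rho>)) 1 0 (\<lambda>i. i + 2)"
    using homs by (simp add: force_scope_def)
  then show "typed E (types (j # P # \<rho>)) (force E X 1 0 (\<lambda>i. i + 2) \<phi>) \<Omega>"
    by (rule typed_force[OF assms(2)])
  have "vals (j # P # \<rho>) (\<lambda>i. i + 2) (length \<rho>) = \<rho>"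
    by (simp add: vals_def map_nth)
  then show "val D (j # P # \<rho>) (force E X 1 0 (\<lambda>i. i + 2) \<phi>) = force_val X D P j \<rho> \<phi>"
    using val_force[OF assms(2) scope, of D] homs by simp
qed

lemma force_val_simps [simp]:
  assumes "stage X D P j \<rho>" "lfm_wf X (length \<rho>) \<phi>"
  shows "force_val X D P j \<rho> \<phi> \<in> Arr E" "Dom E (force_val X D P j \<rho> \<phi>) = D"
    "Cod E (force_val X D P j \<rho> \<phi>) = \<Omega>"
  using val_hom[OF _ val_force_stage(1)[OF assms], of D] stageD[OF assms(1)]
    val_force_stage(2)[OF assms] by simp_all

lemma force_val_comp:
  assumes "stage X D P j \<rho>" "lfm_wf X (length \<rho>) \<phi>" "f \<in> Hom E D' D"
  shows "force_val X D P j \<rho> \<phi> \<bullet> f = force_val X D' (P \<bullet> f) (j \<bullet> f) (\<rho> \<restriction> f) \<phi>"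
proof -
  note homs = stageD[OF assms(1)]
  have "stage X D' (P \<bullet> f) (j \<bullet> f) (\<rho> \<restriction> f)"
    using assms(1,3) homs by (intro stage_comp) simp_all
  then have "val D' ((j # P # \<rho>) \<restriction> f) (force E X 1 0 (\<lambda>i. i + 2) \<phi>) =
      force_val X D' (P \<bullet> f) (j \<bullet> f) (\<rho> \<restriction> f) \<phi>"
    using val_force_stage(2)[of X D' "P \<bullet> f" "j \<bullet> f" "\<rho> \<restriction> f" \<phi>] assms(2) by simp
  then show ?thesis
    using val_comp[OF _ val_force_stage(1)[OF assms(1,2)] assms(3)] homs
      val_force_stage(2)[OF assms(1,2)] by simp
qed

lemma forced_LAnd:
  assumes "stage X D P j \<rho>" "lfm_wf X (length \<rho>) \<phi>" "lfm_wf X (length \<rho>) \<psi>"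
  shows "forced X D P j \<rho> (LAnd \<phi> \<psi>) \<longleftrightarrow> forced X D P j \<rho> \<phi> \<and> forced X D P j \<rho> \<psi>"
  using assms by simp

lemma forced_LImp:
  assumes stage: "stage X D P j \<rho>" and wf: "lfm_wf X (length \<rho>) \<phi>" "lfm_wf X (length \<rho>) \<psi>"
  shows "forced X D P j \<rho> (LImp \<phi> \<psi>) \<longleftrightarrow> (\<forall>D' f k. f \<in> Hom E D' D \<longrightarrow> op_ge D' (P \<bullet> f) (j \<bullet> f) k \<longrightarrow>
    forced X D' (P \<bullet> f) k (\<rho> \<restriction> f) \<phi> \<longrightarrow> forced X D' (P \<bullet> f) k (\<rho> \<restriction> f) \<psi>)"
proof -
  note homs = stageD[OF stage]
  let ?G = "Prod E D P\<Omega>" and ?f = "Fst E D P\<Omega>" and ?k = "Snd E D P\<Omega>"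
  let ?val = "force_val X ?G (P \<bullet> ?f) ?k (\<rho> \<restriction> ?f)"
  have stage': "stage X ?G (P \<bullet> ?f) ?k (\<rho> \<restriction> ?f)" using stage by (rule stage_op)
  have "forced X D P j \<rho> (LImp \<phi> \<psi>) \<longleftrightarrow> (\<forall>D' f k. f \<in> Hom E D' D \<longrightarrow> op_ge D' (P \<bullet> f) (j \<bullet> f) k \<longrightarrow>
      is_true (?val \<phi> \<bullet> pair E f k) \<longrightarrow> is_true (?val \<psi> \<bullet> pair E f k))"
    using homs stage' wf by (simp add: Let_def is_true_all_ge_val_sub_imp)
  also have "\<dots> \<longleftrightarrow> (\<forall>D' f k. f \<in> Hom E D' D \<longrightarrow> op_ge D' (P \<bullet> f) (j \<bullet> f) k \<longrightarrow>
      forced X D' (P \<bullet> f) k (\<rho> \<restriction> f) \<phi> \<longrightarrow> forced X D' (P \<bullet> f) k (\<rho> \<restriction> f) \<psi>)"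
    by (intro all_cong1 imp_cong refl)
      (use homs stage' wf in \<open>simp_all add: force_val_comp op_ge_def\<close>)
  finally show ?thesis .
qed

lemma forced_LImpD:
  assumes "stage X D P j \<rho>" "lfm_wf X (length \<rho>) \<phi>" "lfm_wf X (length \<rho>) \<psi>"
    and "forced X D P j \<rho> (LImp \<phi> \<psi>)" "op_ge D P j k" "forced X D P k \<rho> \<phi>"
  shows "forced X D P k \<rho> \<psi>"
  using assms(4)[unfolded forced_LImp[OF assms(1-3)], rule_format, of "Idt E D" D k]
    assms(5,6) stageD[OF assms(1)] by simp

lemma forced_LAll:
  assumes stage: "stage X D P j \<rho>" and wf: "lfm_wf X (Suc (length \<rho>)) \<phi>"
  shows "forced X D P j \<rho> (LAll \<phi>) \<longleftrightarrow> (\<forall>D' f k x. f \<in> Hom E D' D \<longrightarrow> op_ge D' (P \<bullet> f) (j \<bullet> f) k \<longrightarrow>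
    x \<in> Hom E D' X \<longrightarrow> forced X D' (P \<bullet> f) k (x # \<rho> \<restriction> f) \<phi>)"
proof -
  note homs = stageD[OF stage]
  let ?G = "Prod E D P\<Omega>" and ?f = "Fst E D P\<Omega>" and ?k = "Snd E D P\<Omega>"
  let ?H = "Prod E ?G X" and ?x = "Snd E ?G X" and ?g = "Fst E ?G X"
  let ?val = "force_val X ?H (P \<bullet> ?f \<bullet> ?g) (?k \<bullet> ?g) (?x # \<rho> \<restriction> (?f \<bullet> ?g)) \<phi>"
  have stage': "stage X ?H (P \<bullet> ?f \<bullet> ?g) (?k \<bullet> ?g) (?x # \<rho> \<restriction> (?f \<bullet> ?g))"
    using stage by (rule stage_op_up)
  have "forced X D P j \<rho> (LAll \<phi>) \<longleftrightarrow> (\<forall>D' f k x. f \<in> Hom E D' D \<longrightarrow> op_ge D' (P \<bullet> f) (j \<bullet> f) k \<longrightarrow>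
      x \<in> Hom E D' X \<longrightarrow> is_true (?val \<bullet> pair E (pair E f k) x))"
    using homs stage' wf by (simp add: Let_def is_true_all_ge_val_sub_all)
  also have "\<dots> \<longleftrightarrow> (\<forall>D' f k x. f \<in> Hom E D' D \<longrightarrow> op_ge D' (P \<bullet> f) (j \<bullet> f) k \<longrightarrow>
      x \<in> Hom E D' X \<longrightarrow> forced X D' (P \<bullet> f) k (x # \<rho> \<restriction> f) \<phi>)"
    by (intro all_cong1 imp_cong refl)
      (use homs stage' wf in \<open>simp_all add: force_val_comp op_ge_def\<close>)
  finally show ?thesis .
qed

lemma stage_op_ge: "stage X D P j \<rho> \<Longrightarrow> op_ge D P j k \<Longrightarrow> stage X D P k \<rho>"
  by (simp add: stage_def op_ge_def)

lemma force_val_mono: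
  assumes "lfm_wf X (length \<rho>) \<phi>" "stage X D P j \<rho>" "infl_monos D P" "op_ge D P j k"
  shows "sub_le E D (force_val X D P j \<rho> \<phi>) (force_val X D P k \<rho> \<phi>)"
  using assms
proof (induction \<phi> arbitrary: D P j k \<rho>)
  case (LAtom R "is")
  note homs = stageD[OF LAtom.prems(2)]
  have "env D (map (nth \<rho>) is)" "types (map (nth \<rho>) is) = replicate (length is) X"
    using LAtom.prems(1) homs(2) stage_nth[OF LAtom.prems(2)]
    by (auto simp: env_def intro!: nth_equalityI)
  then show ?case
    using LAtom.prems(1,4) homs by (auto simp: op_ge_def intro!: sub_le_memb_if_op_leq)
next
  case (LAnd \<phi> \<psi>)
  then show ?case
    using LAnd.IH[of \<rho> D P j k] stage_op_ge[OF LAnd.prems(2,4)] by (simp add: sub_le_iff)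
next
  case (LOr \<phi> \<psi>)
  show ?case
    unfolding force_val.simps using LOr.prems stageD[OF LOr.prems(2)] stage_op_ge[OF LOr.prems(2,4)]
    by (intro memb_mono[OF LOr.prems(3) _ LOr.prems(4)] sub_join_mono LOr.IH) simp_all
next
  case (LImp \<phi> \<psi>)
  then show ?case
    using stageD[OF LImp.prems(2)] stage_op[OF LImp.prems(2)] unfolding force_val.simps Let_def
    by (intro all_ge_val_mono[OF _ _ _ LImp.prems(4)]) simp_all
next
  case (LEx \<phi>)
  note stage_j = LEx.prems(2) and stage_k = stage_op_ge[OF LEx.prems(2,4)]
  let ?G = "Prod E D X" and ?f = "Fst E D X" and ?x = "Snd E D X"
  let ?val = "\<lambda>j. force_val X ?G (P \<bullet> ?f) (j \<bullet> ?f) (?x # \<rho> \<restriction> ?f) \<phi>"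
  have "sub_le E ?G (?val j) (?val k)"
    using LEx.prems(1) stageD[OF stage_j] stage_up[OF stage_j]
    by (intro LEx.IH) (auto intro!: infl_monos_comp[OF LEx.prems(3)] op_ge_comp[OF LEx.prems(4)])
  then show ?case
    using LEx.prems(1) stageD[OF stage_j] stage_up[OF stage_j] stage_up[OF stage_k]
    unfolding force_val.simps Let_def
    by (intro memb_mono[OF LEx.prems(3) _ LEx.prems(4)] sub_ex_mono) simp_all
next
  case (LAll \<phi>)
  then show ?case
    using stageD[OF LAll.prems(2)] stage_op_up[OF LAll.prems(2)] unfolding force_val.simps Let_def
    by (intro all_ge_val_mono[OF _ _ _ LAll.prems(4)]) simp_all
qed

lemma forced_mono:
  assumes "lfm_wf X (length \<rho>) \<phi>" "stage X D P j \<rho>" "infl_monos D P" "op_ge D P j k"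
    and "forced X D P j \<rho> \<phi>"
  shows "forced X D P k \<rho> \<phi>"
  by (rule sub_leD[OF force_val_mono[OF assms(1-4)] _ _ assms(5)])
    (use assms(1,2) stage_op_ge[OF assms(2,4)] in simp_all)

lemma forced_comp:
  assumes "stage X D P j \<rho>" "lfm_wf X (length \<rho>) \<phi>" "f \<in> Hom E D' D" "forced X D P j \<rho> \<phi>"
  shows "forced X D' (P \<bullet> f) (j \<bullet> f) (\<rho> \<restriction> f) \<phi>"
  unfolding force_val_comp[OF assms(1-3), symmetric]
  by (rule is_true_comp[OF assms(4)]) (use assms in simp_all)

lemma op_ge_restrictD:
  assumes "stage X D P j \<rho>" "infl_monos D P" "f \<in> Hom E D' D" "op_ge D' (P \<bullet> f) (j \<bullet> f) k"
  shows "stage X D' (P \<bullet> f) k (\<rho> \<restriction> f)" "infl_monos D' (P \<bullet> f)" "infl_mono D' k"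
proof -
  have P: "P \<in> Hom E D PP\<Omega>" "P \<bullet> f \<in> Hom E D' PP\<Omega>" using stageD[OF assms(1)] assms(3) by simp_all
  show "stage X D' (P \<bullet> f) k (\<rho> \<restriction> f)" using assms by (intro stage_comp) (simp_all add: op_ge_def)
  show "infl_monos D' (P \<bullet> f)" using assms(2) P(1) assms(3) by (rule infl_monos_comp)
  then show "infl_mono D' k" using P(2) assms(4) by (rule infl_mono_if_op_ge)
qed

lemma forced_LImpI:
  assumes "stage X D P j \<rho>" "infl_monos D P" "lfm_wf X (length \<rho>) \<phi>" "lfm_wf X (length \<rho>) \<psi>"
    and "\<And>D' f k. f \<in> Hom E D' D \<Longrightarrow> op_ge D' (P \<bullet> f) (j \<bullet> f) k \<Longrightarrow> stage X D' (P \<bullet> f) k (\<rho> \<restriction> f) \<Longrightarrow>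
      infl_monos D' (P \<bullet> f) \<Longrightarrow> infl_mono D' k \<Longrightarrow> forced X D' (P \<bullet> f) k (\<rho> \<restriction> f) \<phi> \<Longrightarrow>
      forced X D' (P \<bullet> f) k (\<rho> \<restriction> f) \<psi>"
  shows "forced X D P j \<rho> (LImp \<phi> \<psi>)"
  unfolding forced_LImp[OF assms(1,3,4)] using op_ge_restrictD[OF assms(1,2)] assms(5) by blast

lemma forced_LAllI:
  assumes "stage X D P j \<rho>" "infl_monos D P" "lfm_wf X (Suc (length \<rho>)) \<phi>"
    and "\<And>D' f k x. f \<in> Hom E D' D \<Longrightarrow> op_ge D' (P \<bullet> f) (j \<bullet> f) k \<Longrightarrow> x \<in> Hom E D' X \<Longrightarrow>
      stage X D' (P \<bullet> f) k (\<rho> \<restriction> f) \<Longrightarrow> infl_monos D' (P \<bullet> f) \<Longrightarrow> infl_mono D' k \<Longrightarrow>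
      forced X D' (P \<bullet> f) k (x # \<rho> \<restriction> f) \<phi>"
  shows "forced X D P j \<rho> (LAll \<phi>)"
  unfolding forced_LAll[OF assms(1,3)] using op_ge_restrictD[OF assms(1,2)] assms(4) by blast

end


subsection \<open>Recursion and induction on the natural numbers object\<close>

locale topos_nno = elementary_topos E for E :: "('o, 'a) topos" +
  fixes N :: 'o and z s :: 'a
  assumes nno: "nno E N z s"
begin

lemma nno_simps [simp]:
  "N \<in> Obj E" "z \<in> Arr E" "Dom E z = One E" "Cod E z = N" "s \<in> Arr E" "Dom E s = N" "Cod E s = N"
  using nno by (auto simp: nno_def)

lemma nno_rec:
  assumes "a \<in> Hom E (One E) A" "f \<in> Hom E A A"
  shows "\<exists>!h. h \<in> Hom E N A \<and> h \<bullet> z = a \<and> h \<bullet> s = f \<bullet> h"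
proof -
  have "A \<in> Obj E" using assms by auto
  then show ?thesis using nno assms unfolding nno_def by blast
qed

lemma nno_endo:
  assumes "h \<in> Hom E N N" "h \<bullet> z = z" "h \<bullet> s = s \<bullet> h"
  shows "h = Idt E N"
proof -
  have "z \<in> Hom E (One E) N" "s \<in> Hom E N N" by simp_all
  note rec = nno_rec[OF this]
  have "Idt E N \<in> Hom E N N \<and> Idt E N \<bullet> z = z \<and> Idt E N \<bullet> s = s \<bullet> Idt E N" by simp
  then show ?thesis using rec assms by blast
qed

lemma nno_induct_global:
  assumes c: "c \<in> Hom E N \<Omega>" and base: "is_true (c \<bullet> z)"
    and step: "\<And>D y. y \<in> Hom E D N \<Longrightarrow> is_true (c \<bullet> y) \<Longrightarrow> is_true (c \<bullet> s \<bullet> y)"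
  shows "is_true c"
proof -
  obtain e where e: "e \<in> Arr E" "Cod E e = N" "is_true (c \<bullet> e)"
    and factor: "\<And>D h. h \<in> Hom E D N \<Longrightarrow> is_true (c \<bullet> h) \<Longrightarrow> \<exists>!k. k \<in> Hom E D (Dom E e) \<and> e \<bullet> k = h"
    using c by (rule equalizer_true_at) blast
  obtain z' where z': "z' \<in> Hom E (One E) (Dom E e)" "e \<bullet> z' = z"
    using factor[of z "One E"] base by auto
  have "is_true (c \<bullet> s \<bullet> e)" using step[of e "Dom E e"] e by simp
  then obtain s' where s': "s' \<in> Hom E (Dom E e) (Dom E e)" "e \<bullet> s' = s \<bullet> e"
    using factor[of "s \<bullet> e" "Dom E e"] e(1,2) by auto
  obtain h where h: "h \<in> Hom E N (Dom E e)" "h \<bullet> z = z'" "h \<bullet> s = s' \<bullet> h"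
    using nno_rec[OF z'(1) s'(1)] by blast
  have "e \<bullet> h = Idt E N"
  proof (rule nno_endo)
    show "e \<bullet> h \<in> Hom E N N" "(e \<bullet> h) \<bullet> z = z" using e(1,2) h(1,2) z'(2) by simp_all
    have "(e \<bullet> h) \<bullet> s = (e \<bullet> s') \<bullet> h" using e(1,2) h(1,3) s'(1) by simp
    then show "(e \<bullet> h) \<bullet> s = s \<bullet> e \<bullet> h" using e(1,2) h(1) s'(2) by simp
  qed
  then have "c = (c \<bullet> e) \<bullet> h" using e(1,2) h(1) c by simp
  then show ?thesis using is_true_comp[OF e(3), of h] e(1,2) h(1) c by simp
qed

lemma nno_induct:
  assumes D: "D \<in> Obj E" and c: "c \<in> Hom E (Prod E D N) \<Omega>"
    and base: "is_true (c \<bullet> pair E (Idt E D) (z \<bullet> bang E D))"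
    and step: "\<And>D' k y. k \<in> Hom E D' D \<Longrightarrow> y \<in> Hom E D' N \<Longrightarrow>
      is_true (c \<bullet> pair E k y) \<Longrightarrow> is_true (c \<bullet> pair E k (s \<bullet> y))"
  shows "is_true c"
proof -
  let ?a = "sub_all E N D (c \<bullet> pair E (Snd E N D) (Fst E N D))"
  have all_iff: "is_true (?a \<bullet> y) \<longleftrightarrow>
      (\<forall>D'' k d. k \<in> Hom E D'' D' \<longrightarrow> d \<in> Hom E D'' D \<longrightarrow> is_true (c \<bullet> pair E d (y \<bullet> k)))"
    if y: "y \<in> Hom E D' N" for D' y
  proof -
    have D': "D' \<in> Obj E" using y by auto
    let ?c = "c \<bullet> pair E (Snd E D' D) (y \<bullet> Fst E D' D)"
    have c': "?c \<in> Hom E (Prod E D' D) \<Omega>" using c y D D' by simp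
    have "is_true (?a \<bullet> y) \<longleftrightarrow> is_true ?c" using c y D D' by simp
    then show ?thesis
      unfolding is_true_iff_comp[OF c'] using c y D D' by (simp add: all_Arr_Prod_iff)
  qed
  have "is_true ?a"
  proof (rule nno_induct_global)
    show "?a \<in> Hom E N \<Omega>" using c D by simp
    have "is_true (c \<bullet> pair E d (z \<bullet> k))" if "k \<in> Hom E D'' (One E)" "d \<in> Hom E D'' D" for D'' k d
      using is_true_comp[OF base, of d] bang_unique[of k] that c D by simp
    then show "is_true (?a \<bullet> z)" using all_iff[of z "One E"] by simp
  next
    fix D' y assume y: "y \<in> Hom E D' N" "is_true (?a \<bullet> y)"
    have "is_true (c \<bullet> pair E d ((s \<bullet> y) \<bullet> k))" if "k \<in> Hom E D'' D'" "d \<in> Hom E D'' D" for D'' k d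
      using y(2)[unfolded all_iff[OF y(1)]] step[of d D'' "y \<bullet> k"] that y(1) by simp
    then show "is_true (?a \<bullet> s \<bullet> y)" using all_iff[of "s \<bullet> y" D'] y(1) by simp
  qed
  then have "is_true (?a \<bullet> Idt E N)" using c D by simp
  then have "is_true (c \<bullet> pair E (Fst E D N) (Idt E N \<bullet> Snd E D N))"
    using all_iff[of "Idt E N" N, THEN iffD1, rule_format,
      of "Snd E D N" "Prod E D N" "Fst E D N"] D by simp
  then show ?thesis using c D by simp
qed

lemma nno_ext:
  assumes D: "D \<in> Obj E" and h: "h \<in> Hom E (Prod E D N) A" and h': "h' \<in> Hom E (Prod E D N) A"
    and zero: "h \<bullet> pair E (Idt E D) (z \<bullet> bang E D) = h' \<bullet> pair E (Idt E D) (z \<bullet> bang E D)"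
    and step: "\<And>D' k y. k \<in> Hom E D' D \<Longrightarrow> y \<in> Hom E D' N \<Longrightarrow> h \<bullet> pair E k y = h' \<bullet> pair E k y \<Longrightarrow>
      h \<bullet> pair E k (s \<bullet> y) = h' \<bullet> pair E k (s \<bullet> y)"
  shows "h = h'"
proof -
  have A: "A \<in> Obj E" using h by auto
  let ?eq = "eq_at E A \<bullet> pair E h h'"
  have eq_iff: "is_true (?eq \<bullet> pair E k y) \<longleftrightarrow> h \<bullet> pair E k y = h' \<bullet> pair E k y"
    if "k \<in> Hom E D' D" "y \<in> Hom E D' N" for D' k y
    using that h h' A by simp
  have "is_true ?eq"
  proof (rule nno_induct[OF D])
    show "?eq \<in> Hom E (Prod E D N) \<Omega>" using h h' A by simp
    show "is_true (?eq \<bullet> pair E (Idt E D) (z \<bullet> bang E D))"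
      using eq_iff[of "Idt E D" D "z \<bullet> bang E D"] zero D by simp
    fix D' k y assume k: "k \<in> Hom E D' D" and y: "y \<in> Hom E D' N" and "is_true (?eq \<bullet> pair E k y)"
    then have "h \<bullet> pair E k (s \<bullet> y) = h' \<bullet> pair E k (s \<bullet> y)"
      using eq_iff[OF k y] by (intro step) blast+
    then show "is_true (?eq \<bullet> pair E k (s \<bullet> y))" using eq_iff[OF k, of "s \<bullet> y"] y by simp
  qed
  then show ?thesis using h h' by simp
qed

lemma nno_iterate:
  assumes a: "a \<in> Hom E D B" and t: "t \<in> Hom E B B"
  obtains h where "h \<in> Hom E (Prod E D N) B" "h \<bullet> pair E (Idt E D) (z \<bullet> bang E D) = a"
    "h \<bullet> pair E (Fst E D N) (s \<bullet> Snd E D N) = t \<bullet> h"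
proof -
  have D: "D \<in> Obj E" and B: "B \<in> Obj E" using a by auto
  let ?W = "Exp E D B"
  let ?a = "curried E (One E) D B (a \<bullet> Snd E (One E) D)" and ?t = "curried E ?W D B (t \<bullet> Ev E D B)"
  have "?a \<in> Hom E (One E) ?W" "?t \<in> Hom E ?W ?W" using a t D B by simp_all
  then obtain r where r: "r \<in> Hom E N ?W" "r \<bullet> z = ?a" "r \<bullet> s = ?t \<bullet> r"
    using nno_rec by blast
  let ?h = "Ev E D B \<bullet> pair E (r \<bullet> Snd E D N) (Fst E D N)"
  show thesis
  proof (rule that)
    show "?h \<in> Hom E (Prod E D N) B" using r(1) D B by simp
    have "?h \<bullet> pair E (Idt E D) (z \<bullet> bang E D) = Ev E D B \<bullet> pair E ((r \<bullet> z) \<bullet> bang E D) (Idt E D)"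
      using r(1) D B by simp
    then show "?h \<bullet> pair E (Idt E D) (z \<bullet> bang E D) = a" unfolding r(2) using a D B by simp
    have "?h \<bullet> pair E (Fst E D N) (s \<bullet> Snd E D N) =
        Ev E D B \<bullet> pair E ((r \<bullet> s) \<bullet> Snd E D N) (Fst E D N)"
      using r(1) D B by simp
    then show "?h \<bullet> pair E (Fst E D N) (s \<bullet> Snd E D N) = t \<bullet> ?h"
      unfolding r(3) using r(1) t D B by simp
  qed
qed

lemma comp_pair_suc:
  assumes "h \<in> Hom E (Prod E D N) A" "h \<bullet> pair E (Fst E D N) (s \<bullet> Snd E D N) = r"
    and "k \<in> Hom E D' D" "y \<in> Hom E D' N"
  shows "h \<bullet> pair E k (s \<bullet> y) = r \<bullet> pair E k y"
proof -
  have "D \<in> Obj E" using assms(3) by auto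
  then have "h \<bullet> pair E k (s \<bullet> y) = (h \<bullet> pair E (Fst E D N) (s \<bullet> Snd E D N)) \<bullet> pair E k y"
    using assms(1,3,4) by simp
  then show ?thesis unfolding assms(2) .
qed

definition solves_prim_rec :: "'o \<Rightarrow> 'o \<Rightarrow> 'a \<Rightarrow> 'a \<Rightarrow> 'a \<Rightarrow> bool" where
  "solves_prim_rec D A f g h \<longleftrightarrow> h \<in> Hom E (Prod E D N) A \<and>
    h \<bullet> pair E (Idt E D) (z \<bullet> bang E D) = f \<and>
    h \<bullet> pair E (Fst E D N) (s \<bullet> Snd E D N) = g \<bullet> pair E (pair E (Fst E D N) h) (Snd E D N)"

lemma solves_prim_rec_suc:
  assumes h: "solves_prim_rec D A f g h" and g: "g \<in> Hom E (Prod E (Prod E D A) N) A"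
    and k: "k \<in> Hom E D' D" and y: "y \<in> Hom E D' N"
  shows "h \<bullet> pair E k (s \<bullet> y) = g \<bullet> pair E (pair E k (h \<bullet> pair E k y)) y"
proof -
  have D: "D \<in> Obj E" using k by auto
  have h_hom: "h \<in> Hom E (Prod E D N) A"
    and suc: "h \<bullet> pair E (Fst E D N) (s \<bullet> Snd E D N) =
        g \<bullet> pair E (pair E (Fst E D N) h) (Snd E D N)"
    using h unfolding solves_prim_rec_def by blast+
  show ?thesis
    unfolding comp_pair_suc[OF h_hom suc k y] using h_hom g k y D by simp
qed

lemma prim_rec_unique:
  assumes h: "solves_prim_rec D A f g h" and h': "solves_prim_rec D A f g h'"
    and D: "D \<in> Obj E" and g: "g \<in> Hom E (Prod E (Prod E D A) N) A"
  shows "h = h'"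
proof (rule nno_ext[OF D])
  show "h \<in> Hom E (Prod E D N) A" "h' \<in> Hom E (Prod E D N) A"
    "h \<bullet> pair E (Idt E D) (z \<bullet> bang E D) = h' \<bullet> pair E (Idt E D) (z \<bullet> bang E D)"
    using h h' by (simp_all add: solves_prim_rec_def)
  fix D' k y assume k: "k \<in> Hom E D' D" "y \<in> Hom E D' N" and "h \<bullet> pair E k y = h' \<bullet> pair E k y"
  then show "h \<bullet> pair E k (s \<bullet> y) = h' \<bullet> pair E k (s \<bullet> y)"
    unfolding solves_prim_rec_suc[OF h g k] solves_prim_rec_suc[OF h' g k] by simp
qed

text \<open>Iterate \<open>((d, x), n) \<mapsto> ((d, g((d, x), n)), S n)\<close> on \<open>(D \<times> A) \<times> N\<close>.\<close>

lemma prim_rec_exists: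
  assumes f: "f \<in> Hom E D A" and g: "g \<in> Hom E (Prod E (Prod E D A) N) A"
  obtains h where "solves_prim_rec D A f g h"
proof -
  have D: "D \<in> Obj E" and A: "A \<in> Obj E" using f by auto
  let ?C = "Prod E D A"
  let ?B = "Prod E ?C N"
  let ?c = "Fst E ?C N" and ?n = "Snd E ?C N"
  let ?t = "pair E (pair E (Fst E D A \<bullet> ?c) g) (s \<bullet> ?n)"
  have "pair E (pair E (Idt E D) f) (z \<bullet> bang E D) \<in> Hom E D ?B" "?t \<in> Hom E ?B ?B"
    using f g D A by simp_all
  then obtain h where h: "h \<in> Hom E (Prod E D N) ?B"
    and zero: "h \<bullet> pair E (Idt E D) (z \<bullet> bang E D) = pair E (pair E (Idt E D) f) (z \<bullet> bang E D)"
    and suc: "h \<bullet> pair E (Fst E D N) (s \<bullet> Snd E D N) = ?t \<bullet> h"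
    by (rule nno_iterate)
  have parameter: "Fst E D A \<bullet> ?c \<bullet> h = Fst E D N"
  proof (rule nno_ext[OF D])
    fix D' k y assume "k \<in> Hom E D' D" "y \<in> Hom E D' N"
      and "(Fst E D A \<bullet> ?c \<bullet> h) \<bullet> pair E k y = Fst E D N \<bullet> pair E k y"
    then show "(Fst E D A \<bullet> ?c \<bullet> h) \<bullet> pair E k (s \<bullet> y) = Fst E D N \<bullet> pair E k (s \<bullet> y)"
      using comp_pair_suc[OF h suc, of k D' y] h g D A by simp
  qed (use h zero f D A in simp_all)
  have counter: "?n \<bullet> h = Snd E D N"
  proof (rule nno_ext[OF D])
    fix D' k y assume "k \<in> Hom E D' D" "y \<in> Hom E D' N"
      and "(?n \<bullet> h) \<bullet> pair E k y = Snd E D N \<bullet> pair E k y"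
    then show "(?n \<bullet> h) \<bullet> pair E k (s \<bullet> y) = Snd E D N \<bullet> pair E k (s \<bullet> y)"
      using comp_pair_suc[OF h suc, of k D' y] h g D A by simp
  qed (use h zero f D A in simp_all)
  let ?x = "Snd E D A \<bullet> ?c \<bullet> h"
  have "pair E (pair E (Fst E D N) ?x) (Snd E D N) = h"
    unfolding parameter[symmetric] counter[symmetric] using h D A
    by (simp add: pair_eta[of "?c \<bullet> h"] pair_eta[of h])
  moreover have "?x \<bullet> pair E (Fst E D N) (s \<bullet> Snd E D N) = g \<bullet> h"
    using suc h g D A by simp
  ultimately have "solves_prim_rec D A f g ?x"
    unfolding solves_prim_rec_def using h zero f D A by simp
  then show thesis by (rule that)
qed


subsection \<open>The standard interpretation at generalized elements\<close>

abbreviation pmor :: "prim \<Rightarrow> 'a" where "pmor \<equiv> prim_mor E N z s"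
abbreviation pow :: "nat \<Rightarrow> 'o" where "pow m \<equiv> ctx E (replicate m N)"
abbreviation std_lfm :: "nat \<Rightarrow> afm \<Rightarrow> 'a lfm" where "std_lfm \<equiv> std E N z s"
abbreviation tval :: "'o \<Rightarrow> 'a list \<Rightarrow> atm \<Rightarrow> 'a" where "tval D \<rho> t \<equiv> val D \<rho> (std_tm E N z s t)"

lemma pow_obj [simp]: "pow m \<in> Obj E"
  by (rule ctx_obj) auto

lemma prim_mor_PRec:
  assumes "pmor f \<in> Hom E (pow (arity f)) N" "pmor g \<in> Hom E (pow (arity f + 2)) N"
  shows "solves_prim_rec (pow (arity f)) N (pmor f) (pmor g) (pmor (PRec f g))"
proof -
  have g: "pmor g \<in> Hom E (Prod E (Prod E (pow (arity f)) N) N) N" using assms(2) by simp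
  obtain h where h: "solves_prim_rec (pow (arity f)) N (pmor f) (pmor g) h"
    using assms(1) g by (rule prim_rec_exists)
  moreover have "pmor (PRec f g) = (THE h. solves_prim_rec (pow (arity f)) N (pmor f) (pmor g) h)"
    unfolding prim_mor.simps Let_def solves_prim_rec_def ..
  moreover have "solves_prim_rec (pow (arity f)) N (pmor f) (pmor g)
      (THE h. solves_prim_rec (pow (arity f)) N (pmor f) (pmor g) h)"
    using h by (rule theI) (rule prim_rec_unique[OF _ h pow_obj g])
  ultimately show ?thesis by simp
qed

lemma prim_mor_hom: "prim_wf f \<Longrightarrow> pmor f \<in> Hom E (pow (arity f)) N"
proof (induction f)
  case (PProj m i)
  have "set (replicate m N) \<subseteq> Obj E" by auto
  then show ?case using PProj by simp
next
  case (PComp m f gs)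
  have "env (pow m) (map pmor gs)" "types (map pmor gs) = replicate (length gs) N"
    using PComp by (auto simp: env_def intro!: nth_equalityI)
  then show ?case using PComp by simp
next
  case (PRec f g)
  then show ?case using prim_mor_PRec[of f g] by (simp add: solves_prim_rec_def)
qed simp_all

lemma typed_std_tm: "atm_wf n t \<Longrightarrow> typed E (replicate n N) (std_tm E N z s t) N"
proof (induction t)
  case (AFun f ts)
  have "typed E (replicate n N) (tuple (map (std_tm E N z s) ts)) (pow (arity f))"
    using typed_tuple[of "map (std_tm E N z s) ts" "replicate n N" N] AFun by auto
  then show ?case using prim_mor_hom[of f] AFun.prems by auto
qed simp

context
  fixes D :: 'o and \<rho> :: "'a list" and n :: nat
  assumes env: "env D \<rho>" and types: "types \<rho> = replicate n N"
begin

lemma length_env: "length \<rho> = n"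
  using arg_cong[OF types, of length] by simp

lemma tval_hom: "atm_wf n t \<Longrightarrow> tval D \<rho> t \<in> Hom E D N"
  using val_hom[OF env, of "std_tm E N z s t" N] typed_std_tm types by simp

lemma tval_comp: "atm_wf n t \<Longrightarrow> f \<in> Hom E D' D \<Longrightarrow> tval D \<rho> t \<bullet> f = tval D' (\<rho> \<restriction> f) t"
  using val_comp[OF env] typed_std_tm types by metis

lemma tval_AFun:
  assumes "atm_wf n (AFun f ts)"
  shows "tval D \<rho> (AFun f ts) = pmor f \<bullet> mor_tuple E D (map (tval D \<rho>) ts)"
proof -
  let ?ts = "map (std_tm E N z s) ts"
  have args: "typed E (types \<rho>) u N" if "u \<in> set ?ts" for u
    using that assms typed_std_tm types by auto
  have "typed E (types \<rho>) (tuple ?ts) (pow (length ts))"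
    using typed_tuple[of ?ts "types \<rho>" N] args by simp
  moreover have "pmor f \<in> Hom E (pow (length ts)) N" using assms prim_mor_hom[of f] by simp
  moreover have "val D \<rho> (tuple ?ts) = mor_tuple E D (map (tval D \<rho>) ts)"
    using val_tuple[OF env, of ?ts N] args by (simp add: o_def)
  ultimately show ?thesis using val_TApp[OF env, of "pmor f"] by simp
qed

end

lemma wf_atm_subst: "atm_wf n t \<Longrightarrow> \<forall>i<n. atm_wf m (\<sigma> i) \<Longrightarrow> atm_wf m (atm_subst \<sigma> t)"
  by (induction t) auto

lemma under_wf: "\<forall>i<n. atm_wf m (\<sigma> i) \<Longrightarrow> \<forall>i<Suc n. atm_wf (Suc m) (under \<sigma> i)"
  by (auto simp: under_def intro!: wf_atm_subst[of m] split: nat.split)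

lemma wf_afm_subst: "afm_wf n \<phi> \<Longrightarrow> \<forall>i<n. atm_wf m (\<sigma> i) \<Longrightarrow> afm_wf m (afm_subst \<sigma> \<phi>)"
proof (induction \<phi> arbitrary: n m \<sigma>)
  case (AEx \<phi>)
  then show ?case using under_wf[of n m \<sigma>] by simp
next
  case (AAll \<phi>)
  then show ?case using under_wf[of n m \<sigma>] by simp
qed (auto intro: wf_atm_subst)

definition tvals :: "'o \<Rightarrow> 'a list \<Rightarrow> (nat \<Rightarrow> atm) \<Rightarrow> nat \<Rightarrow> 'a list" where
  "tvals D \<rho> \<sigma> n = map (\<lambda>i. tval D \<rho> (\<sigma> i)) [0..<n]"

context
  fixes D :: 'o and \<rho> :: "'a list" and m n :: nat and \<sigma> :: "nat \<Rightarrow> atm"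
  assumes env: "env D \<rho>" and types: "types \<rho> = replicate m N" and \<sigma>: "\<forall>i<n. atm_wf m (\<sigma> i)"
begin

lemma env_tvals: "env D (tvals D \<rho> \<sigma> n)"
  and types_tvals: "types (tvals D \<rho> \<sigma> n) = replicate n N"
  using tval_hom[OF env types] \<sigma> env_obj[OF env]
  by (auto simp: env_def tvals_def intro!: nth_equalityI)

lemma tval_subst: "atm_wf n t \<Longrightarrow> tval D \<rho> (atm_subst \<sigma> t) = tval D (tvals D \<rho> \<sigma> n) t"
proof (induction t)
  case (AVar i)
  then show ?case using env_tvals by (simp add: tvals_def)
next
  case (AFun f ts)
  have wf: "atm_wf m (AFun f (map (atm_subst \<sigma>) ts))"
    using wf_atm_subst[OF AFun.prems \<sigma>] by simp
  have "map (tval D \<rho>) (map (atm_subst \<sigma>) ts) = map (tval D (tvals D \<rho> \<sigma> n)) ts"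
    using AFun by simp
  then show ?case
    unfolding atm_subst.simps tval_AFun[OF env types wf]
      tval_AFun[OF env_tvals types_tvals AFun.prems]
    by (rule arg_cong)
qed

lemma tvals_comp: "f \<in> Hom E D' D \<Longrightarrow> tvals D \<rho> \<sigma> n \<restriction> f = tvals D' (\<rho> \<restriction> f) \<sigma> n"
  using tval_comp[OF env types] \<sigma> by (auto simp: tvals_def restrict_def)

end

lemma tval_weaken:
  assumes "env D (x # \<rho>)" "Cod E x = N" "types \<rho> = replicate m N" "atm_wf m t"
  shows "tval D (x # \<rho>) (atm_subst (\<lambda>k. AVar (Suc k)) t) = tval D \<rho> t"
proof -
  have types: "types (x # \<rho>) = replicate (Suc m) N" using assms by simp
  have "tvals D (x # \<rho>) (\<lambda>k. AVar (Suc k)) m = \<rho>"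
    using assms length_env[of D \<rho> m] by (intro nth_equalityI) (auto simp: tvals_def)
  then show ?thesis using tval_subst[OF assms(1) types, of m "\<lambda>k. AVar (Suc k)" t] assms(4) by simp
qed

lemma tvals_under:
  assumes "env D (x # \<rho>)" "Cod E x = N" "types \<rho> = replicate m N" "\<forall>i<n. atm_wf m (\<sigma> i)"
  shows "tvals D (x # \<rho>) (under \<sigma>) (Suc n) = x # tvals D \<rho> \<sigma> n"
  unfolding tvals_def map_upt_Suc using assms tval_weaken[OF assms(1-3)] by (simp add: under_def)

lemma lfm_wf_std: "afm_wf n \<phi> \<Longrightarrow> lfm_wf N n (std_lfm n \<phi>)"
proof (induction \<phi> arbitrary: n)
  case (AEq t u)
  then have "typed E (replicate n N) (TEq (std_tm E N z s t) (std_tm E N z s u)) \<Omega>"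
    using typed_std_tm by auto
  moreover have "set (replicate n N) \<subseteq> Obj E" by auto
  ultimately show ?case using sem_simps[of "replicate n N"] by (simp del: sem.simps typed_simps)
qed simp_all

lemma force_val_AEq:
  assumes "atm_wf n t" "atm_wf n u" "stage N D P j \<rho>" "length \<rho> = n"
  shows "force_val N D P j \<rho> (std_lfm n (AEq t u)) =
      memb (eq_at E N \<bullet> pair E (tval D \<rho> t) (tval D \<rho> u)) j"
proof -
  note homs = stageD[OF assms(3)]
  have types: "types \<rho> = replicate n N" using homs assms(4) by simp
  have "map (nth \<rho>) [0..<n] = \<rho>" using assms(4) map_nth by blast
  then have "force_val N D P j \<rho> (std_lfm n (AEq t u)) =
      memb (val D \<rho> (TEq (std_tm E N z s t) (std_tm E N z s u))) j"
    by (simp add: val_def types del: sem.simps)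
  also have "val D \<rho> (TEq (std_tm E N z s t) (std_tm E N z s u)) =
      eq_at E N \<bullet> pair E (tval D \<rho> t) (tval D \<rho> u)"
    using homs typed_std_tm assms(1,2) types by (intro val_TEq) simp_all
  finally show ?thesis .
qed

lemma force_val_subst_AEq:
  assumes wf: "atm_wf n t" "atm_wf n u" and \<sigma>: "\<forall>i<n. atm_wf (length \<rho>) (\<sigma> i)"
    and stage: "stage N D P j \<rho>"
  shows "force_val N D P j \<rho> (std_lfm (length \<rho>) (AEq (atm_subst \<sigma> t) (atm_subst \<sigma> u))) =
    force_val N D P j (tvals D \<rho> \<sigma> n) (std_lfm n (AEq t u))"
proof -
  note env = stage_env[OF stage]
  have "stage N D P j (tvals D \<rho> \<sigma> n)" "length (tvals D \<rho> \<sigma> n) = n"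
    using stage env_tvals[OF env \<sigma>] types_tvals[OF env \<sigma>] by (simp_all add: stage_def tvals_def)
  then show ?thesis
    using force_val_AEq[OF wf_atm_subst[OF wf(1) \<sigma>] wf_atm_subst[OF wf(2) \<sigma>] stage refl]
      force_val_AEq[OF wf] tval_subst[OF env \<sigma>] wf by simp
qed

lemma force_val_subst:
  assumes "afm_wf n \<phi>" "\<forall>i<n. atm_wf (length \<rho>) (\<sigma> i)" "stage N D P j \<rho>"
  shows "force_val N D P j \<rho> (std_lfm (length \<rho>) (afm_subst \<sigma> \<phi>)) =
    force_val N D P j (tvals D \<rho> \<sigma> n) (std_lfm n \<phi>)"
  using assms
proof (induction \<phi> arbitrary: n \<sigma> D P j \<rho>)
  case (AEq t u)
  then show ?case unfolding afm_subst.simps by (intro force_val_subst_AEq) simp_all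
next
  case (AAnd \<phi> \<psi>)
  show ?case using AAnd.prems(1) AAnd.IH[OF _ AAnd.prems(2,3)] by simp
next
  case (AOr \<phi> \<psi>)
  show ?case using AOr.prems(1) AOr.IH[OF _ AOr.prems(2,3)] by simp
next
  case (AImp \<phi> \<psi>)
  note homs = stageD[OF AImp.prems(3)] and env = stage_env[OF AImp.prems(3)]
  then show ?case
    using AImp.prems(1,2) AImp.IH[OF _ _ stage_op[OF AImp.prems(3)], of n \<sigma>]
      tvals_comp[OF env AImp.prems(2), of "Fst E D P\<Omega>"] by (simp add: Let_def)
next
  case (AEx \<phi>)
  note homs = stageD[OF AEx.prems(3)] and env = stage_env[OF AEx.prems(3)]
  then show ?case
    using AEx.prems(1,2) AEx.IH[OF _ _ stage_up[OF AEx.prems(3)], of "Suc n" "under \<sigma>"]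
      under_wf[OF AEx.prems(2)]
      tvals_comp[OF env AEx.prems(2), of "Fst E D N"]
      tvals_under[of "Prod E D N" "Snd E D N" "\<rho> \<restriction> Fst E D N" "length \<rho>" n \<sigma>] by (simp add: Let_def)
next
  case (AAll \<phi>)
  note homs = stageD[OF AAll.prems(3)] and env = stage_env[OF AAll.prems(3)]
  let ?G = "Prod E D P\<Omega>" and ?f = "Fst E D P\<Omega>"
  let ?H = "Prod E ?G N" and ?g = "Fst E ?G N" and ?x = "Snd E ?G N"
  show ?case
    using AAll.prems(1,2) AAll.IH[OF _ _ stage_op_up[OF AAll.prems(3)], of "Suc n" "under \<sigma>"]
      under_wf[OF AAll.prems(2)] tvals_comp[OF env AAll.prems(2), of "?f \<bullet> ?g"] homs
      tvals_under[of ?H ?x "\<rho> \<restriction> (?f \<bullet> ?g)" "length \<rho>" n \<sigma>] by (simp add: Let_def)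
qed simp


subsection \<open>Validity of the axioms\<close>

context
  fixes D :: 'o and \<rho> :: "'a list" and n :: nat
  assumes env: "env D \<rho>" and types: "types \<rho> = replicate n N"
begin

lemma env_map_tval: "\<forall>t\<in>set ts. atm_wf n t \<Longrightarrow> env D (map (tval D \<rho>) ts)"
  and types_map_tval: "\<forall>t\<in>set ts. atm_wf n t \<Longrightarrow> types (map (tval D \<rho>) ts) = replicate (length ts) N"
  using tval_hom[OF env types] env_obj[OF env] by (auto simp: env_def intro!: nth_equalityI)

lemma tval_AZero: "tval D \<rho> AZero = z \<bullet> bang E D"
  using tval_AFun[OF env types, of PZero "[]"] by simp

lemma tval_ASuc:
  assumes "atm_wf n t"
  shows "tval D \<rho> (ASuc t) = s \<bullet> tval D \<rho> t"
  using tval_AFun[OF env types, of PSucc "[t]"] tval_hom[OF env types assms] env_obj[OF env] assms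
  by simp

lemma tval_PProj:
  assumes "atm_wf n (AFun (PProj m i) ts)"
  shows "tval D \<rho> (AFun (PProj m i) ts) = tval D \<rho> (ts ! i)"
proof -
  have "proj E (types (map (tval D \<rho>) ts)) i \<bullet> mor_tuple E D (map (tval D \<rho>) ts) =
      map (tval D \<rho>) ts ! i"
    using assms by (intro proj_mor_tuple env_map_tval) simp_all
  then show ?thesis
    using assms types_map_tval[of ts] unfolding tval_AFun[OF env types assms] by simp
qed

lemma tval_PComp:
  assumes wf: "atm_wf n (AFun (PComp m f gs) ts)"
  shows "tval D \<rho> (AFun (PComp m f gs) ts) = tval D \<rho> (AFun f (map (\<lambda>g. AFun g ts) gs))"
proof -
  let ?x = "mor_tuple E D (map (tval D \<rho>) ts)"
  have x: "?x \<in> Hom E D (pow m)"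
    using wf mor_tuple_hom[OF env_map_tval[of ts]] types_map_tval[of ts] by simp
  have gs: "env (pow m) (map pmor gs)" "types (map pmor gs) = replicate (length gs) N"
    using wf prim_mor_hom by (auto simp: env_def intro!: nth_equalityI)
  have f: "pmor f \<in> Hom E (pow (length gs)) N" using wf prim_mor_hom[of f] by simp
  have "tval D \<rho> (AFun (PComp m f gs) ts) = pmor f \<bullet> mor_tuple E (pow m) (map pmor gs) \<bullet> ?x"
    unfolding tval_AFun[OF env types wf] using x gs f by simp
  also have "\<dots> = pmor f \<bullet> mor_tuple E D (map pmor gs \<restriction> ?x)"
    using x gs by simp
  also have "map pmor gs \<restriction> ?x = map (tval D \<rho>) (map (\<lambda>g. AFun g ts) gs)"
    using wf tval_AFun[OF env types, of _ ts] by (simp add: restrict_def)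
  also have "pmor f \<bullet> mor_tuple E D \<dots> = tval D \<rho> (AFun f (map (\<lambda>g. AFun g ts) gs))"
    by (rule tval_AFun[OF env types, symmetric]) (use wf in auto)
  finally show ?thesis .
qed

context
  fixes f g :: prim and ts :: "atm list"
  assumes rec: "prim_wf (PRec f g)" and ts: "length ts = arity f" "\<forall>t\<in>set ts. atm_wf n t"
begin

lemma solves_PRec: "solves_prim_rec (pow (arity f)) N (pmor f) (pmor g) (pmor (PRec f g))"
  using rec prim_mor_hom[of f] prim_mor_hom[of g] by (intro prim_mor_PRec) simp_all

lemma tval_PRec:
  assumes "atm_wf n t"
  shows "tval D \<rho> (AFun (PRec f g) (t # ts)) =
      pmor (PRec f g) \<bullet> pair E (mor_tuple E D (map (tval D \<rho>) ts)) (tval D \<rho> t)"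
  using tval_AFun[OF env types, of "PRec f g" "t # ts"] rec ts assms by simp

lemma mor_tuple_args: "mor_tuple E D (map (tval D \<rho>) ts) \<in> Hom E D (pow (arity f))"
  using mor_tuple_hom[OF env_map_tval[of ts]] types_map_tval[of ts] ts by simp

lemma tval_PRec_AZero: "tval D \<rho> (AFun (PRec f g) (AZero # ts)) = tval D \<rho> (AFun f ts)"
proof -
  let ?x = "mor_tuple E D (map (tval D \<rho>) ts)" and ?D = "pow (arity f)"
  have h: "pmor (PRec f g) \<in> Hom E (Prod E ?D N) N"
    and zero: "pmor (PRec f g) \<bullet> pair E (Idt E ?D) (z \<bullet> bang E ?D) = pmor f"
    using solves_PRec unfolding solves_prim_rec_def by blast+
  have "tval D \<rho> (AFun (PRec f g) (AZero # ts)) = pmor (PRec f g) \<bullet> pair E ?x (z \<bullet> bang E D)"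
    unfolding tval_AZero[symmetric] by (rule tval_PRec) simp
  also have "\<dots> = (pmor (PRec f g) \<bullet> pair E (Idt E ?D) (z \<bullet> bang E ?D)) \<bullet> ?x"
    using h mor_tuple_args by (simp del: prim_mor.simps)
  also have "\<dots> = tval D \<rho> (AFun f ts)"
    unfolding zero by (rule tval_AFun[OF env types, symmetric]) (use rec ts in simp)
  finally show ?thesis .
qed

lemma tval_PRec_ASuc:
  assumes t: "atm_wf n t"
  shows "tval D \<rho> (AFun (PRec f g) (ASuc t # ts)) =
      tval D \<rho> (AFun g (t # AFun (PRec f g) (t # ts) # ts))"
proof -
  let ?x = "mor_tuple E D (map (tval D \<rho>) ts)"
  have g: "pmor g \<in> Hom E (Prod E (Prod E (pow (arity f)) N) N) N"
    using rec prim_mor_hom[of g] by simp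
  have "tval D \<rho> (AFun (PRec f g) (ASuc t # ts)) = pmor (PRec f g) \<bullet> pair E ?x (s \<bullet> tval D \<rho> t)"
    unfolding tval_ASuc[OF t, symmetric] by (rule tval_PRec) (use t in simp)
  also have "\<dots> =
      pmor g \<bullet> pair E (pair E ?x (pmor (PRec f g) \<bullet> pair E ?x (tval D \<rho> t))) (tval D \<rho> t)"
    using solves_PRec g mor_tuple_args tval_hom[OF env types t] by (rule solves_prim_rec_suc)
  also have "\<dots> = pmor g \<bullet> mor_tuple E D (map (tval D \<rho>) (t # AFun (PRec f g) (t # ts) # ts))"
    unfolding list.map mor_tuple_Cons tval_PRec[OF t] ..
  also have "\<dots> = tval D \<rho> (AFun g (t # AFun (PRec f g) (t # ts) # ts))"
    by (rule tval_AFun[OF env types, symmetric]) (use rec ts t in simp)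
  finally show ?thesis .
qed

end

end

lemma length_vars [simp]: "length (vars k m) = m"
  by (simp add: vars_def)

lemma HA_axiom_wf: "HA_axiom n \<phi> \<Longrightarrow> afm_wf n \<phi>"
proof (induction rule: HA_axiom.induct)
  case (induction n \<phi>)
  have "afm_wf n (subst_zero \<phi>)"
    unfolding subst_zero_def using induction by (rule wf_afm_subst) (auto split: nat.split)
  moreover have "afm_wf (Suc n) (subst_suc \<phi>)"
    unfolding subst_suc_def using induction by (rule wf_afm_subst) (auto split: nat.split)
  ultimately show ?case using induction by simp
qed (auto simp: vars_def)

definition valid :: "nat \<Rightarrow> afm \<Rightarrow> bool" where
  "valid n \<phi> \<longleftrightarrow> (\<forall>D P j \<rho>. stage N D P j \<rho> \<longrightarrow> length \<rho> = n \<longrightarrow> infl_monos D P \<longrightarrow> infl_mono D j \<longrightarrow>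
     forced N D P j \<rho> (std_lfm n \<phi>))"

lemma valid_AEq:
  assumes wf: "afm_wf n (AEq t u)"
    and eq: "\<And>D \<rho>. env D \<rho> \<Longrightarrow> types \<rho> = replicate n N \<Longrightarrow> tval D \<rho> t = tval D \<rho> u"
  shows "valid n (AEq t u)"
  unfolding valid_def
proof (intro allI impI)
  fix D P j \<rho> assume stage: "stage N D P j \<rho>" and length_\<rho>: "length \<rho> = n" and j: "infl_mono D j"
  note homs = stageD[OF stage] and env = stage_env[OF stage]
  have types: "types \<rho> = replicate n N" using homs length_\<rho> by simp
  have u: "tval D \<rho> u \<in> Hom E D N" using tval_hom[OF env(1) types] wf by simp
  have "is_true (memb (eq_at E N \<bullet> pair E (tval D \<rho> u) (tval D \<rho> u)) j)"
    using homs u by (intro infl_mono_true[OF j]) simp_all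
  then show "forced N D P j \<rho> (std_lfm n (AEq t u))"
    using force_val_AEq[of n t u, OF _ _ stage length_\<rho>] eq[OF env(1) types] wf by simp
qed

lemma valid_gen:
  assumes wf: "afm_wf (Suc n) \<phi>" and valid: "valid (Suc n) \<phi>"
  shows "valid n (AAll \<phi>)"
  unfolding valid_def std.simps
proof (intro allI impI)
  fix D P j \<rho> assume stage: "stage N D P j \<rho>" and length_\<rho>: "length \<rho> = n" and P: "infl_monos D P"
  have wf': "lfm_wf N (Suc (length \<rho>)) (std_lfm (Suc n) \<phi>)" using lfm_wf_std[OF wf] length_\<rho> by simp
  from stage P wf' show "forced N D P j \<rho> (LAll (std_lfm (Suc n) \<phi>))"
  proof (rule forced_LAllI)
    fix D' f k x assume x: "x \<in> Hom E D' N" and stage': "stage N D' (P \<bullet> f) k (\<rho> \<restriction> f)"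
      and "infl_monos D' (P \<bullet> f)" "infl_mono D' k"
    moreover have "length (x # \<rho> \<restriction> f) = Suc n" using length_\<rho> by simp
    ultimately show "forced N D' (P \<bullet> f) k (x # \<rho> \<restriction> f) (std_lfm (Suc n) \<phi>)"
      using valid stage_Cons[OF stage' x] unfolding valid_def by blast
  qed
qed

lemma succ_eq_zero_le_bot:
  assumes y: "y \<in> Hom E D N"
  shows "sub_le E D (eq_at E N \<bullet> pair E (s \<bullet> y) (z \<bullet> bang E D)) (sub_bot E D)"
proof -
  have D: "D \<in> Obj E" using y by auto
  have "sub_bot E (One E) \<in> Hom E (One E) \<Omega>" "true_at E \<Omega> \<in> Hom E \<Omega> \<Omega>" by simp_all
  then obtain h where h: "h \<in> Hom E N \<Omega>" "h \<bullet> z = sub_bot E (One E)" "h \<bullet> s = true_at E \<Omega> \<bullet> h"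
    using nno_rec by blast
  have "is_true (sub_bot E D')" if f: "f \<in> Hom E D' D" and eq: "s \<bullet> y \<bullet> f = z \<bullet> bang E D'" for D' f
  proof -
    have D': "D' \<in> Obj E" using f by auto
    have "sub_bot E D' = (h \<bullet> z) \<bullet> bang E D'" unfolding h(2) using D' by simp
    also have "\<dots> = h \<bullet> s \<bullet> y \<bullet> f" unfolding eq using h(1) D' by simp
    also have "\<dots> = (h \<bullet> s) \<bullet> y \<bullet> f" using h(1) y f by simp
    also have "\<dots> = true_at E D'" unfolding h(3) using h(1) y f by simp
    finally show ?thesis using D' by simp
  qed
  then show ?thesis using y D by (simp add: sub_le_iff)
qed

lemma forced_ABot_if_succ_eq_zero:
  assumes stage: "stage N D P k \<rho>" and length_\<rho>: "length \<rho> = Suc n" and k: "infl_mono D k"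
    and eq: "forced N D P k \<rho> (std_lfm (Suc n) (AEq (ASuc (AVar 0)) AZero))"
  shows "forced N D P k \<rho> (std_lfm (Suc n) ABot)"
proof -
  note homs = stageD[OF stage] and env = stage_env[OF stage]
  let ?y = "\<rho> ! 0"
  have y: "?y \<in> Hom E D N" using stage_nth[OF stage, of 0] length_\<rho> by simp
  have types: "types \<rho> = replicate (Suc n) N" using env(2) length_\<rho> by simp
  have "tval D \<rho> (ASuc (AVar 0)) = s \<bullet> ?y"
    using tval_ASuc[OF env(1) types, of "AVar 0"] env(1) length_\<rho> by simp
  then have "is_true (memb (eq_at E N \<bullet> pair E (s \<bullet> ?y) (z \<bullet> bang E D)) k)"
    using eq force_val_AEq[OF _ _ stage length_\<rho>, of "ASuc (AVar 0)" AZero]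
      tval_AZero[OF env(1) types] by simp
  moreover have
    "sub_le E D (memb (eq_at E N \<bullet> pair E (s \<bullet> ?y) (z \<bullet> bang E D)) k) (memb (sub_bot E D) k)"
    using homs y succ_eq_zero_le_bot[OF y] by (intro infl_mono_sub_le[OF k]) simp_all
  ultimately have "is_true (memb (sub_bot E D) k)"
    using homs y by (elim sub_leD[rotated 3]) simp_all
  then show ?thesis using homs(2) by simp
qed

lemma valid_succ_nonzero: "valid n (AAll (ANeg (AEq (ASuc (AVar 0)) AZero)))"
proof (rule valid_gen)
  let ?eq = "AEq (ASuc (AVar 0)) AZero"
  show "afm_wf (Suc n) (ANeg ?eq)" by simp
  show "valid (Suc n) (ANeg ?eq)"
    unfolding valid_def std.simps(5)
  proof (intro allI impI)
    fix D P j \<rho> assume stage: "stage N D P j \<rho>" and length_\<rho>: "length \<rho> = Suc n"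
      and P: "infl_monos D P"
    have "lfm_wf N (length \<rho>) (std_lfm (Suc n) ?eq)" "lfm_wf N (length \<rho>) (std_lfm (Suc n) ABot)"
      unfolding length_\<rho> by (rule lfm_wf_std, simp)+
    with stage P show "forced N D P j \<rho> (LImp (std_lfm (Suc n) ?eq) (std_lfm (Suc n) ABot))"
      by (rule forced_LImpI) (rule forced_ABot_if_succ_eq_zero, use length_\<rho> in simp_all)
  qed
qed

lemma forced_nat_induct:
  assumes stage: "stage N D P j \<rho>" and wf: "lfm_wf N (Suc (length \<rho>)) \<phi>"
    and zero: "forced N D P j ((z \<bullet> bang E D) # \<rho>) \<phi>"
    and suc: "\<And>D' f y. f \<in> Hom E D' D \<Longrightarrow> y \<in> Hom E D' N \<Longrightarrow>
      forced N D' (P \<bullet> f) (j \<bullet> f) (y # \<rho> \<restriction> f) \<phi> \<Longrightarrow> forced N D' (P \<bullet> f) (j \<bullet> f) ((s \<bullet> y) # \<rho> \<restriction> f) \<phi>"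
    and x: "x \<in> Hom E D N"
  shows "forced N D P j (x # \<rho>) \<phi>"
proof -
  note homs = stageD[OF stage] and stage' = stage_up[OF stage]
  let ?c = "force_val N (Prod E D N) (P \<bullet> Fst E D N) (j \<bullet> Fst E D N) (Snd E D N # \<rho> \<restriction> Fst E D N) \<phi>"
  have c: "?c \<in> Hom E (Prod E D N) \<Omega>" using stage' wf by simp
  have c_pair: "?c \<bullet> pair E f y = force_val N D' (P \<bullet> f) (j \<bullet> f) (y # \<rho> \<restriction> f) \<phi>"
    if "f \<in> Hom E D' D" "y \<in> Hom E D' N" for D' f y
    using force_val_comp[OF stage', of \<phi> "pair E f y" D'] that wf homs by simp
  have c_Idt: "?c \<bullet> pair E (Idt E D) y = force_val N D P j (y # \<rho>) \<phi>" if "y \<in> Hom E D N" for y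
    using c_pair[of "Idt E D" D y] that homs by simp
  have "is_true ?c"
  proof (rule nno_induct[OF homs(2) c])
    show "is_true (?c \<bullet> pair E (Idt E D) (z \<bullet> bang E D))"
      using c_Idt[of "z \<bullet> bang E D"] zero homs(2) by simp
    fix D' f y assume "f \<in> Hom E D' D" "y \<in> Hom E D' N" "is_true (?c \<bullet> pair E f y)"
    then show "is_true (?c \<bullet> pair E f (s \<bullet> y))"
      using c_pair[of f D' y] c_pair[of f D' "s \<bullet> y"] suc[of f D' y] by simp
  qed
  then have "is_true (?c \<bullet> pair E (Idt E D) x)" using c x homs(2) by (intro is_true_comp) simp_all
  then show ?thesis using c_Idt[OF x] by simp
qed

lemma force_val_subst_zero:
  assumes "afm_wf (Suc n) \<phi>" "stage N D P j \<rho>" "length \<rho> = n"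
  shows "force_val N D P j \<rho> (std_lfm n (subst_zero \<phi>)) =
      force_val N D P j ((z \<bullet> bang E D) # \<rho>) (std_lfm (Suc n) \<phi>)"
proof -
  let ?\<sigma> = "\<lambda>i. case i of 0 \<Rightarrow> AZero | Suc i' \<Rightarrow> AVar i'"
  note env = stage_env[OF assms(2)]
  have "tvals D \<rho> ?\<sigma> (Suc n) = (z \<bullet> bang E D) # \<rho>"
    unfolding tvals_def map_upt_Suc using tval_AZero[OF env] env(1) assms(3)
    by (auto intro!: nth_equalityI)
  moreover have "\<forall>i<Suc n. atm_wf (length \<rho>) (?\<sigma> i)" using assms(3) by (auto split: nat.split)
  ultimately show ?thesis
    unfolding subst_zero_def using force_val_subst[OF assms(1) _ assms(2), of ?\<sigma>] assms(3) by simp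
qed

lemma force_val_subst_suc:
  assumes "afm_wf (Suc n) \<phi>" "stage N D P j (y # \<rho>)" "length \<rho> = n"
  shows "force_val N D P j (y # \<rho>) (std_lfm (Suc n) (subst_suc \<phi>)) =
    force_val N D P j ((s \<bullet> y) # \<rho>) (std_lfm (Suc n) \<phi>)"
proof -
  let ?\<sigma> = "\<lambda>i. case i of 0 \<Rightarrow> ASuc (AVar 0) | Suc i' \<Rightarrow> AVar (Suc i')"
  note env = stage_env[OF assms(2)]
  have "tvals D (y # \<rho>) ?\<sigma> (Suc n) = (s \<bullet> y) # \<rho>"
    unfolding tvals_def map_upt_Suc using tval_ASuc[OF env, of "AVar 0"] env(1) assms(3)
    by (auto intro!: nth_equalityI)
  moreover have "\<forall>i<Suc n. atm_wf (length (y # \<rho>)) (?\<sigma> i)" using assms(3) by (auto split: nat.split)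
  ultimately show ?thesis
    unfolding subst_suc_def using force_val_subst[OF assms(1) _ assms(2), of ?\<sigma>] assms(3) by simp
qed

lemma forced_induction:
  assumes wf: "afm_wf (Suc n) \<phi>" and stage: "stage N D P j \<rho>" and length_\<rho>: "length \<rho> = n"
    and j: "is_true (memb j P)"
    and zero: "forced N D P j \<rho> (std_lfm n (subst_zero \<phi>))"
    and suc: "forced N D P j \<rho> (std_lfm n (AAll (AImp \<phi> (subst_suc \<phi>))))"
    and x: "x \<in> Hom E D N"
  shows "forced N D P j (x # \<rho>) (std_lfm (Suc n) \<phi>)"
proof (rule forced_nat_induct[OF stage])
  note homs = stageD[OF stage]
  have "afm_wf (Suc n) (subst_suc \<phi>)"
    unfolding subst_suc_def using wf by (rule wf_afm_subst) (auto split: nat.split)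
  then have wfs: "lfm_wf N (Suc n) (std_lfm (Suc n) \<phi>)"
    "lfm_wf N (Suc n) (std_lfm (Suc n) (subst_suc \<phi>))"
    using wf lfm_wf_std by blast+
  then have wf_imp: "lfm_wf N (Suc (length \<rho>))
      (LImp (std_lfm (Suc n) \<phi>) (std_lfm (Suc n) (subst_suc \<phi>)))"
    using length_\<rho> by simp
  show "lfm_wf N (Suc (length \<rho>)) (std_lfm (Suc n) \<phi>)" using wfs length_\<rho> by simp
  show "forced N D P j ((z \<bullet> bang E D) # \<rho>) (std_lfm (Suc n) \<phi>)"
    using zero unfolding force_val_subst_zero[OF wf stage length_\<rho>] .
  fix D' f y assume f: "f \<in> Hom E D' D" and y: "y \<in> Hom E D' N"
    and \<phi>: "forced N D' (P \<bullet> f) (j \<bullet> f) (y # \<rho> \<restriction> f) (std_lfm (Suc n) \<phi>)"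
  have stage': "stage N D' (P \<bullet> f) (j \<bullet> f) (y # \<rho> \<restriction> f)"
    using homs f y by (intro stage_Cons stage_comp[OF stage]) simp_all
  have ge: "op_ge D' (P \<bullet> f) (j \<bullet> f) (j \<bullet> f)"
    using op_ge_comp[OF op_ge_refl[OF _ j] _ _ f] homs by simp
  have "forced N D' (P \<bullet> f) (j \<bullet> f) (y # \<rho> \<restriction> f)
      (LImp (std_lfm (Suc n) \<phi>) (std_lfm (Suc n) (subst_suc \<phi>)))"
    using suc f y ge unfolding std.simps forced_LAll[OF stage wf_imp] by blast
  then have "forced N D' (P \<bullet> f) (j \<bullet> f) (y # \<rho> \<restriction> f) (std_lfm (Suc n) (subst_suc \<phi>))"
    using forced_LImpD[OF stage'] wfs length_\<rho> ge \<phi> by simp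
  then show "forced N D' (P \<bullet> f) (j \<bullet> f) ((s \<bullet> y) # \<rho> \<restriction> f) (std_lfm (Suc n) \<phi>)"
    using force_val_subst_suc[OF wf stage'] length_\<rho> by simp
qed (rule x)

lemma valid_induction:
  assumes wf: "afm_wf (Suc n) \<phi>"
  shows "valid n (AImp (AAnd (subst_zero \<phi>) (AAll (AImp \<phi> (subst_suc \<phi>)))) (AAll \<phi>))"
    (is "valid n (AImp (AAnd ?zero ?suc) (AAll \<phi>))")
  unfolding valid_def std.simps(5)
proof (intro allI impI)
  fix D P j \<rho> assume stage: "stage N D P j \<rho>" and length_\<rho>: "length \<rho> = n" and P: "infl_monos D P"
  have "afm_wf n (AImp (AAnd ?zero ?suc) (AAll \<phi>))"
    by (rule HA_axiom_wf[OF HA_axiom.induction[OF wf]])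
  then have "afm_wf n ?zero" "afm_wf n ?suc" "afm_wf n (AAnd ?zero ?suc)" "afm_wf n (AAll \<phi>)"
    unfolding afm_wf.simps(3,5) by blast+
  then have wfs: "lfm_wf N (length \<rho>) (std_lfm n ?zero)" "lfm_wf N (length \<rho>) (std_lfm n ?suc)"
      "lfm_wf N (length \<rho>) (std_lfm n (AAnd ?zero ?suc))" "lfm_wf N (length \<rho>) (std_lfm n (AAll \<phi>))"
    unfolding length_\<rho> by (simp_all only: lfm_wf_std)
  from stage P wfs(3,4)
  show "forced N D P j \<rho> (LImp (std_lfm n (AAnd ?zero ?suc)) (std_lfm n (AAll \<phi>)))"
  proof (rule forced_LImpI)
    fix D1 f k assume stage1: "stage N D1 (P \<bullet> f) k (\<rho> \<restriction> f)" and P1: "infl_monos D1 (P \<bullet> f)"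
      and antecedent: "forced N D1 (P \<bullet> f) k (\<rho> \<restriction> f) (std_lfm n (AAnd ?zero ?suc))"
    have "lfm_wf N (Suc (length (\<rho> \<restriction> f))) (std_lfm (Suc n) \<phi>)" using wfs(4) by simp
    with stage1 P1 show "forced N D1 (P \<bullet> f) k (\<rho> \<restriction> f) (std_lfm n (AAll \<phi>))"
      unfolding std.simps(7)
    proof (rule forced_LAllI)
      let ?P = "\<lambda>g. (P \<bullet> f) \<bullet> g" and ?\<rho> = "\<lambda>g. \<rho> \<restriction> f \<restriction> g"
      fix D2 g l x assume g: "g \<in> Hom E D2 D1" and l: "op_ge D2 (?P g) (k \<bullet> g) l"
        and x: "x \<in> Hom E D2 N"
        and stage2: "stage N D2 (?P g) l (?\<rho> g)" and P2: "infl_monos D2 (?P g)"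
      have stage_k: "stage N D2 (?P g) (k \<bullet> g) (?\<rho> g)"
        using stageD[OF stage1] g by (intro stage_comp[OF stage1]) simp_all
      have "forced N D2 (?P g) (k \<bullet> g) (?\<rho> g) (std_lfm n (AAnd ?zero ?suc))"
        by (rule forced_comp[OF stage1 _ g antecedent]) (use wfs(3) in simp)
      then have "forced N D2 (?P g) l (?\<rho> g) (std_lfm n (AAnd ?zero ?suc))"
        by (rule forced_mono[OF _ stage_k P2 l, rotated]) (use wfs(3) in simp)
      then have conjuncts: "forced N D2 (?P g) l (?\<rho> g) (std_lfm n ?zero)"
        "forced N D2 (?P g) l (?\<rho> g) (std_lfm n ?suc)"
        using forced_LAnd[OF stage2, of "std_lfm n ?zero" "std_lfm n ?suc"] wfs(1,2)
        by (simp_all del: std.simps(7) force_val.simps)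
      show "forced N D2 (?P g) l (x # ?\<rho> g) (std_lfm (Suc n) \<phi>)"
        by (rule forced_induction[OF wf stage2 _ _ conjuncts x])
          (use l length_\<rho> in \<open>simp_all add: op_ge_def\<close>)
    qed
  qed
qed

lemma valid_HA_axiom: "HA_axiom n \<phi> \<Longrightarrow> valid n \<phi>"
proof (induction rule: HA_axiom.induct)
  case (succ_nonzero n)
  show ?case by (rule valid_succ_nonzero)
next
  case (proj_eq m i n)
  note wf = HA_axiom_wf[OF HA_axiom.proj_eq[OF proj_eq]]
  have args: "atm_wf n (AFun (PProj m i) (vars 0 m))" "vars 0 m ! i = AVar i"
    using wf proj_eq(1) by (simp_all add: vars_def)
  show ?case by (rule valid_AEq[OF wf]) (rule tval_PProj[OF _ _ args(1), unfolded args(2)])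
next
  case (comp_eq m f gs n)
  note wf = HA_axiom_wf[OF HA_axiom.comp_eq[OF comp_eq]]
  have "atm_wf n (AFun (PComp m f gs) (vars 0 m))" using wf unfolding afm_wf.simps ..
  then show ?case by (intro valid_AEq[OF wf] tval_PComp)
next
  case (rec_zero f g n)
  note wf = HA_axiom_wf[OF HA_axiom.rec_zero[OF rec_zero]]
  have args: "length (vars 0 (arity f)) = arity f" "\<forall>t\<in>set (vars 0 (arity f)). atm_wf n t"
    using wf by simp_all
  show ?case by (rule valid_AEq[OF wf]) (rule tval_PRec_AZero[OF _ _ rec_zero(1) args])
next
  case (rec_suc f g n)
  note wf = HA_axiom_wf[OF HA_axiom.rec_suc[OF rec_suc]]
  have args: "length (vars 1 (arity f)) = arity f"
    "\<forall>t\<in>set (vars 1 (arity f)). atm_wf n t" "atm_wf n (AVar 0)"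
    using wf by simp_all
  show ?case by (rule valid_AEq[OF wf]) (rule tval_PRec_ASuc[OF _ _ rec_suc(1) args])
next
  case (induction n \<phi>)
  then show ?case by (rule valid_induction)
next
  case (gen n \<phi>)
  then show ?case using valid_gen HA_axiom_wf by blast
qed

lemma holds_valid:
  assumes wf: "afm_wf n \<phi>" and valid: "valid n \<phi>"
  shows "holds E (replicate n N)
    (TAll PP\<Omega> (TImp (sub_Lop E 0) (TAll P\<Omega> (TImp (TMem (TVar 0) (Lop E))
      (force E N 1 0 (\<lambda>i. i + 2) (std_lfm n \<phi>))))))"
proof (rule holdsI)
  let ?force = "force E N 1 0 (\<lambda>i. i + 2) (std_lfm n \<phi>)"
  have typed: "typed E (P\<Omega> # PP\<Omega> # replicate n N) ?force \<Omega>"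
    by (rule typed_force[OF lfm_wf_std[OF wf]]) (simp add: force_scope_def)
  then show "typed E (replicate n N)
      (TAll PP\<Omega> (TImp (sub_Lop E 0) (TAll P\<Omega> (TImp (TMem (TVar 0) (Lop E)) ?force)))) \<Omega>"
    by simp
  fix D \<rho> assume env: "env D \<rho>" and types: "types \<rho> = replicate n N"
  have "holds_at D2 (j # P \<bullet> g # \<rho> \<restriction> f \<restriction> g) ?force"
    if f: "f \<in> Hom E D1 D" and P: "P \<in> Hom E D1 PP\<Omega>"
      and P_Lop: "holds_at D1 (P # \<rho> \<restriction> f) (sub_Lop E 0)"
      and g: "g \<in> Hom E D2 D1" and j: "j \<in> Hom E D2 P\<Omega>"
      and j_Lop: "holds_at D2 (j # P \<bullet> g # \<rho> \<restriction> f \<restriction> g) (TMem (TVar 0) (Lop E))" for D1 f P D2 g j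
  proof -
    have env2: "env D2 (j # P \<bullet> g # \<rho> \<restriction> f \<restriction> g)" using env f P g j by simp
    have "infl_monos D1 P" using infl_monos_if_sub_Lop[of D1 "P # \<rho> \<restriction> f" 0] env f P P_Lop by simp
    then have "infl_monos D2 (P \<bullet> g)" using P g by (rule infl_monos_comp)
    moreover have "infl_mono D2 j" using infl_mono_if_mem_Lop[OF env2, of 0] j j_Lop by simp
    moreover have "stage N D2 (P \<bullet> g) j (\<rho> \<restriction> f \<restriction> g)" "length (\<rho> \<restriction> f \<restriction> g) = n"
      using env types length_env[OF env types] f P g j by (simp_all add: stage_def)
    ultimately show ?thesis
      using valid val_force_stage(2)[of N D2 "P \<bullet> g" j "\<rho> \<restriction> f \<restriction> g" "std_lfm n \<phi>"] lfm_wf_std[OF wf]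
      unfolding valid_def by simp
  qed
  then show "holds_at D \<rho>
      (TAll PP\<Omega> (TImp (sub_Lop E 0) (TAll P\<Omega> (TImp (TMem (TVar 0) (Lop E)) ?force))))"
    using env types typed by (simp add: holds_at_TAll_TImp)
qed auto

end

theorem theorem4p17:
  fixes E :: "('o, 'a) topos" and N :: 'o and z s :: 'a and n :: nat and \<phi> :: afm
  assumes "elementary_topos E"
    and "nno E N z s"
    and "HA_axiom n \<phi>"
  shows "holds E (replicate n N)
    (TAll (pw E (pw E (Omega E))) (TImp (sub_Lop E 0)
      (TAll (pw E (Omega E)) (TImp (TMem (TVar 0) (Lop E))
        (force E N 1 0 (\<lambda>i. i + 2) (std E N z s n \<phi>))))))"
proof -
  interpret topos_nno E N z s
    using assms(1,2) by (intro topos_nno.intro topos_nno_axioms.intro)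
  show ?thesis
    using HA_axiom_wf[OF assms(3)] valid_HA_axiom[OF assms(3)] by (rule holds_valid)
qed

end
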